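(* Let $n\ge1$, $\gamma>0$ and $0<\sigma<\gamma$. (i) On the homogeneous scale, $$\|f\|_{\dot\Lambda^\gamma}\asymp\||D|^\sigma f\|_{\dot\Lambda^{\gamma-\sigma}}.$$ Equivalently, if $g=|D|^\sigma f$, then $\||D|^{-\sigma}g\|_{\dot\Lambda^\gamma}\asymp\|g\|_{\dot\Lambda^{\gamma-\sigma}}$. (ii) On the inhomogeneous scale, $$\|f\|_{\Lambda^\gamma}\asymp\|\langle D\rangle^\sigma f\|_{\Lambda^{\gamma-\sigma}}.$$ Equivalently, if $g=\langle D\rangle^\sigma f$, then $\|\langle D\rangle^{-\sigma}g\|_{\Lambda^\gamma}\asymp\|g\|_{\Lambda^{\gamma-\sigma}}$.
   Context: $\widehat f$ is the Fourier transform with kernel $e^{-2\pi ix\cdot\xi}$ on $\mathbb{R}^n$, $\vee$ its inverse. For real $\sigma$, $|D|^\sigma f:=(|\xi|^\sigma\widehat f)^\vee$ and $\langle D\rangle^\sigma f:=((1+|\xi|^2)^{\sigma/2}\widehat f)^\vee$. Littlewood--Paley operators: fix $\varphi\in C_c^\infty(\mathbb{R}^n\setminus\{0\})$ supported in $\{\frac12\le|\xi|\le2\}$ with $\sum_{j\in\mathbb{Z}}\varphi(2^{-j}\xi)=1$ for $\xi\ne0$, and $\chi\in C_c^\infty(\mathbb{R}^n)$ supported in $\{|\xi|\le2\}$ and equal to $1$ on $\{|\xi|\le1\}$; $\Delta_jf:=(\varphi(2^{-j}\cdot)\widehat f)^\vee$, $S_0f:=(\chi\widehat f)^\vee$. For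 $\gamma>0$ the homogeneous and inhomogeneous Lipschitz norms are taken, up to equivalence, in their Littlewood--Paley form $$\|f\|_{\dot\Lambda^\gamma}\asymp\sup_{j\in\mathbb{Z}}2^{j\gamma}\|\Delta_jf\|_{L^\infty},\qquad\|f\|_{\Lambda^\gamma}\asymp\|S_0f\|_{L^\infty}+\sup_{j\ge0}2^{j\gamma}\|\Delta_jf\|_{L^\infty}.$$ In (i), $f$ and $g$ range over tempered distributions modulo polynomials (where $|D|^{\pm\sigma}$ is well defined); in (ii), $f$ and $g$ range over $\mathcal S'(\mathbb{R}^n)$. $A\asymp B$ means $cA\le B\le CA$ with constants $c,C>0$ independent of $f$ (or $g$), both sides possibly infinite. *)

theory Defs
  imports "HOL-Analysis.Analysis" "HOL-Probability.Essential_Supremum"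
begin

section \<open>Schwartz functions\<close>

text \<open>The role of the space of dimension n is played by an arbitrary type of class
  \<open>euclidean_space\<close>; its dimension is automatically at least 1.\<close>

definition partial_deriv :: "'a::euclidean_space \<Rightarrow> ('a \<Rightarrow> complex) \<Rightarrow> 'a \<Rightarrow> complex" where
  "partial_deriv b f = (\<lambda>x. frechet_derivative f (at x) b)"

text \<open>Iterated partial derivative along a list of basis vectors (a multi-index, with order).\<close>

definition iter_partial :: "'a::euclidean_space list \<Rightarrow> ('a \<Rightarrow> complex) \<Rightarrow> 'a \<Rightarrow> complex" where
  "iter_partial bs f = foldr partial_deriv bs f"

definition smooth :: "('a::euclidean_space \<Rightarrow> complex) \<Rightarrow> bool" where
  "smooth f \<longleftrightarrow> (\<forall>bs. set bs \<subseteq> Basis \<longrightarrow> (\<forall>x. iter_partial bs f differentiable (at x)))"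

definition schwartz :: "('a::euclidean_space \<Rightarrow> complex) set" where
  "schwartz = {f. smooth f \<and>
     (\<forall>N bs. set bs \<subseteq> Basis \<longrightarrow> bounded (range (\<lambda>x. (1 + norm x) ^ N *\<^sub>R iter_partial bs f x)))}"

definition schwartz_norm :: "nat \<Rightarrow> ('a::euclidean_space \<Rightarrow> complex) \<Rightarrow> real" where
  "schwartz_norm N f =
     (\<Sum>bs \<in> {bs. set bs \<subseteq> Basis \<and> length bs \<le> N}. SUP x. (1 + norm x) ^ N * norm (iter_partial bs f x))"

text \<open>Schwartz functions vanishing to infinite order at the origin.\<close>

definition schwartz_flat :: "('a::euclidean_space \<Rightarrow> complex) set" where
  "schwartz_flat = {f \<in> schwartz. \<forall>bs. set bs \<subseteq> Basis \<longrightarrow> iter_partial bs f 0 = 0}"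

definition fourier :: "('a::euclidean_space \<Rightarrow> complex) \<Rightarrow> 'a \<Rightarrow> complex" where
  "fourier f \<xi> = (LINT x|lborel. cis (- 2 * pi * (x \<bullet> \<xi>)) * f x)"

definition inv_fourier :: "('a::euclidean_space \<Rightarrow> complex) \<Rightarrow> 'a \<Rightarrow> complex" where
  "inv_fourier f x = (LINT \<xi>|lborel. cis (2 * pi * (x \<bullet> \<xi>)) * f \<xi>)"

section \<open>Tempered distributions\<close>

text \<open>A tempered distribution is a continuous linear functional on the Schwartz space. It is
  represented by a functional on all functions, of which only the values on \<open>schwartz\<close> matter.\<close>

type_synonym 'a functional = "('a \<Rightarrow> complex) \<Rightarrow> complex"

definition tempered :: "'a::euclidean_space functional set" where
  "tempered = {u.
     (\<forall>\<phi>\<in>schwartz. \<forall>\<psi>\<in>schwartz. u (\<lambda>x. \<phi> x + \<psi> x) = u \<phi> + u \<psi>) \<and>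
     (\<forall>c. \<forall>\<phi>\<in>schwartz. u (\<lambda>x. c * \<phi> x) = c * u \<phi>) \<and>
     (\<exists>C N. \<forall>\<phi>\<in>schwartz. norm (u \<phi>) \<le> C * schwartz_norm N \<phi>)}"

definition regular_dist :: "('a::euclidean_space \<Rightarrow> complex) \<Rightarrow> 'a functional" where
  "regular_dist h = (\<lambda>\<psi>. LINT x|lborel. h x * \<psi> x)"

definition fourier_dist :: "'a::euclidean_space functional \<Rightarrow> 'a functional" where
  "fourier_dist u = (\<lambda>\<psi>. u (fourier \<psi>))"

definition inv_fourier_dist :: "'a::euclidean_space functional \<Rightarrow> 'a functional" where
  "inv_fourier_dist u = (\<lambda>\<psi>. u (inv_fourier \<psi>))"

definition mult_dist :: "('a::euclidean_space \<Rightarrow> complex) \<Rightarrow> 'a functional \<Rightarrow> 'a functional" where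
  "mult_dist m u = (\<lambda>\<psi>. u (\<lambda>\<xi>. m \<xi> * \<psi> \<xi>))"

definition fourier_multiplier :: "('a::euclidean_space \<Rightarrow> complex) \<Rightarrow> 'a functional \<Rightarrow> 'a functional" where
  "fourier_multiplier m u = inv_fourier_dist (mult_dist m (fourier_dist u))"

text \<open>The essential supremum norm of a distribution; it is infinite if the distribution is not
  given by a bounded measurable function.\<close>

definition Linf_norm :: "'a::euclidean_space functional \<Rightarrow> ennreal" where
  "Linf_norm u =
     (INF h \<in> {h \<in> borel_measurable lborel. \<forall>\<psi>\<in>schwartz. u \<psi> = regular_dist h \<psi>}.
        esssup lborel (\<lambda>x. ennreal (norm (h x))))"

section \<open>Littlewood--Paley operators and the inhomogeneous scale\<close>

text \<open>The low-frequency cutoff is called \<open>\<eta>\<close> (the usual letter chi is a binder).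
  The support conditions on \<open>\<phi>\<close> and \<open>\<eta>\<close> refer to closed sets, so it is enough to
  state them for the points where the functions do not vanish; compactness of the supports follows.\<close>

definition lp_annulus :: "('a::euclidean_space \<Rightarrow> complex) \<Rightarrow> bool" where
  "lp_annulus \<phi> \<longleftrightarrow> smooth \<phi> \<and>
     (\<forall>\<xi>. \<phi> \<xi> \<noteq> 0 \<longrightarrow> 1/2 \<le> norm \<xi> \<and> norm \<xi> \<le> 2) \<and>
     (\<forall>\<xi>. \<xi> \<noteq> 0 \<longrightarrow> ((\<lambda>j::int. \<phi> ((2 powi (- j)) *\<^sub>R \<xi>)) has_sum 1) UNIV)"

definition lp_ball :: "('a::euclidean_space \<Rightarrow> complex) \<Rightarrow> bool" where
  "lp_ball \<eta> \<longleftrightarrow> smooth \<eta> \<and>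
     (\<forall>\<xi>. \<eta> \<xi> \<noteq> 0 \<longrightarrow> norm \<xi> \<le> 2) \<and> (\<forall>\<xi>. norm \<xi> \<le> 1 \<longrightarrow> \<eta> \<xi> = 1)"

definition lp_block :: "('a::euclidean_space \<Rightarrow> complex) \<Rightarrow> int \<Rightarrow> 'a functional \<Rightarrow> 'a functional" where
  "lp_block \<phi> j = fourier_multiplier (\<lambda>\<xi>. \<phi> ((2 powi (- j)) *\<^sub>R \<xi>))"

definition lp_low :: "('a::euclidean_space \<Rightarrow> complex) \<Rightarrow> 'a functional \<Rightarrow> 'a functional" where
  "lp_low \<eta> = fourier_multiplier \<eta>"

definition inhom_lip_norm ::
  "('a::euclidean_space \<Rightarrow> complex) \<Rightarrow> ('a \<Rightarrow> complex) \<Rightarrow> real \<Rightarrow> 'a functional \<Rightarrow> ennreal" where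
  "inhom_lip_norm \<phi> \<eta> \<gamma> f =
     Linf_norm (lp_low \<eta> f) +
     (SUP j\<in>{0::int..}. ennreal (2 powr (of_int j * \<gamma>)) * Linf_norm (lp_block \<phi> j f))"

definition bessel_op :: "real \<Rightarrow> 'a::euclidean_space functional \<Rightarrow> 'a functional" where
  "bessel_op s = fourier_multiplier (\<lambda>\<xi>. of_real ((1 + (norm \<xi>)\<^sup>2) powr (s / 2)))"

section \<open>Tempered distributions modulo polynomials and the homogeneous scale\<close>

definition poly_equiv :: "('a::euclidean_space functional \<times> 'a functional) set" where
  "poly_equiv = {(f, g). f \<in> tempered \<and> g \<in> tempered \<and>
     (\<exists>p. polynomial_function p \<and> (\<forall>\<psi>\<in>schwartz. f \<psi> - g \<psi> = regular_dist p \<psi>))}"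

definition tempered_mod_poly :: "'a::euclidean_space functional set set" where
  "tempered_mod_poly = tempered // poly_equiv"

text \<open>\<open>|D|\<close> to the power \<open>s\<close>, on classes modulo polynomials. For \<open>f\<close> tempered, the product of
  \<open>|\<xi>|\<close> to the power \<open>s\<close> with the Fourier transform of \<open>f\<close> is defined only as a functional on
  Schwartz functions that vanish to infinite order at the origin. It determines \<open>g\<close> up to
  distributions whose Fourier transform is supported at the origin, that is, up to polynomials,
  so that the value of the operator at the class of \<open>f\<close> is the class of all such \<open>g\<close>.\<close>

definition riesz_op :: "real \<Rightarrow> 'a::euclidean_space functional set \<Rightarrow> 'a functional set" where
  "riesz_op s F = {g \<in> tempered. \<exists>f\<in>F. \<forall>\<psi>\<in>schwartz_flat.
     fourier_dist g \<psi> = mult_dist (\<lambda>\<xi>. of_real (norm \<xi> powr s)) (fourier_dist f) \<psi>}"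

text \<open>The Littlewood--Paley blocks annihilate polynomials, so the supremum has the same value for
  all representatives of a class; \<open>the_elem\<close> selects this common value.\<close>

definition hom_lip_norm ::
  "('a::euclidean_space \<Rightarrow> complex) \<Rightarrow> real \<Rightarrow> 'a functional set \<Rightarrow> ennreal" where
  "hom_lip_norm \<phi> \<gamma> F = the_elem
     ((\<lambda>f. SUP j::int. ennreal (2 powr (of_int j * \<gamma>)) * Linf_norm (lp_block \<phi> j f)) ` F)"

section \<open>Comparability with constants\<close>

definition comparable_on :: "'b set \<Rightarrow> ('b \<Rightarrow> ennreal) \<Rightarrow> ('b \<Rightarrow> ennreal) \<Rightarrow> bool" where
  "comparable_on X A B \<longleftrightarrow>
     (\<exists>c C::real. 0 < c \<and> 0 < C \<and> (\<forall>f\<in>X. ennreal c * A f \<le> B f \<and> B f \<le> ennreal C * A f))"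

end

theory Submission
  imports Defs "HOL-Probability.Probability"
begin

text \<open>For a multiplier \<open>m\<close> in the Schwartz space, Young's inequality bounds the norm of the corresponding
  operator on bounded functions by the \<open>L\<^sup>1\<close> norm of the Fourier transform of \<open>m\<close>, and this bound is
  invariant under dilations of \<open>m\<close>. On the block \<open>\<Delta>\<^sub>j\<close> a potential of order \<open>s\<close> acts like the multiplier
  \<open>2 ^ (j s)\<close> times a dilate of \<open>(e\<^sup>2 + |\<xi>|\<^sup>2) ^ (s / 2)\<close> cut off to an annulus, with \<open>e = 0\<close> for \<open>|D|\<close> and
  \<open>e = 2 ^ -j\<close> for \<open>\<langle>D\<rangle>\<close>; these symbols are bounded in the Schwartz space uniformly in \<open>e \<in> [0, 1]\<close>. Applying
  this to the orders \<open>s\<close> and \<open>-s\<close> gives both inequalities. On the homogeneous scale one also needs that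
  \<open>|D|\<close> to the power \<open>s\<close> is defined on every class modulo polynomials, which follows from the
  Hahn--Banach theorem, and that blocks annihilate polynomials.\<close>

section \<open>Partial derivatives\<close>

text \<open>A distribution is accessible only through its values on Schwartz functions, so a
  multiplier acts by transposition, and two multipliers are composed only when the intermediate test
  function is Schwartz. The power of |\<xi>| is therefore never applied to a representative: it is
  absorbed into the symbol of a block, where the annulus removes the singularity at the origin. All
  estimates compare weighted blocks of orders s and s + t. Read from (\<gamma>, 0) with t =
  \<sigma>, and from (\<gamma> - \<sigma>, \<sigma>) with t = -\<sigma>, the same estimate leads
  away from the starting norm and back to it, so no inverse operator enters. The low-frequency term
  has its own splitting: \<eta> is \<eta>^2 plus a remainder living on the shell 1 < |\<xi>| \<le>
  2, where the blocks 0, 1, 2 sum to 1. The homogeneous norm of a class is the common value over its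
  representatives, so the class of |D|^s f has to be shown inhabited; its defining condition
  prescribes a functional on flat test functions only, which is where an extension theorem is
  required.\<close>

lemma partial_deriv_eqI: "(f has_derivative f') (at x) \<Longrightarrow> partial_deriv b f x = f' b"
  unfolding partial_deriv_def using frechet_derivative_at by metis

lemma differentiable_has_derivative:
  assumes "f differentiable (at x)"
  shows "(f has_derivative (\<lambda>h. frechet_derivative f (at x) h)) (at x)"
  using assms frechet_derivative_works by auto

text \<open>By linearity the coordinate partials determine the derivative in every direction. This
  is used for radial directions, which are not basis vectors, in
  \<open>flat_family_taylor\<close>.\<close>

lemma has_derivative_partial_deriv:
  fixes f :: "'a::euclidean_space \<Rightarrow> complex"
  assumes "f differentiable (at x)"
  shows "(f has_derivative (\<lambda>h. \<Sum>b\<in>Basis. (h \<bullet> b) *\<^sub>R partial_deriv b f x)) (at x)"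
proof -
  have lin: "linear (frechet_derivative f (at x))"
    using assms linear_frechet_derivative by blast
  have "frechet_derivative f (at x) h = (\<Sum>b\<in>Basis. (h \<bullet> b) *\<^sub>R partial_deriv b f x)" for h
  proof -
    have "frechet_derivative f (at x) (\<Sum>b\<in>Basis. (h \<bullet> b) *\<^sub>R b) =
        (\<Sum>b\<in>Basis. (h \<bullet> b) *\<^sub>R partial_deriv b f x)"
      by (simp add: linear_sum[OF lin] linear_cmul[OF lin] partial_deriv_def)
    then show ?thesis by (simp add: euclidean_representation)
  qed
  then show ?thesis using differentiable_has_derivative[OF assms] by simp
qed

lemma partial_deriv_add:
  assumes "f differentiable (at x)" "g differentiable (at x)"
  shows "partial_deriv b (\<lambda>x. f x + g x) x = partial_deriv b f x + partial_deriv b g x"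
  using partial_deriv_eqI[OF has_derivative_add[OF assms[THEN differentiable_has_derivative]]]
  by (simp add: partial_deriv_def)

lemma partial_deriv_mult:
  assumes "f differentiable (at x)" "g differentiable (at x)"
  shows "partial_deriv b (\<lambda>x. f x * g x) x = partial_deriv b f x * g x + f x * partial_deriv b g x"
  using partial_deriv_eqI[OF has_derivative_mult[OF assms[THEN differentiable_has_derivative]]]
  by (simp add: partial_deriv_def)

lemma partial_deriv_const: "partial_deriv b (\<lambda>x. c) = (\<lambda>x. 0)"
  by (rule ext, rule partial_deriv_eqI[of _ "\<lambda>_. 0", simplified]) auto

lemma partial_deriv_cmult:
  assumes "f differentiable (at x)"
  shows "partial_deriv b (\<lambda>x. c * f x) x = c * partial_deriv b f x"
  using partial_deriv_mult[of "\<lambda>_. c" x f b] assms by (simp add: partial_deriv_const)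

lemma partial_deriv_coord:
  "partial_deriv b (\<lambda>x. complex_of_real (x \<bullet> c)) x = of_real (b \<bullet> c)"
  by (rule partial_deriv_eqI) (auto intro!: derivative_eq_intros)

lemma differentiable_coord [simp]: "(\<lambda>x. complex_of_real (x \<bullet> c)) differentiable (at x)"
  unfolding differentiable_def by (rule exI) (auto intro!: derivative_eq_intros)

lemma partial_deriv_eq_0:
  assumes "open U" "x \<in> U" "\<And>y. y \<in> U \<Longrightarrow> f y = 0"
  shows "f differentiable (at x)" "partial_deriv b f x = 0"
proof -
  have *: "(f has_derivative (\<lambda>_. 0)) (at x)"
    by (rule has_derivative_transform_within_open[of "\<lambda>_. 0" _ x UNIV U]) (use assms in auto)
  show "f differentiable (at x)" "partial_deriv b f x = 0"
    using * partial_deriv_eqI[OF *] differentiableI by blast+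
qed

text \<open>Off a closed set the function vanishes on an open neighbourhood, so differentiation does
  not enlarge a closed support.\<close>

lemma partial_deriv_supp:
  assumes "closed K" "\<And>y. f y \<noteq> 0 \<Longrightarrow> y \<in> K" "partial_deriv b f x \<noteq> 0"
  shows "x \<in> K"
  using partial_deriv_eq_0(2)[of "- K" x f b] assms by (auto simp: open_Compl)

lemma iter_partial_Nil [simp]: "iter_partial [] f = f"
  by (simp add: iter_partial_def)

lemma iter_partial_Cons [simp]: "iter_partial (b # bs) f = partial_deriv b (iter_partial bs f)"
  by (simp add: iter_partial_def)

lemma iter_partial_snoc: "iter_partial (bs @ [b]) f = iter_partial bs (partial_deriv b f)"
  by (simp add: iter_partial_def)

lemma smooth_differentiable: "smooth f \<Longrightarrow> f differentiable (at x)"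
  unfolding smooth_def by (drule spec[of _ "[]"]) simp

section \<open>Uniformly Schwartz families\<close>

text \<open>A family \<open>T i\<close>, \<open>i \<in> I\<close>, of functions is controlled by a scale \<open>\<rho> 0 \<le> \<rho> 1 \<le> \<dots>\<close> of
  weights on \<open>I\<close> if every Schwartz seminorm of \<open>T i\<close> is at most \<open>C * \<rho> M i\<close> for some \<open>C\<close> and \<open>M\<close>.
  For \<open>\<rho> = 1\<close> this is a bound which is uniform in a parameter; for \<open>I\<close> a set of Schwartz functions
  and \<open>\<rho>\<close> the Schwartz norms it expresses that \<open>T\<close> is a continuous operator.\<close>

locale scale =
  fixes I :: "'i set" and \<rho> :: "nat \<Rightarrow> 'i \<Rightarrow> real"
  assumes scale_nonneg: "i \<in> I \<Longrightarrow> 0 \<le> \<rho> M i"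
    and scale_mono: "i \<in> I \<Longrightarrow> M \<le> M' \<Longrightarrow> \<rho> M i \<le> \<rho> M' i"
begin

text \<open>The index \<open>M\<close> is chosen together with \<open>C\<close>, before
  \<open>i\<close> and \<open>x\<close>: an operation may lose finitely many orders of the scale.
  Keeping \<open>C\<close> nonnegative allows \<open>M\<close> to be raised by
  \<open>scale_mono\<close>, so that two bounds can be merged.\<close>

definition bd :: "('i \<Rightarrow> 'b \<Rightarrow> real) \<Rightarrow> bool" where
  "bd f \<longleftrightarrow> (\<exists>C\<ge>0. \<exists>M. \<forall>i\<in>I. \<forall>x. f i x \<le> C * \<rho> M i)"

lemma bdI: "0 \<le> C \<Longrightarrow> (\<And>i x. i \<in> I \<Longrightarrow> f i x \<le> C * \<rho> M i) \<Longrightarrow> bd f"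
  unfolding bd_def by blast

lemma bd_mono:
  assumes "bd g" "\<And>i x. i \<in> I \<Longrightarrow> f i x \<le> g i x" shows "bd f"
  using assms unfolding bd_def by (meson order_trans)

lemma bd_add:
  assumes "bd f" "bd g" shows "bd (\<lambda>i x. f i x + g i x)"
proof -
  obtain C M where 1: "C \<ge> 0" "\<And>i x. i \<in> I \<Longrightarrow> f i x \<le> C * \<rho> M i"
    using assms(1) unfolding bd_def by blast
  obtain D N where 2: "D \<ge> 0" "\<And>i x. i \<in> I \<Longrightarrow> g i x \<le> D * \<rho> N i"
    using assms(2) unfolding bd_def by blast
  show ?thesis
  proof (rule bdI[of "C + D" _ "max M N"])
    fix i x assume i: "i \<in> I"
    have "C * \<rho> M i \<le> C * \<rho> (max M N) i" "D * \<rho> N i \<le> D * \<rho> (max M N) i"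
      using 1(1) 2(1) by (auto intro!: mult_left_mono scale_mono i)
    then show "f i x + g i x \<le> (C + D) * \<rho> (max M N) i"
      using 1(2)[OF i, of x] 2(2)[OF i, of x] by (simp add: algebra_simps)
  qed (use 1 2 in simp)
qed

lemma bd_cmult:
  assumes "bd f" "0 \<le> c" shows "bd (\<lambda>i x. c * f i x)"
proof -
  obtain C M where 1: "C \<ge> 0" "\<And>i x. i \<in> I \<Longrightarrow> f i x \<le> C * \<rho> M i"
    using assms(1) unfolding bd_def by blast
  show ?thesis
    by (rule bdI[of "c * C" _ M]) (use 1 assms in \<open>auto intro: mult_left_mono simp: mult.assoc\<close>)
qed

lemma bd_sum:
  assumes "finite A" "\<And>a. a \<in> A \<Longrightarrow> bd (f a)" shows "bd (\<lambda>i x. \<Sum>a\<in>A. f a i x)"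
  using assms
proof (induction A rule: finite_induct)
  case empty
  show ?case by (rule bdI[of 0 _ 0]) auto
next
  case (insert a A)
  then show ?case using bd_add[of "f a" "\<lambda>i x. \<Sum>a\<in>A. f a i x"] by simp
qed

definition rapid :: "('i \<Rightarrow> 'a::euclidean_space \<Rightarrow> complex) \<Rightarrow> bool" where
  "rapid T \<longleftrightarrow> (\<forall>N. bd (\<lambda>i x. (1 + norm x) ^ N * norm (T i x)))"

text \<open>Here the derivative is applied to \<open>T\<close> itself, whereas
  \<open>iter_partial\<close> adds new derivatives on the outside. This order makes closure under
  sums, products and the Fourier transform a plain induction on \<open>k\<close> with the family
  generalised.\<close>

primrec fam :: "nat \<Rightarrow> ('i \<Rightarrow> 'a::euclidean_space \<Rightarrow> complex) \<Rightarrow> bool" where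
  "fam 0 T = rapid T"
| "fam (Suc k) T = (rapid T \<and> (\<forall>i\<in>I. \<forall>x. T i differentiable (at x)) \<and>
     (\<forall>b\<in>Basis. fam k (\<lambda>i. partial_deriv b (T i))))"

definition schwartz_fam :: "('i \<Rightarrow> 'a::euclidean_space \<Rightarrow> complex) \<Rightarrow> bool" where
  "schwartz_fam T \<longleftrightarrow> (\<forall>k. fam k T)"

lemma rapidD: "rapid T \<Longrightarrow> bd (\<lambda>i x. (1 + norm x) ^ N * norm (T i x))"
  by (simp add: rapid_def)

lemma fam_rapid: "fam k T \<Longrightarrow> rapid T"
  by (cases k) auto

lemma fam_SucD: "fam (Suc k) T \<Longrightarrow> fam k T"
  by (induction k arbitrary: T) auto

lemma rapid_cong: "(\<And>i x. i \<in> I \<Longrightarrow> S i x = T i x) \<Longrightarrow> rapid S \<Longrightarrow> rapid T"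
  unfolding rapid_def by (metis (no_types, lifting) bd_mono order_refl)

lemma fam_cong: "(\<And>i x. i \<in> I \<Longrightarrow> S i x = T i x) \<Longrightarrow> fam k S \<Longrightarrow> fam k T"
proof (induction k arbitrary: S T)
  case 0
  then show ?case using rapid_cong by auto
next
  case (Suc k)
  have eq: "S i = T i" if "i \<in> I" for i using Suc(2)[OF that] by auto
  have "fam k (\<lambda>i. partial_deriv b (T i))" if "b \<in> Basis" for b
    by (rule Suc.IH[of "\<lambda>i. partial_deriv b (S i)"]) (use Suc(3) eq that in auto)
  moreover have "T i differentiable (at x)" if "i \<in> I" for i x
    using Suc(3) eq[OF that] that by auto
  ultimately show ?case using Suc(3) rapid_cong[of S T] Suc(2) by simp
qed

lemma rapid_add: "rapid S \<Longrightarrow> rapid T \<Longrightarrow> rapid (\<lambda>i x. S i x + T i x)"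
  unfolding rapid_def
proof
  fix N
  assume "\<forall>N. bd (\<lambda>i x. (1 + norm x) ^ N * norm (S i x))" "\<forall>N. bd (\<lambda>i x. (1 + norm x) ^ N * norm (T i x))"
  then have "bd (\<lambda>i x. (1 + norm x) ^ N * norm (S i x) + (1 + norm x) ^ N * norm (T i x))"
    using bd_add by blast
  then show "bd (\<lambda>i x. (1 + norm x) ^ N * norm (S i x + T i x))"
    by (rule bd_mono) (simp flip: distrib_left add: mult_left_mono norm_triangle_ineq)
qed

lemma fam_add: "fam k S \<Longrightarrow> fam k T \<Longrightarrow> fam k (\<lambda>i x. S i x + T i x)"
proof (induction k arbitrary: S T)
  case 0
  then show ?case using rapid_add by simp
next
  case (Suc k)
  have "fam k (\<lambda>i. partial_deriv b (\<lambda>x. S i x + T i x))" if "b \<in> Basis" for b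
    by (rule fam_cong[OF _ Suc.IH[of "\<lambda>i. partial_deriv b (S i)" "\<lambda>i. partial_deriv b (T i)"]])
      (use Suc that in \<open>auto simp: partial_deriv_add\<close>)
  then show ?case using Suc rapid_add by auto
qed

text \<open>Up to order \<open>k\<close>, these are the multipliers of the Schwartz space: all
  derivatives grow at most polynomially, each with its own exponent.\<close>

primrec slow :: "nat \<Rightarrow> ('a::euclidean_space \<Rightarrow> complex) \<Rightarrow> bool" where
  "slow 0 m = (\<exists>C\<ge>0. \<exists>K. \<forall>x. norm (m x) \<le> C * (1 + norm x) ^ K)"
| "slow (Suc k) m = ((\<exists>C\<ge>0. \<exists>K. \<forall>x. norm (m x) \<le> C * (1 + norm x) ^ K) \<and>
     (\<forall>x. m differentiable (at x)) \<and> (\<forall>b\<in>Basis. slow k (partial_deriv b m)))"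

lemma slow_SucD: "slow (Suc k) m \<Longrightarrow> slow k m"
  by (induction k arbitrary: m) auto

lemma slow_const: "slow k (\<lambda>_. c)"
proof -
  have *: "\<exists>C\<ge>0. \<exists>K. \<forall>x::'b::euclidean_space. norm c \<le> C * (1 + norm x) ^ K" for c :: complex
    by (rule exI[of _ "norm c"]) (simp add: exI[of _ 0])
  show ?thesis
    by (induction k arbitrary: c) (use * in \<open>simp_all add: partial_deriv_const\<close>)
qed

lemma slow_coord: "slow k (\<lambda>x. complex_of_real (x \<bullet> c))"
proof -
  have *: "norm (complex_of_real (x \<bullet> c)) \<le> norm c * (1 + norm x) ^ 1" for x
    using Cauchy_Schwarz_ineq2[of x c] by (simp add: algebra_simps add_increasing)
  then have **: "\<exists>C\<ge>0. \<exists>K. \<forall>x. norm (complex_of_real (x \<bullet> c)) \<le> C * (1 + norm x) ^ K"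
    by (metis norm_ge_zero)
  show ?thesis
  proof (cases k)
    case 0
    then show ?thesis using ** by simp
  next
    case (Suc l)
    have "partial_deriv b (\<lambda>x. complex_of_real (x \<bullet> c)) = (\<lambda>_. of_real (b \<bullet> c))" for b
      by (simp add: partial_deriv_coord fun_eq_iff)
    then show ?thesis using Suc ** slow_const by auto
  qed
qed

lemma rapid_mult:
  assumes "slow 0 m" "rapid T" shows "rapid (\<lambda>i x. m x * T i x)"
  unfolding rapid_def
proof
  fix N
  obtain C K where C: "C \<ge> 0" "\<And>x. norm (m x) \<le> C * (1 + norm x) ^ K"
    using assms(1) by auto
  have "bd (\<lambda>i x. C * ((1 + norm x) ^ (N + K) * norm (T i x)))"
    using bd_cmult[OF rapidD[OF assms(2)] C(1)] .
  then show "bd (\<lambda>i x. (1 + norm x) ^ N * norm (m x * T i x))"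
  proof (rule bd_mono)
    fix i x assume "i \<in> I"
    have "(1 + norm x) ^ N * norm (m x * T i x) = norm (m x) * ((1 + norm x) ^ N * norm (T i x))"
      by (simp add: norm_mult)
    also have "\<dots> \<le> C * (1 + norm x) ^ K * ((1 + norm x) ^ N * norm (T i x))"
      by (intro mult_right_mono C) auto
    finally show "(1 + norm x) ^ N * norm (m x * T i x) \<le> C * ((1 + norm x) ^ (N + K) * norm (T i x))"
      by (simp add: power_add algebra_simps)
  qed
qed

lemma fam_mult: "slow k m \<Longrightarrow> fam k T \<Longrightarrow> fam k (\<lambda>i x. m x * T i x)"
proof (induction k arbitrary: m T)
  case 0
  then show ?case using rapid_mult by simp
next
  case (Suc k)
  have "fam k (\<lambda>i. partial_deriv b (\<lambda>x. m x * T i x))" if "b \<in> Basis" for b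
  proof (rule fam_cong)
    show "fam k (\<lambda>i x. partial_deriv b m x * T i x + m x * partial_deriv b (T i) x)"
      using Suc.prems that fam_SucD[OF Suc.prems(2)] slow_SucD[OF Suc.prems(1)]
      by (intro fam_add Suc.IH) simp_all
    show "partial_deriv b m x * T i x + m x * partial_deriv b (T i) x = partial_deriv b (\<lambda>x. m x * T i x) x"
      if "i \<in> I" for i x
      using that Suc by (auto simp: partial_deriv_mult)
  qed
  moreover have "rapid (\<lambda>i x. m x * T i x)"
    using Suc.prems by (intro rapid_mult) auto
  ultimately show ?case using Suc.prems by simp
qed

lemma schwartz_fam_add: "schwartz_fam S \<Longrightarrow> schwartz_fam T \<Longrightarrow> schwartz_fam (\<lambda>i x. S i x + T i x)"
  unfolding schwartz_fam_def using fam_add by blast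

lemma schwartz_fam_mult: "(\<And>k. slow k m) \<Longrightarrow> schwartz_fam T \<Longrightarrow> schwartz_fam (\<lambda>i x. m x * T i x)"
  unfolding schwartz_fam_def using fam_mult by blast

lemma schwartz_fam_cmult: "schwartz_fam T \<Longrightarrow> schwartz_fam (\<lambda>i x. c * T i x)"
  using schwartz_fam_mult slow_const by blast

lemma schwartz_fam_coord: "schwartz_fam T \<Longrightarrow> schwartz_fam (\<lambda>i x. of_real (x \<bullet> c) * T i x)"
  using schwartz_fam_mult slow_coord by blast

lemma schwartz_fam_sum:
  fixes T :: "'c \<Rightarrow> 'i \<Rightarrow> 'a::euclidean_space \<Rightarrow> complex"
  assumes "finite A" "\<And>a. a \<in> A \<Longrightarrow> schwartz_fam (T a)" shows "schwartz_fam (\<lambda>i x. \<Sum>a\<in>A. T a i x)"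
  using assms
proof (induction A rule: finite_induct)
  case empty
  have "bd (\<lambda>i (x::'a). 0)" by (rule bdI[of 0 _ 0]) auto
  then have "rapid (\<lambda>i (x::'a). 0)" by (simp add: rapid_def)
  then have "fam k (\<lambda>i (x::'a). 0)" for k by (induction k) (auto simp: partial_deriv_const)
  then show ?case by (simp add: schwartz_fam_def)
next
  case (insert a A)
  then show ?case using schwartz_fam_add[of "T a" "\<lambda>i x. \<Sum>a\<in>A. T a i x"] by simp
qed

lemma schwartz_fam_rapid: "schwartz_fam T \<Longrightarrow> rapid T"
  unfolding schwartz_fam_def using fam_rapid by blast

lemma schwartz_fam_differentiable: "schwartz_fam T \<Longrightarrow> i \<in> I \<Longrightarrow> T i differentiable (at x)"
  unfolding schwartz_fam_def by (drule spec[of _ "Suc 0"]) simp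

lemma schwartz_fam_partial_deriv: "schwartz_fam T \<Longrightarrow> b \<in> Basis \<Longrightarrow> schwartz_fam (\<lambda>i. partial_deriv b (T i))"
  unfolding schwartz_fam_def
proof
  fix k assume "\<forall>k. fam k T" "b \<in> Basis"
  then show "fam k (\<lambda>i. partial_deriv b (T i))" using fam.simps(2)[of k T] by blast
qed

lemma schwartz_fam_iter_partial:
  "schwartz_fam T \<Longrightarrow> set bs \<subseteq> Basis \<Longrightarrow> schwartz_fam (\<lambda>i. iter_partial bs (T i))"
  by (induction bs) (auto intro: schwartz_fam_partial_deriv)

text \<open>Generalising from \<open>T i\<close> to \<open>iter_partial bs (T i)\<close> reconciles
  the two orders of differentiation: one more derivative turns \<open>bs\<close> into
  \<open>b # bs\<close>.\<close>

lemma schwartz_famI: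
  assumes "\<And>bs. set bs \<subseteq> Basis \<Longrightarrow> rapid (\<lambda>i. iter_partial bs (T i))"
    and "\<And>bs i x. set bs \<subseteq> Basis \<Longrightarrow> i \<in> I \<Longrightarrow> iter_partial bs (T i) differentiable (at x)"
  shows "schwartz_fam T"
proof -
  have "fam k (\<lambda>i. iter_partial bs (T i))" if "set bs \<subseteq> Basis" for k bs
    using that
  proof (induction k arbitrary: bs)
    case (Suc k)
    have "fam k (\<lambda>i. partial_deriv b (iter_partial bs (T i)))" if "b \<in> Basis" for b
      using Suc.IH[of "b # bs"] Suc.prems that by simp
    then show ?case using assms Suc.prems by simp
  qed (use assms in simp)
  from this[of "[]"] show ?thesis by (simp add: schwartz_fam_def)
qed

lemma schwartz_fam_smooth: "schwartz_fam T \<Longrightarrow> i \<in> I \<Longrightarrow> smooth (T i)"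
  unfolding smooth_def using schwartz_fam_iter_partial schwartz_fam_differentiable by blast

lemma schwartz_fam_schwartz:
  assumes "schwartz_fam T" "i \<in> I" shows "T i \<in> schwartz"
proof -
  have "bounded (range (\<lambda>x. (1 + norm x) ^ N *\<^sub>R iter_partial bs (T i) x))" if bs: "set bs \<subseteq> Basis" for N bs
  proof -
    obtain C M where "\<forall>i\<in>I. \<forall>x. (1 + norm x) ^ N * norm (iter_partial bs (T i) x) \<le> C * \<rho> M i"
      using rapidD[OF schwartz_fam_rapid[OF schwartz_fam_iter_partial[OF assms(1) bs]]] unfolding bd_def by blast
    then show ?thesis using assms(2) unfolding bounded_iff by auto
  qed
  then show ?thesis unfolding schwartz_def using schwartz_fam_smooth[OF assms] by auto
qed

end

section \<open>Schwartz norms as a scale, and single functions as families\<close>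

lemma finite_multiindex: "finite {bs :: 'a::euclidean_space list. set bs \<subseteq> Basis \<and> length bs \<le> N}"
  using finite_lists_length_le[OF finite_Basis] .

lemma schwartz_bdd_above:
  assumes "f \<in> schwartz" "set bs \<subseteq> Basis"
  shows "bdd_above (range (\<lambda>x. (1 + norm x) ^ N * norm (iter_partial bs f x)))"
proof -
  have "bounded (range (\<lambda>x. (1 + norm x) ^ N *\<^sub>R iter_partial bs f x))"
    using assms unfolding schwartz_def by auto
  then show ?thesis unfolding bounded_iff bdd_above_def by auto
qed

lemma schwartz_bound_nonneg:
  assumes "f \<in> schwartz" "set bs \<subseteq> Basis"
  shows "0 \<le> (SUP x. (1 + norm x) ^ N * norm (iter_partial bs f x))"
  by (rule cSUP_upper2[OF schwartz_bdd_above[OF assms], of undefined]) auto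

lemma schwartz_norm_ge:
  assumes f: "f \<in> schwartz" and bs: "set bs \<subseteq> Basis" "length bs \<le> N"
  shows "(1 + norm x) ^ N * norm (iter_partial bs f x) \<le> schwartz_norm N f"
proof -
  have "(1 + norm x) ^ N * norm (iter_partial bs f x) \<le> (SUP x. (1 + norm x) ^ N * norm (iter_partial bs f x))"
    by (rule cSUP_upper[OF _ schwartz_bdd_above[OF f bs(1)]]) simp
  also have "\<dots> \<le> schwartz_norm N f"
    unfolding schwartz_norm_def
    by (rule member_le_sum) (use f bs finite_multiindex schwartz_bound_nonneg in auto)
  finally show ?thesis .
qed

text \<open>Raising \<open>M\<close> increases both the polynomial weight and the set of
  multi-indices; the intermediate sum changes the weight first and then enlarges the set.\<close>

lemma scale_schwartz: "A \<subseteq> schwartz \<Longrightarrow> scale A schwartz_norm"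
proof
  fix M M' and f :: "'a \<Rightarrow> complex" assume A: "A \<subseteq> schwartz" "f \<in> A"
  then have f: "f \<in> schwartz" by auto
  show "0 \<le> schwartz_norm M f"
    unfolding schwartz_norm_def by (intro sum_nonneg) (use schwartz_bound_nonneg f in auto)
  assume M: "M \<le> M'"
  have "schwartz_norm M f \<le>
    (\<Sum>bs\<in>{bs. set bs \<subseteq> Basis \<and> length bs \<le> M}. SUP x. (1 + norm x) ^ M' * norm (iter_partial bs f x))"
    unfolding schwartz_norm_def
  proof (intro sum_mono cSUP_mono)
    fix bs :: "'a list" and x :: 'a assume "bs \<in> {bs. set bs \<subseteq> Basis \<and> length bs \<le> M}"
    then show "bdd_above (range (\<lambda>x. (1 + norm x) ^ M' * norm (iter_partial bs f x)))"
      using schwartz_bdd_above[OF f] by simp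
    show "\<exists>y\<in>UNIV. (1 + norm x) ^ M * norm (iter_partial bs f x) \<le> (1 + norm y) ^ M' * norm (iter_partial bs f y)"
      by (rule bexI[of _ x]) (auto intro!: mult_right_mono power_increasing M)
  qed auto
  also have "\<dots> \<le> schwartz_norm M' f"
    unfolding schwartz_norm_def
    by (rule sum_mono2) (use M f finite_multiindex schwartz_bound_nonneg in auto)
  finally show "schwartz_norm M f \<le> schwartz_norm M' f" .
qed

lemma scale_1: "scale E (\<lambda>_ _. 1)"
  by unfold_locales auto

text \<open>The identity family is the starting point for continuity proofs: whatever the closure
  rules build from it is an operator on \<open>A\<close> bounded by Schwartz norms.\<close>

lemma schwartz_fam_id:
  assumes A: "A \<subseteq> schwartz" shows "scale.schwartz_fam A schwartz_norm (\<lambda>f. f)"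
proof -
  interpret scale A schwartz_norm using scale_schwartz[OF A] .
  show ?thesis
  proof (rule schwartz_famI)
    fix bs :: "'a list" assume bs: "set bs \<subseteq> Basis"
    show "rapid (\<lambda>f. iter_partial bs f)"
      unfolding rapid_def
    proof
      fix N
      show "bd (\<lambda>f x. (1 + norm x) ^ N * norm (iter_partial bs f x))"
      \<comment> \<open>\<open>schwartz_norm\<close> has a single index for weight and order of
        differentiation, so the index must dominate both.\<close>
      proof (rule bdI[of 1 _ "max N (length bs)"])
        fix f and x :: 'a assume "f \<in> A"
        then have "f \<in> schwartz" using A by auto
        have "(1 + norm x) ^ N * norm (iter_partial bs f x) \<le>
            (1 + norm x) ^ max N (length bs) * norm (iter_partial bs f x)"
          by (intro mult_right_mono power_increasing) auto
        also have "\<dots> \<le> schwartz_norm (max N (length bs)) f"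
          using \<open>f \<in> schwartz\<close> bs by (intro schwartz_norm_ge) auto
        finally show "(1 + norm x) ^ N * norm (iter_partial bs f x) \<le> 1 * schwartz_norm (max N (length bs)) f"
          by simp
      qed simp
    qed
    show "iter_partial bs f differentiable (at x)" if "f \<in> A" for f x
      using that A bs unfolding schwartz_def smooth_def by auto
  qed
qed

text \<open>A one-element index set with constant scale turns every closure rule for families into
  one for single Schwartz functions, so each rule is proved once.\<close>

lemma schwartz_iff_fam: "f \<in> schwartz \<longleftrightarrow> scale.schwartz_fam {()} (\<lambda>_ _. 1) (\<lambda>_. f)"
proof -
  interpret scale "{()}" "\<lambda>_ _. 1" by (rule scale_1)
  show ?thesis
  proof
    assume f: "f \<in> schwartz"
    show "schwartz_fam (\<lambda>_. f)"
    proof (rule schwartz_famI)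
      fix bs :: "'a list" assume bs: "set bs \<subseteq> Basis"
      show "rapid (\<lambda>_. iter_partial bs f)"
        unfolding rapid_def
      proof
        fix N
        show "bd (\<lambda>i x. (1 + norm x) ^ N * norm (iter_partial bs f x))"
        proof (rule bdI[of "SUP x. (1 + norm x) ^ N * norm (iter_partial bs f x)"])
          show "0 \<le> (SUP x. (1 + norm x) ^ N * norm (iter_partial bs f x))"
            using schwartz_bound_nonneg[OF f bs] .
          show "(1 + norm x) ^ N * norm (iter_partial bs f x) \<le>
              (SUP x. (1 + norm x) ^ N * norm (iter_partial bs f x)) * 1" for x
            using cSUP_upper[OF _ schwartz_bdd_above[OF f bs], of x] by simp
        qed
      qed
      show "iter_partial bs f differentiable (at x)" for x
        using f bs unfolding schwartz_def smooth_def by auto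
    qed
  next
    assume "schwartz_fam (\<lambda>_. f)"
    then show "f \<in> schwartz" using schwartz_fam_schwartz by auto
  qed
qed

context scale
begin

text \<open>Only finitely many multi-indices enter a Schwartz norm, so their separate constants and
  orders can be merged. This is the passage from families to continuity estimates.\<close>

lemma schwartz_fam_norm_bound:
  fixes T :: "'i \<Rightarrow> 'a::euclidean_space \<Rightarrow> complex"
  assumes "schwartz_fam T"
  shows "\<exists>C\<ge>0. \<exists>M. \<forall>i\<in>I. schwartz_norm N (T i) \<le> C * \<rho> M i"
proof -
  let ?B = "{bs. set bs \<subseteq> Basis \<and> length bs \<le> N} :: 'a list set"
  have "\<forall>bs\<in>?B. \<exists>CM. 0 \<le> fst CM \<and>
      (\<forall>i\<in>I. \<forall>x. (1 + norm x) ^ N * norm (iter_partial bs (T i) x) \<le> fst CM * \<rho> (snd CM) i)"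
  proof
    fix bs :: "'a list" assume "bs \<in> ?B"
    then have "bd (\<lambda>i x. (1 + norm x) ^ N * norm (iter_partial bs (T i) x))"
      by (intro rapidD schwartz_fam_rapid schwartz_fam_iter_partial assms) simp
    then show "\<exists>CM. 0 \<le> fst CM \<and>
      (\<forall>i\<in>I. \<forall>x. (1 + norm x) ^ N * norm (iter_partial bs (T i) x) \<le> fst CM * \<rho> (snd CM) i)"
      unfolding bd_def split_paired_Ex by simp
  qed
  from bchoice[OF this] obtain D where
    D: "\<forall>bs\<in>?B. 0 \<le> fst (D bs) \<and>
      (\<forall>i\<in>I. \<forall>x. (1 + norm x) ^ N * norm (iter_partial bs (T i) x) \<le> fst (D bs) * \<rho> (snd (D bs)) i)" ..
  define C M where "C bs = fst (D bs)" and "M bs = snd (D bs)" for bs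
  have CM: "\<And>bs. bs \<in> ?B \<Longrightarrow> 0 \<le> C bs"
    "\<And>bs i x. bs \<in> ?B \<Longrightarrow> i \<in> I \<Longrightarrow> (1 + norm x) ^ N * norm (iter_partial bs (T i) x) \<le> C bs * \<rho> (M bs) i"
    using D unfolding C_def M_def by blast+
  \<comment> \<open>The point of type \<open>unit\<close> is a dummy: it lets \<open>bd_sum\<close>
    merge bounds that depend on \<open>i\<close> only.\<close>
  have "bd (\<lambda>i (x::unit). \<Sum>bs\<in>?B. C bs * \<rho> (M bs) i)"
  proof (rule bd_sum[OF finite_multiindex])
    fix bs :: "'a list" assume "bs \<in> ?B"
    then show "bd (\<lambda>i (x::unit). C bs * \<rho> (M bs) i)"
      using bdI[of "C bs" "\<lambda>i (x::unit). C bs * \<rho> (M bs) i" "M bs"] CM(1) by simp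
  qed
  then obtain D K where D: "D \<ge> 0" "\<And>i. i \<in> I \<Longrightarrow> (\<Sum>bs\<in>?B. C bs * \<rho> (M bs) i) \<le> D * \<rho> K i"
    unfolding bd_def by blast
  have "schwartz_norm N (T i) \<le> D * \<rho> K i" if i: "i \<in> I" for i
  proof -
    have "schwartz_norm N (T i) \<le> (\<Sum>bs\<in>?B. C bs * \<rho> (M bs) i)"
      unfolding schwartz_norm_def by (intro sum_mono cSUP_least CM(2) i) simp_all
    then show ?thesis using D(2)[OF i] by simp
  qed
  then show ?thesis using D(1) by blast
qed

end

section \<open>Integrals on Euclidean space\<close>

lemma integral_lborel_affine:
  fixes f :: "'a::euclidean_space \<Rightarrow> 'b::{banach, second_countable_topology}"
  assumes c: "c \<noteq> 0" and f: "f \<in> borel_measurable borel"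
  shows "integrable lborel (\<lambda>x. f (t + c *\<^sub>R x)) \<longleftrightarrow> integrable lborel f" (is ?A)
    and "integral\<^sup>L lborel f = \<bar>c\<bar> ^ DIM('a) *\<^sub>R (LINT x|lborel. f (t + c *\<^sub>R x))" (is ?B)
proof -
  have [measurable]: "f \<in> borel_measurable borel" by fact
  have pos: "\<bar>c\<bar> ^ DIM('a) > 0" using c by simp
  let ?D = "distr lborel borel (\<lambda>x::'a. t + c *\<^sub>R x)"
  have eq: "lborel = density ?D (\<lambda>_. ennreal (\<bar>c\<bar> ^ DIM('a)))"
    using lborel_affine[OF c, of t] by simp
  have "integrable lborel f \<longleftrightarrow> integrable ?D (\<lambda>x. (\<bar>c\<bar> ^ DIM('a)) *\<^sub>R f x)"
    by (subst eq, subst integrable_density) auto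
  also have "\<dots> \<longleftrightarrow> integrable ?D f"
    using pos Bochner_Integration.integrable_scaleR_right[of "inverse (\<bar>c\<bar> ^ DIM('a))" ?D "\<lambda>x. (\<bar>c\<bar> ^ DIM('a)) *\<^sub>R f x"] by auto
  also have "\<dots> \<longleftrightarrow> integrable lborel (\<lambda>x. f (t + c *\<^sub>R x))" by (subst integrable_distr_eq) auto
  finally show ?A by simp
  have "integral\<^sup>L lborel f = integral\<^sup>L ?D (\<lambda>x. (\<bar>c\<bar> ^ DIM('a)) *\<^sub>R f x)"
    by (subst eq, subst integral_density) auto
  also have "\<dots> = \<bar>c\<bar> ^ DIM('a) *\<^sub>R integral\<^sup>L ?D f" by simp
  also have "integral\<^sup>L ?D f = (LINT x|lborel. f (t + c *\<^sub>R x))" by (subst integral_distr) auto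
  finally show ?B .
qed

text \<open>Lebesgue measure is the image of a product of one-dimensional Lebesgue measures under
  the coordinate representation, so integrals of tensor products factor.\<close>

lemma integral_lborel_prod:
  fixes f :: "'a::euclidean_space \<Rightarrow> real \<Rightarrow> 'b::{real_normed_field, banach, second_countable_topology}"
  assumes f: "\<And>b. b \<in> Basis \<Longrightarrow> integrable lborel (f b)"
  shows "integrable lborel (\<lambda>x. \<Prod>b\<in>Basis. f b (x \<bullet> b))" (is ?A)
    and "(LINT x|lborel. (\<Prod>b\<in>Basis. f b (x \<bullet> b))) = (\<Prod>b\<in>Basis. LINT t|lborel. f b t)" (is ?B)
proof -
  interpret product_sigma_finite "\<lambda>_::'a. lborel :: real measure"
    by standard
  have [measurable]: "f b \<in> borel_measurable borel" if "b \<in> Basis" for b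
    using borel_measurable_integrable[OF f[OF that]] by simp
  have comp: "(\<Prod>b\<in>Basis. f b ((\<Sum>c\<in>Basis. y c *\<^sub>R c) \<bullet> b)) = (\<Prod>b\<in>Basis. f b (y b))" for y :: "'a \<Rightarrow> real"
    by (intro prod.cong) auto
  show ?A
    by (subst lborel_eq, subst integrable_distr_eq)
      (simp_all add: comp product_integrable_prod f)
  show ?B
    by (subst lborel_eq, subst integral_distr)
      (simp_all add: comp product_integral_prod f)
qed

text \<open>The exponent is twice the dimension because each factor 1 + (x \<bullet> b)^2 is at most
  (1 + |x|)^2; hence \<open>decay\<close> lies below the product of the integrable functions 1 / (1
  + t^2) over the coordinates.\<close>

definition decay :: "'a::euclidean_space \<Rightarrow> real" where
  "decay x = 1 / (1 + norm x) ^ (2 * DIM('a))"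

lemma decay_nonneg: "0 \<le> decay x"
  by (simp add: decay_def)

lemma decay_measurable [measurable]: "decay \<in> borel_measurable borel"
  unfolding decay_def[abs_def] by measurable

lemma integrable_decay: "integrable lborel (decay :: 'a::euclidean_space \<Rightarrow> real)"
proof (rule Bochner_Integration.integrable_bound)
  have "set_integrable lborel UNIV (\<lambda>x::real. inverse (1 + x^2))"
    using integrable_inverse_1_plus_square by simp
  then have "integrable lborel (\<lambda>x::real. inverse (1 + x^2))"
    by (simp add: set_integrable_def)
  then show "integrable lborel (\<lambda>x::'a. \<Prod>b\<in>Basis. inverse (1 + (x \<bullet> b)^2))"
    by (rule integral_lborel_prod)
  show "AE x::'a in lborel. norm (decay x) \<le> norm (\<Prod>b\<in>Basis. inverse (1 + (x \<bullet> b)^2))" 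
  proof (rule AE_I2)
    fix x :: 'a
    have pos: "1 + (x \<bullet> b)^2 > 0" for b by (simp add: add_pos_nonneg)
    have le: "1 + (x \<bullet> b)^2 \<le> (1 + norm x)^2" if "b \<in> Basis" for b
    proof -
      have "(x \<bullet> b)^2 \<le> (norm x)^2"
        using Basis_le_norm[OF that, of x] by (simp add: abs_le_square_iff[symmetric])
      then show ?thesis by (simp add: power2_sum add_increasing2)
    qed
    have "inverse (\<Prod>b\<in>(Basis::'a set). (1 + norm x)^2) \<le> inverse (\<Prod>b\<in>Basis. 1 + (x \<bullet> b)^2)"
      by (intro le_imp_inverse_le prod_mono prod_pos) (use le pos less_imp_le in auto)
    then have "decay x \<le> (\<Prod>b\<in>Basis. inverse (1 + (x \<bullet> b)^2))"
      by (simp add: decay_def power_mult inverse_eq_divide prod_dividef)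
    moreover have "0 \<le> (\<Prod>b\<in>Basis. inverse (1 + (x \<bullet> b)^2))"
      by (intro prod_nonneg) (use pos less_imp_le in auto)
    ultimately show "norm (decay x) \<le> norm (\<Prod>b\<in>Basis. inverse (1 + (x \<bullet> b)^2))"
      using decay_nonneg[of x] by simp
  qed
qed simp

definition decay_mass :: "'a::euclidean_space itself \<Rightarrow> real" where
  "decay_mass _ = (LINT x|lborel. decay (x::'a))"

lemma decay_mass_nonneg: "0 \<le> decay_mass TYPE('a::euclidean_space)"
  unfolding decay_mass_def by (intro integral_nonneg_AE AE_I2 decay_nonneg)

lemma decay_bound_iff:
  fixes x :: "'a::euclidean_space"
  shows "(1 + norm x) ^ (2 * DIM('a)) * y \<le> C \<longleftrightarrow> y \<le> C * decay x"
proof -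
  have "0 < (1 + norm x) ^ (2 * DIM('a))"
    by (simp add: add_pos_nonneg)
  then show ?thesis by (simp add: decay_def field_simps)
qed

text \<open>Shifts of length at most 1 change 1 + |x| by a factor of at most 2. This gives one
  majorant for all difference quotients with small step.\<close>

lemma decay_translate:
  fixes x :: "'a::euclidean_space"
  assumes "norm y \<le> 1" shows "decay (x + y) \<le> 2 ^ (2 * DIM('a)) * decay x"
proof -
  have "norm x \<le> norm (x + y) + norm y"
    using norm_triangle_ineq4[of "x + y" y] by simp
  then have "1 + norm x \<le> 2 * (1 + norm (x + y))"
    using assms by (smt (verit) norm_ge_zero)
  then have "(1 + norm x) ^ (2 * DIM('a)) \<le> 2 ^ (2 * DIM('a)) * (1 + norm (x + y)) ^ (2 * DIM('a))"
    unfolding power_mult_distrib[symmetric] by (intro power_mono) auto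
  moreover have "0 < (1 + norm (x + y)) ^ (2 * DIM('a))" by (simp add: add_pos_nonneg)
  ultimately have "(1 + norm x) ^ (2 * DIM('a)) * decay (x + y) \<le> 2 ^ (2 * DIM('a))"
    by (simp add: decay_def field_simps)
  then show ?thesis by (simp only: decay_bound_iff)
qed

lemma integrable_decay_bound:
  fixes f :: "'a::euclidean_space \<Rightarrow> 'b::{banach, second_countable_topology}"
  assumes [measurable]: "f \<in> borel_measurable borel" and le: "\<And>x. norm (f x) \<le> C * decay x"
  shows "integrable lborel f" "(LINT x|lborel. norm (f x)) \<le> C * decay_mass TYPE('a)"
proof -
  show "integrable lborel f"
    by (rule Bochner_Integration.integrable_bound[of _ "\<lambda>x. C * decay x"])
      (use integrable_decay le order_trans[OF le abs_ge_self] in auto)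
  have "(LINT x|lborel. norm (f x)) \<le> (LINT x::'a|lborel. C * decay x)"
    by (rule integral_mono') (use integrable_decay le order_trans[OF norm_ge_zero le] in auto)
  then show "(LINT x|lborel. norm (f x)) \<le> C * decay_mass TYPE('a)"
    by (simp add: decay_mass_def)
qed

lemma differentiable_imp_measurable:
  fixes f :: "'a::euclidean_space \<Rightarrow> complex"
  assumes "\<And>x. f differentiable (at x)" shows "f \<in> borel_measurable borel"
  by (rule borel_measurable_continuous_onI)
    (use assms differentiable_imp_continuous_within continuous_on_eq_continuous_at in blast)

section \<open>Schwartz functions\<close>

lemma schwartz_add: "f \<in> schwartz \<Longrightarrow> g \<in> schwartz \<Longrightarrow> (\<lambda>x. f x + g x) \<in> schwartz"
  unfolding schwartz_iff_fam using scale.schwartz_fam_add[OF scale_1] .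

lemma schwartz_mult_slow: "(\<And>k. scale.slow k m) \<Longrightarrow> f \<in> schwartz \<Longrightarrow> (\<lambda>x. m x * f x) \<in> schwartz"
  unfolding schwartz_iff_fam using scale.schwartz_fam_mult[OF scale_1] .

lemma schwartz_cmult: "f \<in> schwartz \<Longrightarrow> (\<lambda>x. c * f x) \<in> schwartz"
  unfolding schwartz_iff_fam using scale.schwartz_fam_cmult[OF scale_1] .

lemma schwartz_coord: "f \<in> schwartz \<Longrightarrow> (\<lambda>x. of_real (x \<bullet> c) * f x) \<in> schwartz"
  unfolding schwartz_iff_fam using scale.schwartz_fam_coord[OF scale_1] .

lemma schwartz_partial_deriv: "f \<in> schwartz \<Longrightarrow> b \<in> Basis \<Longrightarrow> partial_deriv b f \<in> schwartz"
  unfolding schwartz_iff_fam using scale.schwartz_fam_partial_deriv[OF scale_1] .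

lemma schwartz_differentiable: "f \<in> schwartz \<Longrightarrow> f differentiable (at x)"
  unfolding schwartz_def using smooth_differentiable by auto

lemma schwartz_measurable: "f \<in> schwartz \<Longrightarrow> f \<in> borel_measurable borel"
  using differentiable_imp_measurable schwartz_differentiable by blast

lemma schwartz_bound:
  assumes "f \<in> schwartz" shows "\<exists>C\<ge>0. \<forall>x. (1 + norm x) ^ N * norm (f x) \<le> C"
proof -
  have "bounded (range (\<lambda>x. (1 + norm x) ^ N *\<^sub>R iter_partial [] f x))"
    using assms unfolding schwartz_def by (auto simp del: iter_partial_Nil)
  then obtain C where "\<forall>x. (1 + norm x) ^ N * norm (f x) \<le> C"
    unfolding bounded_iff by auto
  then show ?thesis by (intro exI[of _ "max C 0"]) (auto intro: le_max_iff_disj[THEN iffD2])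
qed

lemma schwartz_decay:
  fixes f :: "'a::euclidean_space \<Rightarrow> complex"
  assumes "f \<in> schwartz" shows "\<exists>C\<ge>0. \<forall>x. norm (f x) \<le> C * decay x"
  using schwartz_bound[OF assms, of "2 * DIM('a)"] unfolding decay_bound_iff .

lemma schwartz_integrable: "f \<in> schwartz \<Longrightarrow> integrable lborel f"
  using schwartz_decay integrable_decay_bound(1) schwartz_measurable by blast

section \<open>The Fourier transform on the Schwartz space\<close>

text \<open>The kernel \<open>cis (a * (x \<bullet> \<xi>))\<close> covers the Fourier transform (\<open>a = -2 * pi\<close>) and its inverse
  (\<open>a = 2 * pi\<close>).\<close>

definition ft :: "real \<Rightarrow> ('a::euclidean_space \<Rightarrow> complex) \<Rightarrow> 'a \<Rightarrow> complex" where
  "ft a f \<xi> = (LINT x|lborel. cis (a * (x \<bullet> \<xi>)) * f x)"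

lemma fourier_eq_ft: "fourier = ft (- 2 * pi)"
  by (simp add: fun_eq_iff fourier_def ft_def)

lemma inv_fourier_eq_ft: "inv_fourier = ft (2 * pi)"
  by (simp add: fun_eq_iff inv_fourier_def ft_def inner_commute)

lemma cis_inner_measurable [measurable]: "(\<lambda>x. cis (a * (x \<bullet> \<xi>))) \<in> borel_measurable borel"
  by (rule borel_measurable_continuous_onI) (intro continuous_intros)

lemma norm_cis_mult: "norm (cis a * z) = norm z"
  by (simp add: norm_mult)

lemma integrable_cis_mult:
  assumes "integrable lborel f" shows "integrable lborel (\<lambda>x. cis (a * (x \<bullet> \<xi>)) * f x)"
  using borel_measurable_integrable[OF assms]
  by (intro Bochner_Integration.integrable_bound[OF assms]) (auto simp: norm_cis_mult)

lemma norm_ft_le: "norm (ft a f \<xi>) \<le> (LINT x|lborel. norm (f x))"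
  unfolding ft_def using integral_norm_bound[of lborel "\<lambda>x. cis (a * (x \<bullet> \<xi>)) * f x"]
  by (simp add: norm_cis_mult)

lemma ft_add: "integrable lborel f \<Longrightarrow> integrable lborel g \<Longrightarrow> ft a (\<lambda>x. f x + g x) \<xi> = ft a f \<xi> + ft a g \<xi>"
  unfolding ft_def by (simp add: distrib_left integrable_cis_mult)

lemma ft_cmult: "ft a (\<lambda>x. c * f x) \<xi> = c * ft a f \<xi>"
  unfolding ft_def by (simp add: mult.left_commute)

lemma ft_sum:
  assumes "\<And>b. b \<in> A \<Longrightarrow> integrable lborel (f b)"
  shows "ft a (\<lambda>x. \<Sum>b\<in>A. f b x) \<xi> = (\<Sum>b\<in>A. ft a (f b) \<xi>)"
  unfolding ft_def using assms by (simp add: sum_distrib_left integrable_cis_mult)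

lemma norm_cis_taylor: "norm (cis t - 1 - \<i> * of_real t) \<le> t\<^sup>2"
proof -
  have "norm (cis t - 1 - \<i> * of_real t) \<le> t\<^sup>2 / 2"
    using iexp_approx1[of t 1] by (simp add: cis_conv_exp diff_diff_eq power2_eq_square)
  then show ?thesis by (smt (verit) field_sum_of_halves zero_le_power2)
qed

text \<open>The second-order error of the exponential bounds the remainder by |h|^2 times a second
  moment of \<open>f\<close>, which is finite for Schwartz functions. No interchange of limits is
  involved.\<close>

lemma has_derivative_ft:
  fixes f :: "'a::euclidean_space \<Rightarrow> complex"
  assumes f: "f \<in> schwartz"
  shows "(ft a f has_derivative (\<lambda>h. ft a (\<lambda>x. \<i> * of_real a * of_real (x \<bullet> h) * f x) \<xi>)) (at \<xi>)"
  unfolding has_derivative_at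
proof
  have mf[measurable]: "f \<in> borel_measurable borel" using schwartz_measurable[OF f] .
  have sh: "(\<lambda>x. \<i> * of_real a * of_real (x \<bullet> h) * f x) \<in> schwartz" for h
    using schwartz_cmult[OF schwartz_coord[OF f], of "\<i> * of_real a" h] by (simp add: mult.assoc)
  note ih = schwartz_integrable[OF sh] and jf = schwartz_integrable[OF f]
  define D where "D h = ft a (\<lambda>x. \<i> * of_real a * of_real (x \<bullet> h) * f x) \<xi>" for h
  have "linear D"
  proof
    show "D (h + k) = D h + D k" for h k
    proof -
      have "(\<lambda>x. \<i> * of_real a * of_real (x \<bullet> (h + k)) * f x) =
         (\<lambda>x. \<i> * of_real a * of_real (x \<bullet> h) * f x + \<i> * of_real a * of_real (x \<bullet> k) * f x)"
        by (auto simp: inner_right_distrib algebra_simps)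
      then show ?thesis unfolding D_def using ft_add[OF ih ih] by simp
    qed
    show "D (r *\<^sub>R h) = r *\<^sub>R D h" for r h
    proof -
      have "(\<lambda>x. \<i> * of_real a * of_real (x \<bullet> (r *\<^sub>R h)) * f x) =
         (\<lambda>x. of_real r * (\<i> * of_real a * of_real (x \<bullet> h) * f x))"
        by (auto simp: algebra_simps)
      then show ?thesis unfolding D_def using ft_cmult[of a "of_real r"] by (simp add: scaleR_conv_of_real)
    qed
  qed
  then show "bounded_linear D" by (rule linear_conv_bounded_linear[THEN iffD1])
  \<comment> \<open>The two powers beyond \<open>2 * DIM('a)\<close> absorb the factor |x|^2,
    leaving an integrable majorant.\<close>
  obtain C where C: "C \<ge> 0" "\<And>x. (1 + norm x) ^ (2 * DIM('a) + 2) * norm (f x) \<le> C"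
    using schwartz_bound[OF f] by blast
  have x2: "(1 + norm x) ^ (2 * DIM('a)) * norm (of_real ((norm x)\<^sup>2) * f x) \<le> C" for x
  proof -
    have "(norm x)\<^sup>2 \<le> (1 + norm x)\<^sup>2" by (intro power_mono) auto
    have "(1 + norm x) ^ (2 * DIM('a)) * ((norm x)\<^sup>2 * norm (f x)) \<le>
        (1 + norm x) ^ (2 * DIM('a)) * ((1 + norm x)\<^sup>2 * norm (f x))"
      using \<open>(norm x)\<^sup>2 \<le> (1 + norm x)\<^sup>2\<close> by (intro mult_left_mono mult_right_mono) auto
    also have "\<dots> \<le> C" using C(2)[of x] by (simp only: power_add mult.assoc)
    finally show ?thesis by (simp add: norm_mult norm_power)
  qed
  have int2: "integrable lborel (\<lambda>x. of_real ((norm x)\<^sup>2) * f x)"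
    by (rule integrable_decay_bound(1)[OF _ decay_bound_iff[THEN iffD1, OF x2]]) measurable
  define K where "K = a\<^sup>2 * (LINT x|lborel. norm (of_real ((norm x)\<^sup>2) * f x))"
  have le: "norm (ft a f (\<xi> + h) - ft a f \<xi> - D h) \<le> K * (norm h)\<^sup>2" for h
  proof -
    have "ft a f (\<xi> + h) - ft a f \<xi> - D h =
      (LINT x|lborel. cis (a * (x \<bullet> \<xi>)) * ((cis (a * (x \<bullet> h)) - 1 - \<i> * of_real (a * (x \<bullet> h))) * f x))"
      unfolding ft_def D_def
      by (subst Bochner_Integration.integral_diff[symmetric],
          (intro Bochner_Integration.integrable_diff integrable_cis_mult jf ih)+)+
        (auto intro!: Bochner_Integration.integral_cong simp: inner_right_distrib algebra_simps cis_mult[symmetric])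
    also have "norm \<dots> \<le> (LINT x|lborel. norm (cis (a * (x \<bullet> \<xi>)) * ((cis (a * (x \<bullet> h)) - 1 - \<i> * of_real (a * (x \<bullet> h))) * f x)))"
      by (rule integral_norm_bound)
    also have "\<dots> \<le> (LINT x|lborel. a\<^sup>2 * (norm h)\<^sup>2 * norm (of_real ((norm x)\<^sup>2) * f x))"
    proof (rule integral_mono')
      fix x
      have "(a * (x \<bullet> h))\<^sup>2 \<le> a\<^sup>2 * ((norm x)\<^sup>2 * (norm h)\<^sup>2)"
        using Cauchy_Schwarz_ineq[of x h] by (simp add: power_mult_distrib mult_left_mono power2_norm_eq_inner)
      then have "norm (cis (a * (x \<bullet> h)) - 1 - \<i> * of_real (a * (x \<bullet> h))) \<le> a\<^sup>2 * ((norm x)\<^sup>2 * (norm h)\<^sup>2)"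
        using norm_cis_taylor[of "a * (x \<bullet> h)"] by linarith
      then have "norm (cis (a * (x \<bullet> h)) - 1 - \<i> * of_real (a * (x \<bullet> h))) * norm (f x) \<le>
          a\<^sup>2 * ((norm x)\<^sup>2 * (norm h)\<^sup>2) * norm (f x)"
        by (rule mult_right_mono) simp
      then show "norm (cis (a * (x \<bullet> \<xi>)) * ((cis (a * (x \<bullet> h)) - 1 - \<i> * of_real (a * (x \<bullet> h))) * f x)) \<le>
          a\<^sup>2 * (norm h)\<^sup>2 * norm (of_real ((norm x)\<^sup>2) * f x)"
        unfolding norm_mult norm_of_real norm_cis by (simp add: mult.assoc mult.commute mult.left_commute)
    qed (use int2 in auto)
    finally show ?thesis by (simp add: K_def mult.assoc mult.commute mult.left_commute)
  qed
  have K: "0 \<le> K" by (simp add: K_def)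
  show "(\<lambda>h. norm (ft a f (\<xi> + h) - ft a f \<xi> - D h) / norm h) \<midarrow>0\<rightarrow> 0"
  proof (rule tendsto_sandwich[OF _ _ tendsto_const])
    show "((\<lambda>h. K * norm h) \<longlongrightarrow> 0) (at (0::'a))"
      by (auto intro!: tendsto_eq_intros)
    show "\<forall>\<^sub>F h in at 0. norm (ft a f (\<xi> + h) - ft a f \<xi> - D h) / norm h \<le> K * norm h"
      unfolding eventually_at_filter
      by (intro always_eventually allI impI)
        (use le in \<open>simp add: divide_le_eq power2_eq_square mult.assoc\<close>)
  qed (auto intro: always_eventually)
qed

lemma partial_deriv_ft:
  assumes f: "f \<in> schwartz"
  shows "partial_deriv b (ft a f) = ft a (\<lambda>x. \<i> * of_real a * (of_real (x \<bullet> b) * f x))"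
  using partial_deriv_eqI[OF has_derivative_ft[OF f]] by (simp add: fun_eq_iff mult.assoc)

lemma ft_differentiable: "f \<in> schwartz \<Longrightarrow> ft a f differentiable (at \<xi>)"
  using has_derivative_ft differentiableI by blast

lemma has_derivative_along_line:
  fixes h :: "'a::euclidean_space \<Rightarrow> complex"
  assumes h: "\<And>x. h differentiable (at x)"
  shows "((\<lambda>s. h (x + s *\<^sub>R b)) has_derivative (\<lambda>r. r *\<^sub>R partial_deriv b h (x + s *\<^sub>R b))) (at s within S)"
proof -
  have "((\<lambda>s. h (x + s *\<^sub>R b)) has_derivative (\<lambda>r. frechet_derivative h (at (x + s *\<^sub>R b)) (r *\<^sub>R b))) (at s within S)"
    by (rule has_derivative_compose[OF _ differentiable_has_derivative[OF h]])
      (auto intro!: derivative_eq_intros)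
  then show ?thesis
    using linear_cmul[OF linear_frechet_derivative[OF h]] by (simp add: partial_deriv_def)
qed

text \<open>This is the mean value inequality along a segment. The direction \<open>b\<close> is
  arbitrary, so that a later use can take the segment from the origin to a given point.\<close>

lemma increment_bound:
  fixes h :: "'a::euclidean_space \<Rightarrow> complex"
  assumes h: "\<And>x. h differentiable (at x)" and t: "0 \<le> t"
    and B: "\<And>s. 0 \<le> s \<Longrightarrow> s \<le> t \<Longrightarrow> norm (partial_deriv b h (x + s *\<^sub>R b)) \<le> B"
  shows "norm (h (x + t *\<^sub>R b) - h x) \<le> t * B"
proof -
  have "norm (h (x + t *\<^sub>R b) - h (x + 0 *\<^sub>R b)) \<le> B * norm (t - 0)"
  proof (rule differentiable_bound[where S = "{0..t}"])
    show "onorm (\<lambda>r. r *\<^sub>R partial_deriv b h (x + s *\<^sub>R b)) \<le> B" if "s \<in> {0..t}" for s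
      using B[of s] that by (intro onorm_le) (metis abs_ge_zero atLeastAtMost_iff mult.commute mult_left_mono norm_scaleR real_norm_def)
  qed (use has_derivative_along_line[OF h] t in auto)
  then show ?thesis using t by (simp add: mult.commute)
qed

text \<open>Both sides are limits of the transform of the difference quotients, as translations of \<open>f\<close> become
  modulations of its transform.\<close>

lemma ft_partial_deriv:
  fixes f :: "'a::euclidean_space \<Rightarrow> complex"
  assumes f: "f \<in> schwartz" and b: "b \<in> Basis"
  shows "ft a (partial_deriv b f) \<xi> = - \<i> * of_real a * (of_real (\<xi> \<bullet> b) * ft a f \<xi>)"
proof -
  define t where "t n = inverse (real (Suc n))" for n
  have t: "0 < t n" "t n \<le> 1" for n by (auto simp: t_def inverse_le_1_iff)
  have t0: "t \<longlonglongrightarrow> 0" unfolding t_def[abs_def] by (rule LIMSEQ_inverse_real_of_nat)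
  define D where "D n x = of_real (inverse (t n)) * (f (x + t n *\<^sub>R b) + (- 1) * f x)" for n x
  note df = schwartz_differentiable[OF f]
  have mf[measurable]: "f \<in> borel_measurable borel" "partial_deriv b f \<in> borel_measurable borel"
    using schwartz_measurable f schwartz_partial_deriv[OF f b] by auto
  obtain C where C: "C \<ge> 0" "\<And>x. norm (partial_deriv b f x) \<le> C * decay x"
    using schwartz_decay[OF schwartz_partial_deriv[OF f b]] by blast
  \<comment> \<open>The majorant does not depend on \<open>n\<close>: the increment is controlled by
    the derivative along the segment, and since \<open>t n \<le> 1\<close> the shift costs only the
    factor from \<open>decay_translate\<close>.\<close>
  have bound: "norm (D n x) \<le> C * 2 ^ (2 * DIM('a)) * decay x" for n x
  proof -
    have "norm (partial_deriv b f (x + s *\<^sub>R b)) \<le> C * 2 ^ (2 * DIM('a)) * decay x" if s: "0 \<le> s" "s \<le> t n" for s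
    proof -
      have "norm (s *\<^sub>R b) \<le> 1" using s t[of n] b by simp
      then have "C * decay (x + s *\<^sub>R b) \<le> C * (2 ^ (2 * DIM('a)) * decay x)"
        by (intro mult_left_mono decay_translate C(1))
      then show ?thesis using order_trans[OF C(2)] by (simp only: mult.assoc)
    qed
    then have "norm (f (x + t n *\<^sub>R b) - f x) \<le> t n * (C * 2 ^ (2 * DIM('a)) * decay x)"
      using t[of n] by (intro increment_bound df) auto
    then show ?thesis unfolding D_def using t[of n] by (simp add: norm_mult norm_divide field_simps)
  qed
  have lim: "(\<lambda>n. D n x) \<longlonglongrightarrow> partial_deriv b f x" for x
  proof -
    have "((\<lambda>s. norm (f (x + s *\<^sub>R b) - f x - s *\<^sub>R partial_deriv b f x) / norm s) \<longlongrightarrow> 0) (at 0)"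
      using has_derivative_along_line[where s = 0 and S = UNIV, OF df] by (simp add: has_derivative_at)
    moreover have "filterlim t (at 0) sequentially"
      unfolding filterlim_at using t(1) t0 by (auto simp: less_imp_neq[symmetric])
    ultimately have "(\<lambda>n. norm (f (x + t n *\<^sub>R b) - f x - t n *\<^sub>R partial_deriv b f x) / norm (t n)) \<longlonglongrightarrow> 0"
      by (rule filterlim_compose)
    moreover have "norm (f (x + t n *\<^sub>R b) - f x - t n *\<^sub>R partial_deriv b f x) / norm (t n) = norm (D n x - partial_deriv b f x)" for n
    proof -
      have "D n x - partial_deriv b f x = (f (x + t n *\<^sub>R b) - f x - t n *\<^sub>R partial_deriv b f x) / of_real (t n)"
        using t(1)[of n] by (simp add: D_def scaleR_conv_of_real field_simps)
      then show ?thesis by (simp add: norm_divide)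
    qed
    ultimately show ?thesis by (simp add: tendsto_norm_zero_iff Lim_null[symmetric])
  qed
  have "(\<lambda>n. ft a (D n) \<xi>) \<longlonglongrightarrow> ft a (partial_deriv b f) \<xi>"
    unfolding ft_def
  proof (rule integral_dominated_convergence)
    show "integrable lborel (\<lambda>x::'a. C * 2 ^ (2 * DIM('a)) * decay x)" using integrable_decay[where 'a='a] by simp
    show "(\<lambda>x. cis (a * (x \<bullet> \<xi>)) * D n x) \<in> borel_measurable lborel" for n
      unfolding D_def[abs_def] by measurable
  qed (use bound lim in \<open>auto simp: norm_cis_mult intro!: tendsto_mult_left\<close>)
  moreover have "(\<lambda>n. ft a (D n) \<xi>) \<longlonglongrightarrow> - \<i> * of_real a * of_real (\<xi> \<bullet> b) * ft a f \<xi>"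
  proof -
    \<comment> \<open>Translating \<open>f\<close> by \<open>t n *\<^sub>R b\<close> multiplies its
      transform by \<open>cis (\<theta> * t n)\<close>; the difference quotient of this factor tends
      to \<open>\<i> * \<theta>\<close>.\<close>
    define \<theta> where "\<theta> = - (a * (\<xi> \<bullet> b))"
    have D: "ft a (D n) \<xi> = (cis (\<theta> * t n) - 1) / of_real (t n) * ft a f \<xi>" for n
    proof -
      let ?g = "\<lambda>y. cis (\<theta> * t n) * (cis (a * (y \<bullet> \<xi>)) * f y)"
      have "ft a (\<lambda>x. f (x + t n *\<^sub>R b)) \<xi> = (LINT x|lborel. ?g (t n *\<^sub>R b + 1 *\<^sub>R x))"
        unfolding ft_def
      proof (rule Bochner_Integration.integral_cong[OF refl])
        fix x
        have "a * (x \<bullet> \<xi>) = \<theta> * t n + a * ((t n *\<^sub>R b + 1 *\<^sub>R x) \<bullet> \<xi>)"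
          by (simp add: \<theta>_def inner_add_left inner_commute algebra_simps)
        then show "cis (a * (x \<bullet> \<xi>)) * f (x + t n *\<^sub>R b) = ?g (t n *\<^sub>R b + 1 *\<^sub>R x)"
          by (simp only: cis_mult[symmetric] mult.assoc scaleR_one add.commute)
      qed
      also have "\<dots> = integral\<^sup>L lborel ?g"
        using integral_lborel_affine(2)[of 1 ?g "t n *\<^sub>R b"] by simp
      finally have tr: "ft a (\<lambda>x. f (x + t n *\<^sub>R b)) \<xi> = cis (\<theta> * t n) * ft a f \<xi>"
        by (simp add: ft_def)
      have "integrable lborel (\<lambda>x. f (x + t n *\<^sub>R b))"
        using integral_lborel_affine(1)[of 1 f "t n *\<^sub>R b"] schwartz_integrable[OF f] by (simp add: add.commute)
      moreover have "integrable lborel (\<lambda>x. (- 1) * f x)" using schwartz_integrable[OF f] by simp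
      ultimately have eq: "ft a (\<lambda>x. f (x + t n *\<^sub>R b) + (- 1) * f x) \<xi> = cis (\<theta> * t n) * ft a f \<xi> + (- 1) * ft a f \<xi>"
        by (subst ft_add) (simp_all only: tr ft_cmult)
      show ?thesis
        unfolding D_def ft_cmult eq by (simp add: divide_inverse algebra_simps)
    qed
    have "(\<lambda>n. (cis (\<theta> * t n) - 1) / of_real (t n) - \<i> * of_real \<theta>) \<longlonglongrightarrow> 0"
    proof (rule Lim_null_comparison)
      show "(\<lambda>n. \<theta>\<^sup>2 * t n) \<longlonglongrightarrow> 0" using tendsto_mult_left[OF t0, of "\<theta>\<^sup>2"] by simp
      show "\<forall>\<^sub>F n in sequentially. norm ((cis (\<theta> * t n) - 1) / of_real (t n) - \<i> * of_real \<theta>) \<le> \<theta>\<^sup>2 * t n"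
      proof (intro always_eventually allI)
        fix n
        have "(cis (\<theta> * t n) - 1) / of_real (t n) - \<i> * of_real \<theta> = (cis (\<theta> * t n) - 1 - \<i> * of_real (\<theta> * t n)) / of_real (t n)"
          using t(1)[of n] by (simp add: diff_divide_distrib)
        then show "norm ((cis (\<theta> * t n) - 1) / of_real (t n) - \<i> * of_real \<theta>) \<le> \<theta>\<^sup>2 * t n"
          using norm_cis_taylor[of "\<theta> * t n"] t(1)[of n]
          by (simp add: norm_divide divide_le_eq power2_eq_square mult_ac)
      qed
    qed
    then have "(\<lambda>n. (cis (\<theta> * t n) - 1) / of_real (t n)) \<longlonglongrightarrow> \<i> * of_real \<theta>"
      by (rule Lim_null[THEN iffD2])
    from tendsto_mult_right[OF this, of "ft a f \<xi>"] show ?thesis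
      unfolding D
      by (simp only: \<theta>_def of_real_minus of_real_mult mult.assoc mult_minus_left mult_minus_right)
  qed
  ultimately have "ft a (partial_deriv b f) \<xi> = - \<i> * of_real a * of_real (\<xi> \<bullet> b) * ft a f \<xi>"
    by (rule LIMSEQ_unique)
  then show ?thesis by (simp only: mult.assoc)
qed

text \<open>Solved for the coordinate factor, the derivative rule trades growth in \<xi> for a
  derivative of \<open>f\<close>; the constant is \<i> / a because (-\<i> a)(\<i> / a) = 1.\<close>

lemma coord_mult_ft:
  fixes f :: "'a::euclidean_space \<Rightarrow> complex"
  assumes "f \<in> schwartz" "b \<in> Basis" "a \<noteq> 0"
  shows "of_real (\<xi> \<bullet> b) * ft a f \<xi> = ft a (\<lambda>x. \<i> / of_real a * partial_deriv b f x) \<xi>"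
  using assms(3) unfolding ft_cmult ft_partial_deriv[OF assms(1,2)] by (simp add: field_simps)

lemma one_plus_norm_le_sum:
  fixes x :: "'a::euclidean_space" shows "1 + norm x \<le> 1 + (\<Sum>b\<in>Basis. \<bar>x \<bullet> b\<bar>)"
  using norm_le_l1[of x] by simp

context scale
begin

lemma bd_ft_rapid:
  fixes T :: "'i \<Rightarrow> 'a::euclidean_space \<Rightarrow> complex"
  assumes "rapid T" "\<And>i. i \<in> I \<Longrightarrow> T i \<in> borel_measurable borel"
  shows "bd (\<lambda>i (\<xi>::'a). LINT x|lborel. norm (T i x))"
proof -
  obtain C M where C: "C \<ge> 0" "\<And>i x. i \<in> I \<Longrightarrow> (1 + norm x) ^ (2 * DIM('a)) * norm (T i x) \<le> C * \<rho> M i"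
    using rapidD[OF assms(1)] unfolding bd_def by blast
  show ?thesis
  proof (rule bdI[of "C * decay_mass TYPE('a)" _ M])
    show "0 \<le> C * decay_mass TYPE('a)" using C(1) decay_mass_nonneg[where 'a='a] by simp
    show "(LINT x|lborel. norm (T i x)) \<le> C * decay_mass TYPE('a) * \<rho> M i" if "i \<in> I" for i
      using integrable_decay_bound(2)[OF assms(2)[OF that] decay_bound_iff[THEN iffD1, OF C(2)[OF that]]]
      by (simp add: algebra_simps)
  qed
qed

text \<open>Each factor 1 + |\<xi>| is at most 1 plus the sum of the |\<xi> \<bullet> b|, and every
  coordinate factor becomes a derivative of the family under the transform. After \<open>N\<close>
  rounds only the bound of a transform by an integral norm remains.\<close>

lemma rapid_ft:
  fixes T :: "'i \<Rightarrow> 'a::euclidean_space \<Rightarrow> complex"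
  assumes a: "a \<noteq> 0" and T: "schwartz_fam T"
  shows "rapid (\<lambda>i. ft a (T i))"
  unfolding rapid_def
proof
  fix N
  show "bd (\<lambda>i \<xi>. (1 + norm \<xi>) ^ N * norm (ft a (T i) \<xi>))"
    using T
  proof (induction N arbitrary: T)
    case 0
    have "bd (\<lambda>i (\<xi>::'a). LINT x|lborel. norm (T i x))"
      by (rule bd_ft_rapid) (use 0 schwartz_fam_rapid schwartz_fam_schwartz schwartz_measurable in auto)
    then show ?case by (rule bd_mono) (simp add: norm_ft_le)
  next
    case (Suc N)
    have 1: "bd (\<lambda>i \<xi>. (1 + norm \<xi>) ^ N * norm (ft a (T i) \<xi>))" using Suc by simp
    have 2: "bd (\<lambda>i \<xi>. (1 + norm \<xi>) ^ N * norm (ft a (\<lambda>x. \<i> / of_real a * partial_deriv b (T i) x) \<xi>))"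
      if "b \<in> Basis" for b
      by (rule Suc.IH) (intro schwartz_fam_cmult schwartz_fam_partial_deriv Suc.prems that)
    have "bd (\<lambda>i \<xi>. (1 + norm \<xi>) ^ N * norm (ft a (T i) \<xi>) +
       (\<Sum>b\<in>Basis. (1 + norm \<xi>) ^ N * norm (ft a (\<lambda>x. \<i> / of_real a * partial_deriv b (T i) x) \<xi>)))"
      by (intro bd_add bd_sum 1 2) auto
    then show ?case
    proof (rule bd_mono)
      fix i and \<xi> :: 'a assume i: "i \<in> I"
      let ?F = "(1 + norm \<xi>) ^ N * norm (ft a (T i) \<xi>)"
      have "(1 + norm \<xi>) ^ Suc N * norm (ft a (T i) \<xi>) = (1 + norm \<xi>) * ?F" by simp
      also have "\<dots> \<le> (1 + (\<Sum>b\<in>Basis. \<bar>\<xi> \<bullet> b\<bar>)) * ?F"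
        by (intro mult_right_mono one_plus_norm_le_sum) simp
      also have "\<dots> = ?F + (\<Sum>b\<in>Basis. (1 + norm \<xi>) ^ N * (\<bar>\<xi> \<bullet> b\<bar> * norm (ft a (T i) \<xi>)))"
        by (simp add: algebra_simps sum_distrib_left)
      also have "\<dots> = ?F + (\<Sum>b\<in>Basis. (1 + norm \<xi>) ^ N * norm (of_real (\<xi> \<bullet> b) * ft a (T i) \<xi>))"
        by (simp add: norm_mult)
      also have "\<dots> = ?F + (\<Sum>b\<in>Basis. (1 + norm \<xi>) ^ N * norm (ft a (\<lambda>x. \<i> / of_real a * partial_deriv b (T i) x) \<xi>))"
        using coord_mult_ft[OF schwartz_fam_schwartz[OF Suc.prems i] _ a] by simp
      finally show "(1 + norm \<xi>) ^ Suc N * norm (ft a (T i) \<xi>) \<le> \<dots>" .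
    qed
  qed
qed

text \<open>A derivative of the transform is the transform of the family multiplied by a coordinate,
  which is again a Schwartz family. Every order is thereby reduced to
  \<open>rapid_ft\<close>.\<close>

lemma schwartz_fam_ft:
  assumes a: "a \<noteq> 0" and T: "schwartz_fam T"
  shows "schwartz_fam (\<lambda>i. ft a (T i))"
  unfolding schwartz_fam_def
proof
  fix k show "fam k (\<lambda>i. ft a (T i))"
    using T
  proof (induction k arbitrary: T)
    case 0
    then show ?case using rapid_ft[OF a] by simp
  next
    case (Suc k)
    have "fam k (\<lambda>i. partial_deriv b (ft a (T i)))" if "b \<in> Basis" for b
    proof (rule fam_cong)
      show "fam k (\<lambda>i. ft a (\<lambda>x. \<i> * of_real a * (of_real (x \<bullet> b) * T i x)))"
        by (rule Suc.IH) (intro schwartz_fam_cmult schwartz_fam_coord Suc.prems)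
      show "ft a (\<lambda>x. \<i> * of_real a * (of_real (x \<bullet> b) * T i x)) x = partial_deriv b (ft a (T i)) x"
        if "i \<in> I" for i x
        using partial_deriv_ft[OF schwartz_fam_schwartz[OF Suc.prems that]] by simp
    qed
    then show ?case
      using rapid_ft[OF a Suc.prems] ft_differentiable[OF schwartz_fam_schwartz[OF Suc.prems]] by auto
  qed
qed

end

lemma schwartz_ft: "a \<noteq> 0 \<Longrightarrow> f \<in> schwartz \<Longrightarrow> ft a f \<in> schwartz"
  unfolding schwartz_iff_fam using scale.schwartz_fam_ft[OF scale_1] .

lemma schwartz_fourier: "f \<in> schwartz \<Longrightarrow> fourier f \<in> schwartz"
  unfolding fourier_eq_ft by (rule schwartz_ft) simp

lemma schwartz_inv_fourier: "f \<in> schwartz \<Longrightarrow> inv_fourier f \<in> schwartz"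
  unfolding inv_fourier_eq_ft by (rule schwartz_ft) simp

section \<open>Fourier inversion\<close>

lemma integrable_lborel_pair_mult:
  fixes f g :: "'a::euclidean_space \<Rightarrow> complex" and k :: "'a \<times> 'a \<Rightarrow> complex"
  assumes f: "integrable lborel f" and g: "integrable lborel g"
    and k[measurable]: "k \<in> borel_measurable (lborel \<Otimes>\<^sub>M lborel)" and k1: "\<And>p. norm (k p) \<le> 1"
  shows "integrable (lborel \<Otimes>\<^sub>M lborel) (\<lambda>(x, y). f x * g y * k (x, y))"
proof -
  have [measurable]: "f \<in> borel_measurable lborel" "g \<in> borel_measurable lborel"
    using f g by auto
  have 1: "integrable (lborel \<Otimes>\<^sub>M lborel) (\<lambda>(x, y). f x * g y)"
  proof (rule lborel_pair.Fubini_integrable)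
    have "(\<lambda>x. LINT y|lborel. norm (case (x, y) of (x, y) \<Rightarrow> f x * g y)) =
        (\<lambda>x. norm (f x) * (LINT y|lborel. norm (g y)))"
      by (simp add: norm_mult fun_eq_iff)
    then show "integrable lborel (\<lambda>x. LINT y|lborel. norm (case (x, y) of (x, y) \<Rightarrow> f x * g y))"
      using f by simp
  qed (use g in auto)
  show ?thesis
  proof (rule Bochner_Integration.integrable_bound[OF 1])
    show "AE p in lborel \<Otimes>\<^sub>M lborel. norm (case p of (x, y) \<Rightarrow> f x * g y * k (x, y)) \<le> norm (case p of (x, y) \<Rightarrow> f x * g y)"
    proof (rule AE_I2, clarsimp)
      fix x y
      show "norm (f x * g y * k (x, y)) \<le> norm (f x * g y)"
        using mult_left_mono[OF k1[of "(x, y)"], of "norm (f x * g y)"] by (simp add: norm_mult)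
    qed
  qed measurable
qed

lemma cis_pair_measurable [measurable]:
  "(\<lambda>p. cis (a * (fst p \<bullet> snd p))) \<in> borel_measurable (lborel \<Otimes>\<^sub>M lborel)"
  unfolding lborel_prod
  by (auto intro!: borel_measurable_continuous_onI continuous_intros)

text \<open>This is exp(-|x|^2 / 2), written as a product so that integrals factor. The
  normalisation is that of the standard normal distribution, whose characteristic function supplies
  the one-dimensional transform.\<close>

definition gauss :: "'a::euclidean_space \<Rightarrow> complex" where
  "gauss x = (\<Prod>b\<in>Basis. of_real (exp (- (x \<bullet> b)\<^sup>2 / 2)))"

text \<open>This is the transform of \<open>gauss\<close> in closed form. Its integral is 1, so its
  rescalings form an approximate identity.\<close>

definition gauss_ft :: "'a::euclidean_space \<Rightarrow> complex" where
  "gauss_ft z = (\<Prod>b\<in>Basis. of_real (sqrt (2 * pi) * exp (- (2 * pi * (z \<bullet> b))\<^sup>2 / 2)))"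

lemma exp_square_eq_density: "exp (- t\<^sup>2 / 2) = sqrt (2 * pi) * std_normal_density t"
  by (simp add: std_normal_density_def)

lemma gauss_integral_1:
  "integrable lborel (\<lambda>t. complex_of_real (exp (- t\<^sup>2 / 2)))"
  "(LINT t|lborel. cis (s * t) * complex_of_real (exp (- t\<^sup>2 / 2))) = of_real (sqrt (2 * pi) * exp (- s\<^sup>2 / 2))"
proof -
  show "integrable lborel (\<lambda>t. complex_of_real (exp (- t\<^sup>2 / 2)))"
    unfolding exp_square_eq_density by (simp del: of_real_mult)
  have "(LINT t|lborel. cis (s * t) * complex_of_real (exp (- t\<^sup>2 / 2))) =
     (LINT t|lborel. complex_of_real (sqrt (2 * pi)) * (std_normal_density t *\<^sub>R iexp (s * t)))"
    unfolding exp_square_eq_density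
    by (rule Bochner_Integration.integral_cong) (auto simp: cis_conv_exp scaleR_conv_of_real)
  also have "\<dots> = complex_of_real (sqrt (2 * pi)) * (LINT t|lborel. std_normal_density t *\<^sub>R iexp (s * t))"
    by (rule Bochner_Integration.integral_mult_right_zero)
  also have "(LINT t|lborel. std_normal_density t *\<^sub>R iexp (s * t)) = char std_normal_distribution s"
    unfolding char_def by (subst integral_density) (auto intro!: normal_density_nonneg)
  also have "\<dots> = of_real (exp (- s\<^sup>2 / 2))"
    by (simp add: char_std_normal_distribution)
  finally show "(LINT t|lborel. cis (s * t) * complex_of_real (exp (- t\<^sup>2 / 2))) = of_real (sqrt (2 * pi) * exp (- s\<^sup>2 / 2))"
    by simp
qed

lemma gauss_integrable: "integrable lborel gauss"
  unfolding gauss_def[abs_def] by (rule integral_lborel_prod(1)) (rule gauss_integral_1(1))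

lemma cis_sum: "cis (\<Sum>b\<in>A. f b) = (\<Prod>b\<in>A. cis (f b))"
  by (induction A rule: infinite_finite_induct) (auto simp: cis_mult[symmetric])

lemma ft_gauss:
  "(LINT \<xi>|lborel. cis (2 * pi * (z \<bullet> \<xi>)) * gauss \<xi>) = gauss_ft (z :: 'a::euclidean_space)"
proof -
  have "cis (2 * pi * (z \<bullet> \<xi>)) * gauss \<xi> =
      (\<Prod>b\<in>Basis. cis (2 * pi * (z \<bullet> b) * (\<xi> \<bullet> b)) * of_real (exp (- (\<xi> \<bullet> b)\<^sup>2 / 2)))" for \<xi>
    unfolding gauss_def euclidean_inner[of z \<xi>] sum_distrib_left cis_sum prod.distrib[symmetric]
    by (simp add: mult.assoc)
  moreover have int: "integrable lborel (\<lambda>t. cis (2 * pi * (z \<bullet> b) * t) * complex_of_real (exp (- t\<^sup>2 / 2)))" for b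
    using integrable_cis_mult[OF gauss_integral_1(1), of "2 * pi * (z \<bullet> b)" 1] by simp
  ultimately have "(LINT \<xi>|lborel. cis (2 * pi * (z \<bullet> \<xi>)) * gauss \<xi>) =
      (\<Prod>b\<in>Basis. LINT t|lborel. cis (2 * pi * (z \<bullet> b) * t) * of_real (exp (- t\<^sup>2 / 2)))"
    using integral_lborel_prod(2)[of "\<lambda>b t. cis (2 * pi * (z \<bullet> b) * t) * of_real (exp (- t\<^sup>2 / 2))"] int
    by simp
  then show ?thesis unfolding gauss_integral_1(2) gauss_ft_def .
qed

lemma gauss_ft_integral:
  "integrable lborel (gauss_ft :: 'a::euclidean_space \<Rightarrow> complex)"
  "integral\<^sup>L lborel (gauss_ft :: 'a \<Rightarrow> complex) = 1"
proof -
  have 1: "integrable lborel (\<lambda>t. complex_of_real (sqrt (2 * pi) * exp (- (2 * pi * t)\<^sup>2 / 2)))"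
  proof -
    have "integrable lborel (\<lambda>t. complex_of_real (exp (- (0 + 2 * pi * t)\<^sup>2 / 2)))"
      by (subst lborel_integrable_real_affine_iff[of "2 * pi" "\<lambda>t. complex_of_real (exp (- t\<^sup>2 / 2))" 0])
        (use gauss_integral_1(1) in simp_all)
    then show ?thesis unfolding of_real_mult by (intro Bochner_Integration.integrable_mult_right) simp
  qed
  have 2: "(LINT t|lborel. complex_of_real (sqrt (2 * pi) * exp (- (2 * pi * t)\<^sup>2 / 2))) = 1"
  proof -
    have "(LINT t|lborel. complex_of_real (exp (- t\<^sup>2 / 2))) =
        (2 * pi) *\<^sub>R (LINT t|lborel. complex_of_real (exp (- (0 + 2 * pi * t)\<^sup>2 / 2)))"
      using lborel_integral_real_affine[of "2 * pi" "\<lambda>t. complex_of_real (exp (- t\<^sup>2 / 2))" 0] by simp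
    moreover have "(LINT t|lborel. complex_of_real (exp (- t\<^sup>2 / 2))) = complex_of_real (sqrt (2 * pi))"
      using gauss_integral_1(2)[of 0] by simp
    ultimately have "(LINT t|lborel. complex_of_real (exp (- (2 * pi * t)\<^sup>2 / 2))) = complex_of_real (sqrt (2 * pi) / (2 * pi))"
      by (simp add: field_simps scaleR_conv_of_real)
    then have "(LINT t|lborel. complex_of_real (sqrt (2 * pi) * exp (- (2 * pi * t)\<^sup>2 / 2))) =
        complex_of_real (sqrt (2 * pi) * (sqrt (2 * pi) / (2 * pi)))"
      unfolding of_real_mult by simp
    also have "sqrt (2 * pi) * (sqrt (2 * pi) / (2 * pi)) = 1" by simp
    finally show ?thesis by simp
  qed
  show "integrable lborel (gauss_ft :: 'a \<Rightarrow> complex)"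
    unfolding gauss_ft_def[abs_def] by (rule integral_lborel_prod(1)) (rule 1)
  show "integral\<^sup>L lborel (gauss_ft :: 'a \<Rightarrow> complex) = 1"
    unfolding gauss_ft_def[abs_def] by (subst integral_lborel_prod(2)) (simp_all only: 1 2 prod.neutral_const)
qed

lemma gauss_props:
  fixes x :: "'a::euclidean_space"
  shows "gauss (0::'a) = 1" "norm (gauss x) \<le> 1" "isCont gauss x"
    "gauss \<in> borel_measurable (borel :: 'a measure)"
proof -
  show "gauss (0::'a) = 1" by (simp add: gauss_def)
  show "norm (gauss x) \<le> 1" unfolding gauss_def prod_norm[symmetric] by (intro prod_le_1) auto
  show "isCont gauss x" unfolding gauss_def[abs_def] by (intro continuous_intros) auto
  show "gauss \<in> borel_measurable (borel :: 'a measure)" unfolding gauss_def[abs_def] by measurable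
qed

lemma gauss_ft_even: "gauss_ft (- z) = gauss_ft z"
  by (simp add: gauss_ft_def)

text \<open>The factor \<open>gauss (e *\<^sub>R \<xi>)\<close> makes the double integral absolutely
  convergent. Fubini's theorem then transforms the Gaussian instead of \<open>f\<close>, and what
  remains is an average of \<open>f\<close> around \<open>x\<close> at distance of order
  \<open>e\<close>.\<close>

lemma gauss_mean_inverse:
  fixes f :: "'a::euclidean_space \<Rightarrow> complex"
  assumes f: "f \<in> schwartz" and e: "0 < e"
  shows "(LINT \<xi>|lborel. cis (2 * pi * (x \<bullet> \<xi>)) * ft (- 2 * pi) f \<xi> * gauss (e *\<^sub>R \<xi>)) =
    (LINT z|lborel. f (x + e *\<^sub>R z) * gauss_ft z)"
proof -
  note [measurable] = schwartz_measurable[OF f] gauss_props(4)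
  define g where "g \<xi> = gauss (e *\<^sub>R \<xi>)" for \<xi> :: 'a
  have ig: "integrable lborel g"
    unfolding g_def using integral_lborel_affine(1)[of e "gauss :: 'a \<Rightarrow> complex" 0] e gauss_integrable[where 'a='a] gauss_props(4)[where 'a='a]
    by simp
  have [measurable]: "g \<in> borel_measurable borel" unfolding g_def[abs_def] by measurable
  have int: "integrable (lborel \<Otimes>\<^sub>M lborel) (\<lambda>(y, \<xi>). f y * (cis (2 * pi * (x \<bullet> \<xi>)) * g \<xi>) * cis (- 2 * pi * (fst (y, \<xi>) \<bullet> snd (y, \<xi>))))"
    by (rule integrable_lborel_pair_mult[where k = "\<lambda>p. cis (- 2 * pi * (fst p \<bullet> snd p))", OF _ _ cis_pair_measurable])
      (auto intro!: schwartz_integrable f integrable_cis_mult[where a="2*pi" and \<xi>=x, unfolded inner_commute[of _ x]] ig)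
  have "(LINT \<xi>|lborel. cis (2 * pi * (x \<bullet> \<xi>)) * ft (- 2 * pi) f \<xi> * g \<xi>) =
    (LINT \<xi>|lborel. LINT y|lborel. f y * (cis (2 * pi * (x \<bullet> \<xi>)) * g \<xi>) * cis (- 2 * pi * (y \<bullet> \<xi>)))"
  proof (rule Bochner_Integration.integral_cong[OF refl])
    fix \<xi>
    have "cis (2 * pi * (x \<bullet> \<xi>)) * ft (- 2 * pi) f \<xi> * g \<xi> =
       cis (2 * pi * (x \<bullet> \<xi>)) * g \<xi> * (LINT y|lborel. cis (- 2 * pi * (y \<bullet> \<xi>)) * f y)"
      by (simp add: ft_def)
    also have "\<dots> = (LINT y|lborel. cis (2 * pi * (x \<bullet> \<xi>)) * g \<xi> * (cis (- 2 * pi * (y \<bullet> \<xi>)) * f y))"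
      by simp
    finally show "cis (2 * pi * (x \<bullet> \<xi>)) * ft (- 2 * pi) f \<xi> * g \<xi> =
       (LINT y|lborel. f y * (cis (2 * pi * (x \<bullet> \<xi>)) * g \<xi>) * cis (- 2 * pi * (y \<bullet> \<xi>)))"
      by (simp add: mult_ac)
  qed
  also have "\<dots> = (LINT y|lborel. LINT \<xi>|lborel. f y * (cis (2 * pi * (x \<bullet> \<xi>)) * g \<xi>) * cis (- 2 * pi * (y \<bullet> \<xi>)))"
    using lborel_pair.Fubini_integral[of "\<lambda>y \<xi>. f y * (cis (2 * pi * (x \<bullet> \<xi>)) * g \<xi>) * cis (- 2 * pi * (y \<bullet> \<xi>))"] int
    by simp
  also have "\<dots> = (LINT y|lborel. f y * (inverse e ^ DIM('a) *\<^sub>R gauss_ft (inverse e *\<^sub>R (y - x))))"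
  proof (rule Bochner_Integration.integral_cong[OF refl])
    fix y
    \<comment> \<open>With this \<open>z\<close> the phases in \<open>x\<close> and \<open>y\<close>
      combine to the phase of z \<bullet> (e \<xi>), so the inner integral is a dilated Gaussian
      transform.\<close>
    define z where "z = inverse e *\<^sub>R (x - y)"
    have "(LINT \<xi>|lborel. f y * (cis (2 * pi * (x \<bullet> \<xi>)) * g \<xi>) * cis (- 2 * pi * (y \<bullet> \<xi>))) =
      (LINT \<xi>|lborel. f y * (cis (2 * pi * (z \<bullet> (e *\<^sub>R \<xi>))) * gauss (e *\<^sub>R \<xi>)))"
    proof (rule Bochner_Integration.integral_cong[OF refl])
      fix \<xi>
      have "2 * pi * (z \<bullet> (e *\<^sub>R \<xi>)) = 2 * pi * (x \<bullet> \<xi>) + (- 2 * pi * (y \<bullet> \<xi>))"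
        using e by (simp add: z_def inner_diff_left field_simps)
      then have "cis (2 * pi * (z \<bullet> (e *\<^sub>R \<xi>))) = cis (2 * pi * (x \<bullet> \<xi>)) * cis (- 2 * pi * (y \<bullet> \<xi>))"
        by (simp only: cis_mult)
      then show "f y * (cis (2 * pi * (x \<bullet> \<xi>)) * g \<xi>) * cis (- 2 * pi * (y \<bullet> \<xi>)) =
          f y * (cis (2 * pi * (z \<bullet> (e *\<^sub>R \<xi>))) * gauss (e *\<^sub>R \<xi>))"
        by (simp only: g_def mult_ac)
    qed
    also have "\<dots> = f y * (LINT \<xi>|lborel. cis (2 * pi * (z \<bullet> (e *\<^sub>R \<xi>))) * gauss (e *\<^sub>R \<xi>))"
      by simp
    also have "(LINT \<xi>|lborel. cis (2 * pi * (z \<bullet> (e *\<^sub>R \<xi>))) * gauss (e *\<^sub>R \<xi>)) =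
        inverse e ^ DIM('a) *\<^sub>R (LINT \<xi>|lborel. cis (2 * pi * (z \<bullet> \<xi>)) * gauss \<xi>)"
    proof -
      have "(\<lambda>\<xi>. cis (2 * pi * (z \<bullet> \<xi>)) * gauss \<xi>) \<in> borel_measurable borel"
        using cis_inner_measurable[of "2 * pi" z] unfolding inner_commute[of _ z] by measurable
      from integral_lborel_affine(2)[OF _ this, of e 0] show ?thesis
        using e by (simp add: field_simps)
    qed
    also have "(LINT \<xi>|lborel. cis (2 * pi * (z \<bullet> \<xi>)) * gauss \<xi>) = gauss_ft (inverse e *\<^sub>R (y - x))"
      unfolding ft_gauss z_def by (subst gauss_ft_even[symmetric]) (simp flip: scaleR_minus_right)
    finally show "(LINT \<xi>|lborel. f y * (cis (2 * pi * (x \<bullet> \<xi>)) * g \<xi>) * cis (- 2 * pi * (y \<bullet> \<xi>))) =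
        f y * (inverse e ^ DIM('a) *\<^sub>R gauss_ft (inverse e *\<^sub>R (y - x)))" .
  qed
  also have "\<dots> = (LINT z|lborel. f (x + e *\<^sub>R z) * gauss_ft z)"
  proof -
    have [measurable]: "gauss_ft \<in> borel_measurable (borel :: 'a measure)"
      unfolding gauss_ft_def[abs_def] by measurable
    have "(\<lambda>y. f y * (inverse e ^ DIM('a) *\<^sub>R gauss_ft (inverse e *\<^sub>R (y - x)))) \<in> borel_measurable borel"
      by measurable
    from integral_lborel_affine(2)[OF _ this, of e x] show ?thesis
      using e by (simp add: power_inverse)
  qed
  finally show ?thesis by (simp add: g_def)
qed

text \<open>As the Gaussian damping is removed, the left side of \<open>gauss_mean_inverse\<close>
  tends to the iterated transform and the averages tend to \<open>f x\<close>; both limits are by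
  dominated convergence.\<close>

theorem ft_inversion:
  fixes f :: "'a::euclidean_space \<Rightarrow> complex"
  assumes f: "f \<in> schwartz"
  shows "ft (2 * pi) (ft (- 2 * pi) f) = f"
proof
  fix x :: 'a
  note [measurable] = schwartz_measurable[OF f] gauss_props(4)
  have F: "ft (- 2 * pi) f \<in> schwartz" using f by (rule schwartz_ft[rotated]) simp
  note [measurable] = schwartz_measurable[OF F]
  have [measurable]: "gauss_ft \<in> borel_measurable (borel :: 'a measure)"
    unfolding gauss_ft_def[abs_def] by measurable
  have mc[measurable]: "(\<lambda>\<xi>. cis (2 * pi * (x \<bullet> \<xi>))) \<in> borel_measurable borel"
    using cis_inner_measurable[of "2 * pi" x] unfolding inner_commute[of _ x] .
  define e where "e n = inverse (real (Suc n))" for n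
  have e: "0 < e n" for n by (simp add: e_def)
  have e0: "e \<longlonglongrightarrow> 0" unfolding e_def[abs_def] by (rule LIMSEQ_inverse_real_of_nat)
  obtain C where C: "C \<ge> 0" "\<And>x. norm (f x) \<le> C"
    using schwartz_bound[OF f, of 0] by auto
  have "(\<lambda>n. LINT \<xi>|lborel. cis (2 * pi * (x \<bullet> \<xi>)) * ft (- 2 * pi) f \<xi> * gauss (e n *\<^sub>R \<xi>)) \<longlonglongrightarrow>
     (LINT \<xi>|lborel. cis (2 * pi * (x \<bullet> \<xi>)) * ft (- 2 * pi) f \<xi>)"
  proof (rule integral_dominated_convergence)
    show "integrable lborel (\<lambda>\<xi>. norm (ft (- 2 * pi) f \<xi>))"
      using schwartz_integrable[OF F] by simp
    show "AE \<xi> in lborel. norm (cis (2 * pi * (x \<bullet> \<xi>)) * ft (- 2 * pi) f \<xi> * gauss (e n *\<^sub>R \<xi>)) \<le> norm (ft (- 2 * pi) f \<xi>)" for n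
    proof (rule AE_I2)
      fix \<xi> :: 'a
      show "norm (cis (2 * pi * (x \<bullet> \<xi>)) * ft (- 2 * pi) f \<xi> * gauss (e n *\<^sub>R \<xi>)) \<le> norm (ft (- 2 * pi) f \<xi>)"
        using mult_left_mono[OF gauss_props(2)[of "e n *\<^sub>R \<xi>"], of "norm (ft (- 2 * pi) f \<xi>)"]
        by (simp add: norm_mult)
    qed
    show "AE \<xi> in lborel. (\<lambda>n. cis (2 * pi * (x \<bullet> \<xi>)) * ft (- 2 * pi) f \<xi> * gauss (e n *\<^sub>R \<xi>)) \<longlonglongrightarrow> cis (2 * pi * (x \<bullet> \<xi>)) * ft (- 2 * pi) f \<xi>"
    proof (rule AE_I2)
      fix \<xi> :: 'a
      have "(\<lambda>n. e n *\<^sub>R \<xi>) \<longlonglongrightarrow> 0" using tendsto_scaleR[OF e0 tendsto_const[of \<xi>]] by simp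
      then have "(\<lambda>n. gauss (e n *\<^sub>R \<xi>)) \<longlonglongrightarrow> gauss (0::'a)"
        by (rule isCont_tendsto_compose[where g = gauss and l = "0::'a", OF gauss_props(3)])
      from tendsto_mult_left[OF this, of "cis (2 * pi * (x \<bullet> \<xi>)) * ft (- 2 * pi) f \<xi>"]
      show "(\<lambda>n. cis (2 * pi * (x \<bullet> \<xi>)) * ft (- 2 * pi) f \<xi> * gauss (e n *\<^sub>R \<xi>)) \<longlonglongrightarrow> cis (2 * pi * (x \<bullet> \<xi>)) * ft (- 2 * pi) f \<xi>"
        by (simp add: gauss_props(1))
    qed
  qed measurable
  moreover have "(\<lambda>n. LINT z|lborel. f (x + e n *\<^sub>R z) * gauss_ft z) \<longlonglongrightarrow> (LINT z::'a|lborel. f x * gauss_ft z)"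
  proof (rule integral_dominated_convergence)
    show "integrable lborel (\<lambda>z::'a. C * norm (gauss_ft z))"
      using integrable_norm[OF gauss_ft_integral(1)] by (rule Bochner_Integration.integrable_mult_right)
    show "AE z in lborel. norm (f (x + e n *\<^sub>R z) * gauss_ft z) \<le> C * norm (gauss_ft z)" for n
      using mult_right_mono[OF C(2)] by (intro AE_I2) (simp add: norm_mult)
    show "AE z in lborel. (\<lambda>n. f (x + e n *\<^sub>R z) * gauss_ft z) \<longlonglongrightarrow> f x * gauss_ft z"
    proof (rule AE_I2)
      fix z :: 'a
      have "(\<lambda>n. x + e n *\<^sub>R z) \<longlonglongrightarrow> x"
        using tendsto_add[OF tendsto_const tendsto_scaleR[OF e0 tendsto_const[of z]], of x] by simp
      then have "(\<lambda>n. f (x + e n *\<^sub>R z)) \<longlonglongrightarrow> f x"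
        by (rule isCont_tendsto_compose[OF differentiable_imp_continuous_within[OF schwartz_differentiable[OF f]]])
      then show "(\<lambda>n. f (x + e n *\<^sub>R z) * gauss_ft z) \<longlonglongrightarrow> f x * gauss_ft z"
        by (rule tendsto_mult_right)
    qed
  qed measurable
  ultimately have "(LINT \<xi>|lborel. cis (2 * pi * (x \<bullet> \<xi>)) * ft (- 2 * pi) f \<xi>) = (LINT z::'a|lborel. f x * gauss_ft z)"
    unfolding gauss_mean_inverse[OF f e] by (rule LIMSEQ_unique)
  then show "ft (2 * pi) (ft (- 2 * pi) f) x = f x"
    by (simp add: ft_def[of "2 * pi"] gauss_ft_integral(2) inner_commute)
qed

lemma inv_fourier_fourier: "f \<in> schwartz \<Longrightarrow> inv_fourier (fourier f) = f"
  unfolding fourier_eq_ft inv_fourier_eq_ft by (rule ft_inversion)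

section \<open>Fourier multipliers on bounded functions\<close>

lemma fourier_multiplier_apply:
  "fourier_multiplier m u \<psi> = u (fourier (\<lambda>\<xi>. m \<xi> * inv_fourier \<psi> \<xi>))"
  by (simp add: fourier_multiplier_def inv_fourier_dist_def mult_dist_def fourier_dist_def)

text \<open>The hypothesis allows inversion to cancel the inner pair of transforms. It concerns the
  outer symbol \<open>m\<close> only, so the inner symbol may be a bare potential.\<close>

lemma fourier_multiplier_compose:
  assumes "(\<lambda>\<xi>. m \<xi> * inv_fourier \<psi> \<xi>) \<in> schwartz"
  shows "fourier_multiplier m (fourier_multiplier a u) \<psi> = fourier_multiplier (\<lambda>\<xi>. a \<xi> * m \<xi>) u \<psi>"
  unfolding fourier_multiplier_apply inv_fourier_fourier[OF assms] by (simp add: mult.assoc)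

lemma Linf_norm_cong: "(\<And>\<psi>. \<psi> \<in> schwartz \<Longrightarrow> u \<psi> = v \<psi>) \<Longrightarrow> Linf_norm u = Linf_norm v"
  unfolding Linf_norm_def by simp

lemma schwartz_slow: "m \<in> schwartz \<Longrightarrow> scale.slow k m"
proof (induction k arbitrary: m)
  case 0
  obtain C where "C \<ge> 0" "\<forall>x. norm (m x) \<le> C" using schwartz_bound[OF 0, of 0] by auto
  then have "\<exists>C\<ge>0. \<exists>K. \<forall>x. norm (m x) \<le> C * (1 + norm x) ^ K"
    by (intro exI[of _ C] conjI exI[of _ 0]) auto
  then show ?case unfolding scale.slow.simps[OF scale_1] .
next
  case (Suc k)
  obtain C where C: "C \<ge> 0" "\<forall>x. norm (m x) \<le> C" using schwartz_bound[OF Suc.prems, of 0] by auto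
  then have "\<exists>C\<ge>0. \<exists>K. \<forall>x. norm (m x) \<le> C * (1 + norm x) ^ K"
    by (intro exI[of _ C] conjI exI[of _ 0]) auto
  then show ?case
    unfolding scale.slow.simps[OF scale_1]
    using Suc schwartz_partial_deriv schwartz_differentiable by blast
qed

lemma schwartz_mult: "m \<in> schwartz \<Longrightarrow> f \<in> schwartz \<Longrightarrow> (\<lambda>x. m x * f x) \<in> schwartz"
  using schwartz_mult_slow schwartz_slow by blast

lemma integral_lborel_translate:
  fixes f :: "'a::euclidean_space \<Rightarrow> 'b::{banach, second_countable_topology}"
  assumes "f \<in> borel_measurable borel"
  shows "integrable lborel (\<lambda>x. f (x - t)) \<longleftrightarrow> integrable lborel f"
    and "(LINT x|lborel. f (x - t)) = integral\<^sup>L lborel f"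
  using integral_lborel_affine[of 1 f "- t"] assms by simp_all

lemma fourier_mult_inv_fourier:
  fixes m \<psi> :: "'a::euclidean_space \<Rightarrow> complex"
  assumes m: "m \<in> schwartz" and \<psi>: "\<psi> \<in> schwartz"
  shows "fourier (\<lambda>\<xi>. m \<xi> * inv_fourier \<psi> \<xi>) x = (LINT y|lborel. \<psi> y * fourier m (x - y))"
proof -
  note [measurable] = schwartz_measurable[OF m] schwartz_measurable[OF \<psi>]
  let ?K = "\<lambda>\<xi> y. m \<xi> * \<psi> y * cis (- 2 * pi * (\<xi> \<bullet> (x - y)))"
  have mk: "(\<lambda>p. cis (- 2 * pi * (fst p \<bullet> (x - snd p)))) \<in> borel_measurable (lborel \<Otimes>\<^sub>M lborel)"
    unfolding lborel_prod by (auto intro!: borel_measurable_continuous_onI continuous_intros)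
  have int: "integrable (lborel \<Otimes>\<^sub>M lborel) (\<lambda>(\<xi>, y). ?K \<xi> y)"
    using integrable_lborel_pair_mult[OF schwartz_integrable[OF m] schwartz_integrable[OF \<psi>] mk] by simp
  have "fourier (\<lambda>\<xi>. m \<xi> * inv_fourier \<psi> \<xi>) x = (LINT \<xi>|lborel. LINT y|lborel. ?K \<xi> y)"
    unfolding fourier_def
  proof (rule Bochner_Integration.integral_cong[OF refl])
    fix \<xi>
    have "cis (- 2 * pi * (\<xi> \<bullet> x)) * (m \<xi> * inv_fourier \<psi> \<xi>) =
        (LINT y|lborel. cis (- 2 * pi * (\<xi> \<bullet> x)) * m \<xi> * (cis (2 * pi * (\<xi> \<bullet> y)) * \<psi> y))"
      by (simp add: inv_fourier_def)
    also have "\<dots> = (LINT y|lborel. ?K \<xi> y)"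
    proof (rule Bochner_Integration.integral_cong[OF refl])
      fix y
      have "- 2 * pi * (\<xi> \<bullet> (x - y)) = - 2 * pi * (\<xi> \<bullet> x) + 2 * pi * (\<xi> \<bullet> y)"
        by (simp add: inner_diff_right algebra_simps)
      then show "cis (- 2 * pi * (\<xi> \<bullet> x)) * m \<xi> * (cis (2 * pi * (\<xi> \<bullet> y)) * \<psi> y) = ?K \<xi> y"
        by (simp only: cis_mult[symmetric] mult_ac)
    qed
    finally show "cis (- 2 * pi * (\<xi> \<bullet> x)) * (m \<xi> * inv_fourier \<psi> \<xi>) = (LINT y|lborel. ?K \<xi> y)" .
  qed
  also have "\<dots> = (LINT y|lborel. LINT \<xi>|lborel. ?K \<xi> y)"
    using lborel_pair.Fubini_integral[OF int] by simp
  also have "\<dots> = (LINT y|lborel. \<psi> y * fourier m (x - y))"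
  proof (rule Bochner_Integration.integral_cong[OF refl])
    fix y
    have "(LINT \<xi>|lborel. ?K \<xi> y) = (LINT \<xi>|lborel. \<psi> y * (cis (- 2 * pi * (\<xi> \<bullet> (x - y))) * m \<xi>))"
      by (simp only: mult_ac)
    then show "(LINT \<xi>|lborel. ?K \<xi> y) = \<psi> y * fourier m (x - y)"
      by (simp add: fourier_def)
  qed
  finally show ?thesis .
qed

text \<open>The transposed multiplier convolves the test function with \<open>fourier m\<close>;
  Fubini's theorem moves this convolution onto \<open>h\<close>. The function \<open>g\<close> is
  the resulting correlation of \<open>h\<close> with the kernel, and its bound is Young's inequality
  at the endpoint.\<close>

lemma regular_dist_multiplier:
  fixes m h :: "'a::euclidean_space \<Rightarrow> complex"
  assumes m: "m \<in> schwartz" and h[measurable]: "h \<in> borel_measurable borel" and B: "\<And>x. norm (h x) \<le> B"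
  defines "g \<equiv> \<lambda>y. LINT x|lborel. h x * fourier m (x - y)"
  shows "g \<in> borel_measurable borel" "norm (g y) \<le> B * (LINT x|lborel. norm (fourier m x))"
    and "\<psi> \<in> schwartz \<Longrightarrow> regular_dist h (fourier (\<lambda>\<xi>. m \<xi> * inv_fourier \<psi> \<xi>)) = regular_dist g \<psi>"
proof -
  let ?k = "fourier m"
  have k: "?k \<in> schwartz" using m by (rule schwartz_fourier)
  note mk[measurable] = schwartz_measurable[OF k]
  have B0: "0 \<le> B" using B[of undefined] norm_ge_zero order_trans by blast
  show "g \<in> borel_measurable borel"
    unfolding g_def by measurable
  have ik: "integrable lborel (\<lambda>x. ?k (x - y))" for y
    using integral_lborel_translate(1)[OF mk] schwartz_integrable[OF k] by simp
  have nk: "(LINT x|lborel. norm (?k (x - y))) = (LINT x|lborel. norm (?k x))" for y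
    using integral_lborel_translate(2)[of "\<lambda>x. norm (?k x)" y] by simp
  show "norm (g y) \<le> B * (LINT x|lborel. norm (?k x))"
  proof -
    have "norm (g y) \<le> (LINT x|lborel. norm (h x * ?k (x - y)))"
      unfolding g_def by (rule integral_norm_bound)
    also have "\<dots> \<le> (LINT x|lborel. B * norm (?k (x - y)))"
      by (rule integral_mono') (use ik B B0 in \<open>auto simp: norm_mult mult_right_mono\<close>)
    also have "\<dots> = B * (LINT x|lborel. norm (?k x))" by (simp add: nk)
    finally show ?thesis .
  qed
  assume \<psi>: "\<psi> \<in> schwartz"
  note [measurable] = schwartz_measurable[OF \<psi>]
  have 1: "integrable (lborel \<Otimes>\<^sub>M lborel) (\<lambda>(y, x). \<psi> y * ?k (x - y))"
  proof (rule lborel_pair.Fubini_integrable)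
    have "(\<lambda>y. LINT x|lborel. norm (case (y, x) of (y, x) \<Rightarrow> \<psi> y * ?k (x - y))) =
        (\<lambda>y. norm (\<psi> y) * (LINT x|lborel. norm (?k x)))"
      by (simp add: norm_mult fun_eq_iff nk)
    then show "integrable lborel (\<lambda>y. LINT x|lborel. norm (case (y, x) of (y, x) \<Rightarrow> \<psi> y * ?k (x - y)))"
      using schwartz_integrable[OF \<psi>] by simp
    show "AE y in lborel. integrable lborel (\<lambda>x. case (y, x) of (y, x) \<Rightarrow> \<psi> y * ?k (x - y))"
      using ik by simp
  qed measurable
  let ?F = "\<lambda>y x. h x * (\<psi> y * ?k (x - y))"
  have int: "integrable (lborel \<Otimes>\<^sub>M lborel) (\<lambda>(y, x). ?F y x)"
  proof (rule Bochner_Integration.integrable_bound)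
    show "integrable (lborel \<Otimes>\<^sub>M lborel) (\<lambda>p. B * norm (case p of (y, x) \<Rightarrow> \<psi> y * ?k (x - y)))"
      using integrable_norm[OF 1] by (rule Bochner_Integration.integrable_mult_right)
    show "AE p in lborel \<Otimes>\<^sub>M lborel. norm (case p of (y, x) \<Rightarrow> ?F y x) \<le> norm (B * norm (case p of (y, x) \<Rightarrow> \<psi> y * ?k (x - y)))"
      by (rule AE_I2) (use B B0 in \<open>auto simp: norm_mult abs_mult intro!: mult_right_mono\<close>)
  qed measurable
  have "regular_dist h (fourier (\<lambda>\<xi>. m \<xi> * inv_fourier \<psi> \<xi>)) = (LINT x|lborel. LINT y|lborel. ?F y x)"
    unfolding regular_dist_def fourier_mult_inv_fourier[OF m \<psi>] by simp
  also have "\<dots> = (LINT y|lborel. LINT x|lborel. ?F y x)"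
    using lborel_pair.Fubini_integral[OF int] .
  also have "\<dots> = regular_dist g \<psi>"
    unfolding regular_dist_def g_def
  proof (rule Bochner_Integration.integral_cong[OF refl])
    fix y
    have "(LINT x|lborel. ?F y x) = (LINT x|lborel. \<psi> y * (h x * ?k (x - y)))"
      by (simp only: mult_ac)
    then show "(LINT x|lborel. ?F y x) = (LINT x|lborel. h x * ?k (x - y)) * \<psi> y"
      by (simp add: mult.commute)
  qed
  finally show "regular_dist h (fourier (\<lambda>\<xi>. m \<xi> * inv_fourier \<psi> \<xi>)) = regular_dist g \<psi>" .
qed

section \<open>The supremum norm of a functional and multiplier estimates\<close>

lemma Linf_norm_leI:
  assumes g: "g \<in> borel_measurable borel" and B: "\<And>x. norm (g x) \<le> B"
    and rep: "\<And>\<psi>. \<psi> \<in> schwartz \<Longrightarrow> u \<psi> = regular_dist g \<psi>"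
  shows "Linf_norm u \<le> ennreal B"
proof -
  have "Linf_norm u \<le> esssup lborel (\<lambda>x. ennreal (norm (g x)))"
    unfolding Linf_norm_def by (rule INF_lower) (use g rep in auto)
  also have "\<dots> \<le> ennreal B"
    by (rule esssup_I) (use g B in \<open>auto intro: ennreal_leI\<close>)
  finally show ?thesis .
qed

text \<open>A strict bound on an infimum of essential suprema yields a representative below
  \<open>B\<close> almost everywhere. Setting it to zero on the exceptional null set makes the bound
  hold everywhere, as the convolution estimate requires.\<close>

lemma Linf_norm_lessD:
  fixes u :: "'a::euclidean_space functional"
  assumes "Linf_norm u < ennreal B"
  obtains g where "g \<in> borel_measurable borel" "\<And>x. norm (g x) \<le> B"
    "\<And>\<psi>. \<psi> \<in> schwartz \<Longrightarrow> u \<psi> = regular_dist g \<psi>"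
proof -
  obtain h where h: "h \<in> borel_measurable lborel" "\<And>\<psi>. \<psi> \<in> schwartz \<Longrightarrow> u \<psi> = regular_dist h \<psi>"
    and less: "esssup lborel (\<lambda>x. ennreal (norm (h x))) < ennreal B"
    using assms unfolding Linf_norm_def INF_less_iff by auto
  have B0: "0 < B" using less by (metis ennreal_eq_0_iff not_le not_less_zero)
  define g where "g x = (if norm (h x) \<le> B then h x else 0)" for x
  have [measurable]: "h \<in> borel_measurable borel" using h(1) by simp
  have g[measurable]: "g \<in> borel_measurable borel" unfolding g_def[abs_def] by simp
  have "AE x in lborel. ennreal (norm (h x)) \<le> esssup lborel (\<lambda>x. ennreal (norm (h x)))"
    by (rule esssup_AE)
  then have ae: "AE x in lborel. g x = h x"
  proof eventually_elim
    fix x assume "ennreal (norm (h x)) \<le> esssup lborel (\<lambda>x. ennreal (norm (h x)))"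
    then have "ennreal (norm (h x)) \<le> ennreal B" using less by simp
    then show "g x = h x" using B0 by (simp add: g_def)
  qed
  show thesis
  proof (rule that[OF g])
    show "norm (g x) \<le> B" for x using B0 by (simp add: g_def)
    fix \<psi> :: "'a \<Rightarrow> complex" assume \<psi>: "\<psi> \<in> schwartz"
    note [measurable] = schwartz_measurable[OF \<psi>]
    have "regular_dist h \<psi> = regular_dist g \<psi>"
      unfolding regular_dist_def
      by (rule integral_cong_AE) (use ae in \<open>auto elim: eventually_mono\<close>)
    then show "u \<psi> = regular_dist g \<psi>" using h(2)[OF \<psi>] by simp
  qed
qed

lemma Linf_norm_multiplier:
  fixes m :: "'a::euclidean_space \<Rightarrow> complex"
  assumes m: "m \<in> schwartz" and K: "(LINT x|lborel. norm (fourier m x)) \<le> K" "0 < K"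
  shows "Linf_norm (fourier_multiplier m u) \<le> ennreal K * Linf_norm u"
proof (rule ennreal_le_epsilon)
  fix e :: real assume fin: "ennreal K * Linf_norm u < top" and e: "0 < e"
  \<comment> \<open>Positivity of \<open>K\<close> matters here: in \<open>ennreal\<close> the
    product of 0 and infinity is 0, so finiteness of the product would otherwise say nothing about
    \<open>u\<close>.\<close>
  then have "Linf_norm u < top" using K(2) by (metis ennreal_mult_top ennreal_eq_0_iff less_irrefl not_le top.not_eq_extremum)
  then obtain L where L: "Linf_norm u = ennreal L" "0 \<le> L" by (cases "Linf_norm u") auto
  \<comment> \<open>The slack is \<open>e / K\<close> so that it becomes \<open>e\<close> after
    multiplication by the kernel norm.\<close>
  have "Linf_norm u < ennreal (L + e / K)"
    unfolding L using L(2) e K(2) by (intro ennreal_lessI) (simp_all add: add_nonneg_pos)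
  then obtain h where h: "h \<in> borel_measurable borel" "\<And>x. norm (h x) \<le> L + e / K"
    "\<And>\<psi>. \<psi> \<in> schwartz \<Longrightarrow> u \<psi> = regular_dist h \<psi>"
    by (rule Linf_norm_lessD) blast
  let ?g = "\<lambda>y. LINT x|lborel. h x * fourier m (x - y)"
  have "Linf_norm (fourier_multiplier m u) \<le> ennreal ((L + e / K) * K)"
  proof (rule Linf_norm_leI)
    show "?g \<in> borel_measurable borel" by (rule regular_dist_multiplier(1)[OF m h(1,2)])
    show "norm (?g y) \<le> (L + e / K) * K" for y
      using regular_dist_multiplier(2)[OF m h(1,2), of y] mult_left_mono[OF K(1), of "L + e / K"] L(2) e K(2)
      by simp
    show "fourier_multiplier m u \<psi> = regular_dist ?g \<psi>" if "\<psi> \<in> schwartz" for \<psi>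
      unfolding fourier_multiplier_apply
      using h(3)[OF schwartz_fourier[OF schwartz_mult[OF m schwartz_inv_fourier[OF that]]]]
        regular_dist_multiplier(3)[OF m h(1,2) that] by simp
  qed
  also have "(L + e / K) * K = K * L + e" using K(2) by (simp add: field_simps)
  also have "ennreal (K * L + e) = ennreal K * Linf_norm u + ennreal e"
    using L e K(2) by (simp add: ennreal_plus ennreal_mult)
  finally show "Linf_norm (fourier_multiplier m u) \<le> ennreal K * Linf_norm u + ennreal e" .
qed

lemma regular_dist_add:
  assumes h: "h \<in> borel_measurable borel" "\<And>x. norm (h x) \<le> B"
    and g: "g \<in> borel_measurable borel" "\<And>x. norm (g x) \<le> D" and \<psi>: "\<psi> \<in> schwartz"
  shows "regular_dist (\<lambda>x. h x + g x) \<psi> = regular_dist h \<psi> + regular_dist g \<psi>"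
proof -
  have int: "integrable lborel (\<lambda>x. h x * \<psi> x)" if [measurable]: "h \<in> borel_measurable borel" and B: "\<And>x. norm (h x) \<le> B" for h B
  proof (rule Bochner_Integration.integrable_bound)
    have [measurable]: "\<psi> \<in> borel_measurable borel" by (rule schwartz_measurable[OF \<psi>])
    show "integrable lborel (\<lambda>x. B * norm (\<psi> x))" using schwartz_integrable[OF \<psi>] by simp
    show "(\<lambda>x. h x * \<psi> x) \<in> borel_measurable lborel" by measurable
    show "AE x in lborel. norm (h x * \<psi> x) \<le> norm (B * norm (\<psi> x))"
      using mult_right_mono[OF order_trans[OF B abs_ge_self]] by (intro AE_I2) (simp add: norm_mult abs_mult)
  qed
  show ?thesis unfolding regular_dist_def
    using int[OF h] int[OF g] by (simp add: distrib_right)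
qed

lemma Linf_norm_add: "Linf_norm (\<lambda>\<psi>. u \<psi> + v \<psi>) \<le> Linf_norm u + Linf_norm v"
proof (rule ennreal_le_epsilon)
  fix e :: real assume fin: "Linf_norm u + Linf_norm v < top" and e: "0 < e"
  obtain L where L: "Linf_norm u = ennreal L" "0 \<le> L" using fin by (cases "Linf_norm u") auto
  obtain L' where L': "Linf_norm v = ennreal L'" "0 \<le> L'" using fin by (cases "Linf_norm v") auto
  have "Linf_norm u < ennreal (L + e / 2)" "Linf_norm v < ennreal (L' + e / 2)"
    unfolding L L' using L(2) L'(2) e by (auto intro!: ennreal_lessI)
  then obtain h g where h: "h \<in> borel_measurable borel" "\<And>x. norm (h x) \<le> L + e / 2"
    "\<And>\<psi>. \<psi> \<in> schwartz \<Longrightarrow> u \<psi> = regular_dist h \<psi>"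
    and g: "g \<in> borel_measurable borel" "\<And>x. norm (g x) \<le> L' + e / 2"
    "\<And>\<psi>. \<psi> \<in> schwartz \<Longrightarrow> v \<psi> = regular_dist g \<psi>"
    by (metis Linf_norm_lessD)
  have "Linf_norm (\<lambda>\<psi>. u \<psi> + v \<psi>) \<le> ennreal ((L + e / 2) + (L' + e / 2))"
  proof (rule Linf_norm_leI)
    show "(\<lambda>x. h x + g x) \<in> borel_measurable borel" using h g by simp
    show "norm (h x + g x) \<le> (L + e / 2) + (L' + e / 2)" for x
      by (rule norm_triangle_mono[OF h(2) g(2)])
    show "u \<psi> + v \<psi> = regular_dist (\<lambda>x. h x + g x) \<psi>" if "\<psi> \<in> schwartz" for \<psi>
      using regular_dist_add[OF h(1,2) g(1,2) that] h(3)[OF that] g(3)[OF that] by simp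
  qed
  also have "(L + e / 2) + (L' + e / 2) = L + L' + e" by simp
  also have "ennreal (L + L' + e) = Linf_norm u + Linf_norm v + ennreal e"
    using L L' e by (simp add: ennreal_plus)
  finally show "Linf_norm (\<lambda>\<psi>. u \<psi> + v \<psi>) \<le> Linf_norm u + Linf_norm v + ennreal e" .
qed

section \<open>Dilation invariance of kernel norms\<close>

lemma fourier_dilate:
  fixes q :: "'a::euclidean_space \<Rightarrow> complex"
  assumes q: "q \<in> borel_measurable borel" and c: "0 < c"
  shows "fourier (\<lambda>\<xi>. q (c *\<^sub>R \<xi>)) x = inverse c ^ DIM('a) *\<^sub>R fourier q (inverse c *\<^sub>R x)"
proof -
  have [measurable]: "q \<in> borel_measurable borel" by fact
  have "(\<lambda>\<xi>. cis (- 2 * pi * (\<xi> \<bullet> (inverse c *\<^sub>R x))) * q \<xi>) \<in> borel_measurable borel"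
    by (intro borel_measurable_times cis_inner_measurable q)
  from integral_lborel_affine(2)[OF _ this, of c 0]
  have "fourier q (inverse c *\<^sub>R x) =
      c ^ DIM('a) *\<^sub>R (LINT \<xi>|lborel. cis (- 2 * pi * ((c *\<^sub>R \<xi>) \<bullet> (inverse c *\<^sub>R x))) * q (c *\<^sub>R \<xi>))"
    unfolding fourier_def using c by simp
  moreover have "(c *\<^sub>R \<xi>) \<bullet> (inverse c *\<^sub>R x) = \<xi> \<bullet> x" for \<xi>
    using c by (simp add: field_simps)
  ultimately have "fourier q (inverse c *\<^sub>R x) = c ^ DIM('a) *\<^sub>R fourier (\<lambda>\<xi>. q (c *\<^sub>R \<xi>)) x"
    unfolding fourier_def by (simp only:)
  then show ?thesis
    using c by (simp add: power_inverse)
qed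

lemma fourier_dilate_L1:
  fixes q :: "'a::euclidean_space \<Rightarrow> complex"
  assumes q: "q \<in> schwartz" and c: "0 < c"
  shows "(LINT x|lborel. norm (fourier (\<lambda>\<xi>. q (c *\<^sub>R \<xi>)) x)) = (LINT x|lborel. norm (fourier q x))"
proof -
  have [measurable]: "fourier q \<in> borel_measurable borel" using schwartz_measurable[OF schwartz_fourier[OF q]] .
  have "(LINT x|lborel. norm (fourier q x)) =
      inverse c ^ DIM('a) * (LINT x|lborel. norm (fourier q (inverse c *\<^sub>R x)))"
    using integral_lborel_affine(2)[of "inverse c" "\<lambda>x. norm (fourier q x)" 0] c by simp
  then show ?thesis
    using c by (simp add: fourier_dilate[OF schwartz_measurable[OF q] c])
qed

section \<open>Dilations and compactly supported smooth functions\<close>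

lemma has_derivative_dilate:
  fixes f :: "'a::euclidean_space \<Rightarrow> complex"
  assumes "f differentiable (at (c *\<^sub>R x))"
  shows "((\<lambda>x. f (c *\<^sub>R x)) has_derivative (\<lambda>h. c *\<^sub>R frechet_derivative f (at (c *\<^sub>R x)) h)) (at x)"
proof -
  have "((\<lambda>x. f (c *\<^sub>R x)) has_derivative (\<lambda>h. frechet_derivative f (at (c *\<^sub>R x)) (c *\<^sub>R h))) (at x)"
    by (rule has_derivative_compose[where f = "\<lambda>x. c *\<^sub>R x", OF _ differentiable_has_derivative[OF assms]])
      (auto intro!: derivative_eq_intros)
  then show ?thesis
    using linear_cmul[OF linear_frechet_derivative[OF assms]] by simp
qed

lemma schwartz_dilate:
  fixes f :: "'a::euclidean_space \<Rightarrow> complex"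
  assumes f: "f \<in> schwartz" and c: "0 < c"
  shows "(\<lambda>x. f (c *\<^sub>R x)) \<in> schwartz"
proof -
  interpret scale "{()}" "\<lambda>_ _. 1" by (rule scale_1)
  have "fam k (\<lambda>_ x. f (c *\<^sub>R x))" for k
    using f
  proof (induction k arbitrary: f)
    have rap: "rapid (\<lambda>_ x. f (c *\<^sub>R x))" if f: "f \<in> schwartz" for f :: "'a \<Rightarrow> complex"
      unfolding rapid_def
    proof
      fix N
      obtain C where C: "C \<ge> 0" "\<And>x. (1 + norm x) ^ N * norm (f x) \<le> C"
        using schwartz_bound[OF f] by blast
      \<comment> \<open>Expanding (1 + 1/c)(1 + c |x|) produces both 1 and |x| with nonnegative
        remaining terms, for large and small \<open>c\<close> alike.\<close>
      define D where "D = 1 + inverse c"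
      have le: "1 + norm x \<le> D * (1 + norm (c *\<^sub>R x))" for x :: 'a
        using c by (simp add: D_def field_simps add_nonneg_nonneg)
      show "bd (\<lambda>i x. (1 + norm x) ^ N * norm (f (c *\<^sub>R x)))"
      proof (rule bdI[of "D ^ N * C"])
        show "0 \<le> D ^ N * C" using C(1) c by (simp add: D_def)
        fix x :: 'a
        have "(1 + norm x) ^ N * norm (f (c *\<^sub>R x)) \<le> (D * (1 + norm (c *\<^sub>R x))) ^ N * norm (f (c *\<^sub>R x))"
          by (intro mult_right_mono power_mono le) auto
        also have "\<dots> = D ^ N * ((1 + norm (c *\<^sub>R x)) ^ N * norm (f (c *\<^sub>R x)))"
          by (simp only: power_mult_distrib mult.assoc)
        also have "\<dots> \<le> D ^ N * C" by (rule mult_left_mono[OF C(2)]) (use c in \<open>simp add: D_def\<close>)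
        finally show "(1 + norm x) ^ N * norm (f (c *\<^sub>R x)) \<le> D ^ N * C * 1" by simp
      qed
    qed
    {
      case 0
      then show ?case using rap by simp
    next
      case (Suc k)
      note hd = has_derivative_dilate[OF schwartz_differentiable[OF Suc.prems]]
      have "partial_deriv b (\<lambda>x. f (c *\<^sub>R x)) = (\<lambda>x. of_real c * partial_deriv b f (c *\<^sub>R x))" for b
        by (rule ext, subst partial_deriv_eqI[OF hd]) (simp add: partial_deriv_def scaleR_conv_of_real)
      moreover have "fam k (\<lambda>_ x. of_real c * partial_deriv b f (c *\<^sub>R x))" if "b \<in> Basis" for b
        using Suc.IH[OF schwartz_partial_deriv[OF Suc.prems that]] by (intro fam_mult slow_const)
      ultimately show ?case using rap[OF Suc.prems] differentiableI[OF hd] by simp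
    }
  qed
  then show ?thesis unfolding schwartz_iff_fam schwartz_fam_def by simp
qed

lemma smooth_compact_support_schwartz:
  fixes f :: "'a::euclidean_space \<Rightarrow> complex"
  assumes f: "smooth f" and R: "\<And>x. f x \<noteq> 0 \<Longrightarrow> norm x \<le> R"
  shows "f \<in> schwartz"
proof -
  have supp: "norm x \<le> R" if "set bs \<subseteq> Basis" "iter_partial bs f x \<noteq> 0" for bs x
    using that
  proof (induction bs arbitrary: x)
    case (Cons b bs)
    have "x \<in> cball 0 R"
      by (rule partial_deriv_supp[of _ "iter_partial bs f" b]) (use Cons in auto)
    then show ?case by simp
  qed (use R in simp)
  have "bounded (range (\<lambda>x. (1 + norm x) ^ N *\<^sub>R iter_partial bs f x))" if bs: "set bs \<subseteq> Basis" for N bs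
  proof -
    have "continuous_on UNIV (iter_partial bs f)"
      using f bs differentiable_imp_continuous_within unfolding smooth_def continuous_on_eq_continuous_within
      by blast
    then have "continuous_on (cball 0 R) (\<lambda>x. (1 + norm x) ^ N *\<^sub>R iter_partial bs f x)"
      by (intro continuous_intros) (auto intro: continuous_on_subset)
    then have "bounded ((\<lambda>x. (1 + norm x) ^ N *\<^sub>R iter_partial bs f x) ` cball 0 R)"
      by (intro compact_imp_bounded compact_continuous_image) auto
    then have "bounded (insert 0 ((\<lambda>x. (1 + norm x) ^ N *\<^sub>R iter_partial bs f x) ` cball 0 R))"
      by simp
    then show ?thesis
      by (rule bounded_subset) (use supp[OF bs] in \<open>auto simp: image_iff\<close>)
  qed
  then show ?thesis unfolding schwartz_def using f by auto
qed

section \<open>The weights of the Bessel and Riesz potentials\<close>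

text \<open>Bessel potentials correspond to \<open>e = 1\<close> and Riesz potentials to \<open>e = 0\<close>. Rescaling the frequency
  block \<open>|\<xi>| \<sim> 2 ^ j\<close> to unit size turns \<open>e = 1\<close> into \<open>e = 2 ^ -j\<close>, so that estimates which are uniform in
  \<open>e \<in> [0, 1]\<close> cover both cases.\<close>

definition weight :: "real \<Rightarrow> real \<Rightarrow> 'a::euclidean_space \<Rightarrow> complex" where
  "weight e s \<xi> = of_real ((e\<^sup>2 + (norm \<xi>)\<^sup>2) powr (s / 2))"

lemma weight_add: "weight e (s + t) \<xi> = weight e s \<xi> * weight e t \<xi>"
  by (simp add: weight_def add_divide_distrib powr_add)

lemma weight_1_0 [simp]: "weight 1 0 \<xi> = 1"
  using add_pos_nonneg[OF zero_less_one zero_le_power2[of "norm \<xi>"]] by (simp add: weight_def)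

lemma weight_0: "weight 0 s \<xi> = of_real (norm \<xi> powr s)"
proof (cases "\<xi> = 0")
  case False
  then have "(norm \<xi>)\<^sup>2 powr (s / 2) = (norm \<xi> powr 2) powr (s / 2)" by (simp add: powr_numeral)
  then show ?thesis by (simp only: weight_def powr_powr) simp
qed (simp add: weight_def)

text \<open>The expression e^2 + |\<xi>|^2 is homogeneous of degree 2 in the pair (e, \<xi>). With c
  = 2^(-j) the scalar factor becomes 2^(j t), the gain or loss on the block
  \<open>j\<close>.\<close>

lemma weight_dilate:
  assumes "0 < c"
  shows "weight e t \<xi> = of_real (c powr (- t)) * weight (c * e) t (c *\<^sub>R \<xi>)"
proof -
  have "(c * e)\<^sup>2 + (norm (c *\<^sub>R \<xi>))\<^sup>2 = c\<^sup>2 * (e\<^sup>2 + (norm \<xi>)\<^sup>2)"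
    using assms by (simp add: power_mult_distrib algebra_simps)
  then have "((c * e)\<^sup>2 + (norm (c *\<^sub>R \<xi>))\<^sup>2) powr (t / 2) = (c powr 2) powr (t / 2) * (e\<^sup>2 + (norm \<xi>)\<^sup>2) powr (t / 2)"
    using assms by (simp add: powr_mult powr_numeral)
  also have "\<dots> = c powr t * (e\<^sup>2 + (norm \<xi>)\<^sup>2) powr (t / 2)" by (simp add: powr_powr)
  finally have "(e\<^sup>2 + (norm \<xi>)\<^sup>2) powr (t / 2) = c powr (- t) * ((c * e)\<^sup>2 + (norm (c *\<^sub>R \<xi>))\<^sup>2) powr (t / 2)"
    using assms by (simp add: powr_minus)
  then show ?thesis unfolding weight_def by (simp only: of_real_mult)
qed

text \<open>The derivative is a coordinate times a weight of order \<open>s - 2\<close>. Symbols of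
  the form weight times function therefore stay in that form under differentiation, provided all
  orders are treated together.\<close>

lemma weight_derivative:
  assumes "0 < e\<^sup>2 + (norm \<xi>)\<^sup>2"
  shows "(weight e s has_derivative (\<lambda>h. of_real s * of_real (\<xi> \<bullet> h) * weight e (s - 2) \<xi>)) (at \<xi>)"
proof -
  have "((\<lambda>\<xi>. e\<^sup>2 + \<xi> \<bullet> \<xi>) has_derivative (\<lambda>h. 2 * (\<xi> \<bullet> h))) (at \<xi>)"
    by (auto intro!: derivative_eq_intros simp: inner_commute)
  moreover have "((\<lambda>x. x powr (s / 2)) has_derivative (\<lambda>x. (s / 2 * (e\<^sup>2 + \<xi> \<bullet> \<xi>) powr (s / 2 - 1)) * x)) (at (e\<^sup>2 + \<xi> \<bullet> \<xi>))"
    using has_real_derivative_powr[of "e\<^sup>2 + \<xi> \<bullet> \<xi>" "s / 2"] assms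
    unfolding power2_norm_eq_inner has_field_derivative_def by (simp only:)
  ultimately have "((\<lambda>\<xi>. (e\<^sup>2 + \<xi> \<bullet> \<xi>) powr (s / 2)) has_derivative
      (\<lambda>h. (s / 2 * (e\<^sup>2 + \<xi> \<bullet> \<xi>) powr (s / 2 - 1)) * (2 * (\<xi> \<bullet> h)))) (at \<xi>)"
    by (rule has_derivative_compose)
  then have "((\<lambda>\<xi>. complex_of_real ((e\<^sup>2 + \<xi> \<bullet> \<xi>) powr (s / 2))) has_derivative
      (\<lambda>h. of_real ((s / 2 * (e\<^sup>2 + \<xi> \<bullet> \<xi>) powr (s / 2 - 1)) * (2 * (\<xi> \<bullet> h))))) (at \<xi>)"
    by (rule has_derivative_of_real)
  moreover have "s / 2 - 1 = (s - 2) / 2" by (simp add: field_simps)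
  ultimately show ?thesis
    unfolding weight_def[abs_def] power2_norm_eq_inner by (simp add: mult_ac)
qed

text \<open>The argument of the power lies between r^2 and 1 + R^2. The sum of the two endpoint
  values covers increasing and decreasing powers in one formula.\<close>

lemma weight_bound:
  assumes "0 < r" "r\<^sup>2 \<le> e\<^sup>2 + (norm \<xi>)\<^sup>2" "norm \<xi> \<le> R" "0 \<le> e" "e \<le> 1"
  shows "norm (weight e s \<xi>) \<le> (r\<^sup>2) powr (s / 2) + (1 + R\<^sup>2) powr (s / 2)"
proof -
  let ?X = "e\<^sup>2 + (norm \<xi>)\<^sup>2"
  have "e\<^sup>2 \<le> 1" using assms by (simp add: power_le_one)
  moreover have "(norm \<xi>)\<^sup>2 \<le> R\<^sup>2" using assms by (intro power_mono) auto
  ultimately have X: "?X \<le> 1 + R\<^sup>2" by simp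
  have r: "0 < r\<^sup>2" using assms by simp
  have "?X powr (s / 2) \<le> (r\<^sup>2) powr (s / 2) + (1 + R\<^sup>2) powr (s / 2)"
  proof (cases "0 \<le> s")
    case True
    then have "?X powr (s / 2) \<le> (1 + R\<^sup>2) powr (s / 2)"
      using X r assms by (intro powr_mono2) auto
    then show ?thesis by (simp add: add_increasing)
  next
    case False
    then have "?X powr (s / 2) \<le> (r\<^sup>2) powr (s / 2)"
      using r assms by (intro powr_mono2') auto
    then show ?thesis by (simp add: add_increasing2)
  qed
  then show ?thesis by (simp add: weight_def)
qed

context scale
begin

text \<open>The predicate \<open>P\<close> is an invariant: stable under derivatives and coordinate
  factors, and strong enough for decay against weights of every order. It is instantiated by
  functions supported away from the singularity and, for \<open>e = 0\<close>, by flat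
  families.\<close>

lemma schwartz_fam_weightI:
  fixes T :: "'i \<Rightarrow> 'a::euclidean_space \<Rightarrow> complex"
  assumes T: "P T"
    and rap: "\<And>s T. P T \<Longrightarrow> rapid (\<lambda>i \<xi>. weight (e i) s \<xi> * T i \<xi>)"
    and diff: "\<And>T i \<xi>. P T \<Longrightarrow> i \<in> I \<Longrightarrow> T i differentiable (at \<xi>)"
    and pd: "\<And>T b. P T \<Longrightarrow> b \<in> Basis \<Longrightarrow> P (\<lambda>i. partial_deriv b (T i))"
    and coord: "\<And>T b s. P T \<Longrightarrow> P (\<lambda>i \<xi>. of_real s * (of_real (\<xi> \<bullet> b) * T i \<xi>))"
  shows "schwartz_fam (\<lambda>i \<xi>. weight (e i) s \<xi> * T i \<xi>)"
  unfolding schwartz_fam_def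
proof
  fix k
  show "fam k (\<lambda>i \<xi>. weight (e i) s \<xi> * T i \<xi>)"
    using T
  proof (induction k arbitrary: s T)
    case 0
    show ?case unfolding fam.simps by (rule rap[OF 0])
  next
    case (Suc k)
    let ?f = "\<lambda>i \<xi>. weight (e i) s \<xi> * T i \<xi>"
    let ?d = "\<lambda>b i \<xi>. weight (e i) (s - 2) \<xi> * (of_real s * (of_real (\<xi> \<bullet> b) * T i \<xi>)) +
      weight (e i) s \<xi> * partial_deriv b (T i) \<xi>"
    have deriv: "?f i differentiable (at \<xi>) \<and> ?d b i \<xi> = partial_deriv b (?f i) \<xi>" if i: "i \<in> I" for i \<xi> b
    proof (cases "0 < (e i)\<^sup>2 + (norm \<xi>)\<^sup>2")
      case True
      note wd = weight_derivative[OF True, of s]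
      have "weight (e i) s differentiable (at \<xi>)" using wd differentiableI by blast
      then show ?thesis
        using diff[OF Suc.prems i, of \<xi>]
        by (simp add: partial_deriv_mult partial_deriv_eqI[OF wd])
    next
      case False
      then have 0: "e i = 0" "\<xi> = 0" by (simp_all add: not_less sum_power2_le_zero_iff)
      \<comment> \<open>Decay is available for every order of the weight. Using it at order
        \<open>s - 2\<close> leaves a spare |h|^2, which forces derivative zero at the singular
        point.\<close>
      obtain C M where C: "C \<ge> 0" "\<And>i \<xi>. i \<in> I \<Longrightarrow> (1 + norm \<xi>) ^ 0 * norm (weight (e i) (s - 2) \<xi> * T i \<xi>) \<le> C * \<rho> M i"
        using rapidD[OF rap[OF Suc.prems], of 0 "s - 2"] unfolding bd_def by blast
      let ?B = "C * \<rho> M i"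
      have fle: "norm (?f i h) \<le> ?B * (norm h)\<^sup>2" for h
      proof (cases "h = 0")
        case False
        have "weight 0 s h = weight 0 (s - 2) h * weight 0 2 h" using weight_add[of 0 "s - 2" 2 h] by simp
        also have "weight 0 2 h = of_real ((norm h)\<^sup>2)" using False by (simp add: weight_0 powr_numeral)
        finally have "norm (?f i h) = norm (weight (e i) (s - 2) h * T i h) * (norm h)\<^sup>2"
          by (simp add: 0 norm_mult norm_power)
        also have "\<dots> \<le> ?B * (norm h)\<^sup>2" using C(2)[OF i, of h] by (intro mult_right_mono) auto
        finally show ?thesis .
      qed (simp add: weight_0 0)
      have "(?f i has_derivative (\<lambda>_. 0)) (at 0)"
        unfolding has_derivative_at
      proof
        show "(\<lambda>h. norm (?f i (0 + h) - ?f i 0 - 0) / norm h) \<midarrow>0\<rightarrow> 0"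
        proof (rule tendsto_sandwich[OF _ _ tendsto_const])
          show "((\<lambda>h. ?B * norm h) \<longlongrightarrow> 0) (at (0::'a))" by (auto intro!: tendsto_eq_intros)
          show "\<forall>\<^sub>F h in at 0. norm (?f i (0 + h) - ?f i 0 - 0) / norm h \<le> ?B * norm h"
            unfolding eventually_at_filter
          proof (intro always_eventually allI impI)
            fix h :: 'a assume "h \<noteq> 0"
            then show "norm (?f i (0 + h) - ?f i 0 - 0) / norm h \<le> ?B * norm h"
              using fle[of h] by (simp add: weight_0 0 divide_le_eq power2_eq_square mult.assoc)
          qed
        qed (auto intro: always_eventually)
      qed simp
      \<comment> \<open>By the convention \<open>0 powr s = 0\<close>, weights of every order vanish
        at this point, so the formula \<open>?d\<close> also has the value 0 there.\<close>
      from differentiableI[OF this] partial_deriv_eqI[OF this, of b] show ?thesis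
        using 0 by (simp add: weight_0)
    qed
    have "fam k (\<lambda>i. partial_deriv b (?f i))" if b: "b \<in> Basis" for b
      by (rule fam_cong[OF _ fam_add[OF Suc.IH[OF coord[OF Suc.prems]] Suc.IH[OF pd[OF Suc.prems b]]]])
        (use deriv in blast)
    moreover have "\<forall>i\<in>I. \<forall>\<xi>. ?f i differentiable (at \<xi>)"
      using deriv by blast
    ultimately show ?case using rap[OF Suc.prems] unfolding fam.simps by blast
  qed
qed

end

lemma schwartz_fam_weight:
  fixes q :: "'a::euclidean_space \<Rightarrow> complex"
  assumes E: "E \<subseteq> {0..1}" and r: "0 < r"
    and q: "q \<in> schwartz" and R: "\<And>\<xi>. q \<xi> \<noteq> 0 \<Longrightarrow> norm \<xi> \<le> R"
    and supp: "\<And>e \<xi>. e \<in> E \<Longrightarrow> q \<xi> \<noteq> 0 \<Longrightarrow> r\<^sup>2 \<le> e\<^sup>2 + (norm \<xi>)\<^sup>2"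
  shows "scale.schwartz_fam E (\<lambda>_ _. 1) (\<lambda>e \<xi>. weight e s \<xi> * q \<xi>)"
proof -
  interpret scale E "\<lambda>_ _. 1" by (rule scale_1)
  \<comment> \<open>The set is closed, so derivatives of a function supported in \<open>K\<close>
    stay supported in it. On \<open>K\<close> the weights are bounded uniformly over all
    \<open>e\<close> in \<open>E\<close>.\<close>
  define K where "K = {\<xi>::'a. norm \<xi> \<le> R \<and> (\<forall>e\<in>E. r\<^sup>2 \<le> e\<^sup>2 + (norm \<xi>)\<^sup>2)}"
  have "closed K"
  proof -
    have "K = cball 0 R \<inter> (\<Inter>e\<in>E. {\<xi>. r\<^sup>2 \<le> e\<^sup>2 + (norm \<xi>)\<^sup>2})" by (auto simp: K_def)
    then show ?thesis by (auto intro!: closed_Int closed_INT closed_Collect_le continuous_intros)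
  qed
  define P where "P T \<longleftrightarrow> (\<exists>q\<in>schwartz. T = (\<lambda>_. q) \<and> (\<forall>\<xi>. q \<xi> \<noteq> 0 \<longrightarrow> \<xi> \<in> K))" for T :: "real \<Rightarrow> 'a \<Rightarrow> complex"
  show ?thesis
  proof (rule schwartz_fam_weightI[where P = P and e = "\<lambda>e. e"])
    show "P (\<lambda>_. q)" using q R supp by (auto simp: P_def K_def)
    fix T and b :: 'a and s assume "P T"
    then obtain q where q: "q \<in> schwartz" "T = (\<lambda>_. q)" "\<And>\<xi>. q \<xi> \<noteq> 0 \<Longrightarrow> \<xi> \<in> K" by (auto simp: P_def)
    show "T e differentiable (at \<xi>)" for e \<xi> using schwartz_differentiable[OF q(1)] q(2) by simp
    have "of_real s * (of_real (\<xi> \<bullet> b) * q \<xi>) \<noteq> 0 \<Longrightarrow> \<xi> \<in> K" for \<xi> using q(3)[of \<xi>] by auto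
    then show "P (\<lambda>e \<xi>. of_real s * (of_real (\<xi> \<bullet> b) * T e \<xi>))"
      unfolding P_def q(2) using schwartz_cmult[OF schwartz_coord[OF q(1)]] by blast
    show "P (\<lambda>e. partial_deriv b (T e))" if "b \<in> Basis"
      unfolding P_def q(2) using schwartz_partial_deriv[OF q(1) that] partial_deriv_supp[OF \<open>closed K\<close> q(3)] by blast
    show "rapid (\<lambda>e \<xi>. weight e s \<xi> * T e \<xi>)"
      unfolding rapid_def
    proof
      fix N
      obtain C where C: "C \<ge> 0" "\<And>x. (1 + norm x) ^ N * norm (q x) \<le> C"
        using schwartz_bound[OF q(1)] by blast
      define D where "D = (r\<^sup>2) powr (s / 2) + (1 + R\<^sup>2) powr (s / 2)"
      show "bd (\<lambda>e \<xi>. (1 + norm \<xi>) ^ N * norm (weight e s \<xi> * T e \<xi>))"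
      proof (rule bdI[of "D * C"])
        show D0: "0 \<le> D * C" using C(1) by (simp add: D_def)
        fix e and \<xi> :: 'a assume e: "e \<in> E"
        show "(1 + norm \<xi>) ^ N * norm (weight e s \<xi> * T e \<xi>) \<le> D * C * 1"
        proof (cases "q \<xi> = 0")
          case False
          then have "r\<^sup>2 \<le> e\<^sup>2 + (norm \<xi>)\<^sup>2" "norm \<xi> \<le> R" using q(3)[OF False] e by (auto simp: K_def)
          then have "norm (weight e s \<xi>) \<le> D"
            unfolding D_def by (intro weight_bound r) (use e E in auto)
          then have "norm (weight e s \<xi>) * ((1 + norm \<xi>) ^ N * norm (q \<xi>)) \<le> D * C"
            by (intro mult_mono C) (auto simp: D_def)
          then show ?thesis by (simp add: q(2) norm_mult mult_ac)
        qed (use D0 q(2) in simp)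
      qed
    qed
  qed
qed

text \<open>The symbols form a uniform Schwartz family and so do their transforms; decay of the
  latter bounds the kernel integrals by one constant for all parameters.\<close>

lemma weight_kernel_bound:
  fixes q :: "'a::euclidean_space \<Rightarrow> complex"
  assumes "E \<subseteq> {0..1}" "0 < r" "q \<in> schwartz" "\<And>\<xi>. q \<xi> \<noteq> 0 \<Longrightarrow> norm \<xi> \<le> R"
    "\<And>e \<xi>. e \<in> E \<Longrightarrow> q \<xi> \<noteq> 0 \<Longrightarrow> r\<^sup>2 \<le> e\<^sup>2 + (norm \<xi>)\<^sup>2"
  shows "\<exists>C>0. \<forall>e\<in>E. (\<lambda>\<xi>. weight e s \<xi> * q \<xi>) \<in> schwartz \<and>
    (LINT x|lborel. norm (fourier (\<lambda>\<xi>. weight e s \<xi> * q \<xi>) x)) \<le> C"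
proof -
  interpret scale E "\<lambda>_ _. 1" by (rule scale_1)
  have fam: "schwartz_fam (\<lambda>e \<xi>. weight e s \<xi> * q \<xi>)"
    by (rule schwartz_fam_weight) (use assms in auto)
  then have "schwartz_fam (\<lambda>e. fourier (\<lambda>\<xi>. weight e s \<xi> * q \<xi>))"
    unfolding fourier_eq_ft by (intro schwartz_fam_ft) auto
  then have "bd (\<lambda>e (\<xi>::'a). LINT x|lborel. norm (fourier (\<lambda>\<xi>. weight e s \<xi> * q \<xi>) x))"
    by (intro bd_ft_rapid schwartz_fam_rapid schwartz_measurable schwartz_fam_schwartz[of "\<lambda>e. fourier (\<lambda>\<xi>. weight e s \<xi> * q \<xi>)"])
  then obtain C where "C \<ge> 0" "\<forall>e\<in>E. (LINT x|lborel. norm (fourier (\<lambda>\<xi>. weight e s \<xi> * q \<xi>) x)) \<le> C"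
    unfolding bd_def by auto
  then show ?thesis
    \<comment> \<open>The family argument gives a nonnegative constant; adding 1 makes it strictly
      positive.\<close>
    using schwartz_fam_schwartz[OF fam] by (intro exI[of _ "C + 1"]) (auto intro: add_increasing2)
qed

section \<open>Littlewood--Paley blocks of potentials\<close>

text \<open>The factor \<open>k\<close> acts as the inner operator and the dilated \<open>q\<close>
  as the outer one. Dilation preserves the integral norm of the kernel, so the constant does not
  depend on \<open>c\<close>.\<close>

lemma Linf_norm_multiplier_cmult:
  fixes q :: "'a::euclidean_space \<Rightarrow> complex"
  assumes q: "q \<in> schwartz" and C: "(LINT x|lborel. norm (fourier q x)) \<le> C" "0 < C"
    and c: "0 < c" and a: "0 < a"
  shows "Linf_norm (fourier_multiplier (\<lambda>\<xi>. k \<xi> * (of_real a * q (c *\<^sub>R \<xi>))) u) \<le>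
    ennreal (C * a) * Linf_norm (fourier_multiplier k u)"
proof -
  let ?m = "\<lambda>\<xi>. of_real a * q (c *\<^sub>R \<xi>)"
  have m: "?m \<in> schwartz" using schwartz_cmult[OF schwartz_dilate[OF q c]] .
  have "fourier ?m x = of_real a * fourier (\<lambda>\<xi>. q (c *\<^sub>R \<xi>)) x" for x
    unfolding fourier_eq_ft by (rule ft_cmult)
  then have "(LINT x|lborel. norm (fourier ?m x)) = a * (LINT x|lborel. norm (fourier q x))"
    using a by (simp add: norm_mult fourier_dilate_L1[OF q c])
  also have "\<dots> \<le> C * a" using mult_left_mono[OF C(1), of a] a by (simp add: mult.commute)
  finally have L1: "(LINT x|lborel. norm (fourier ?m x)) \<le> C * a" .
  have "Linf_norm (fourier_multiplier (\<lambda>\<xi>. k \<xi> * ?m \<xi>) u) = Linf_norm (fourier_multiplier ?m (fourier_multiplier k u))"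
    by (rule Linf_norm_cong, rule fourier_multiplier_compose[symmetric])
      (rule schwartz_mult[OF m schwartz_inv_fourier])
  also have "\<dots> \<le> ennreal (C * a) * Linf_norm (fourier_multiplier k u)"
    by (rule Linf_norm_multiplier[OF m L1]) (use C a in simp)
  finally show ?thesis .
qed

lemma lp_annulus_sum:
  assumes \<phi>: "lp_annulus \<phi>" and \<xi>: "\<xi> \<noteq> 0" and J: "finite J"
    and out: "\<And>j. j \<notin> J \<Longrightarrow> \<phi> ((2 powi (- j)) *\<^sub>R \<xi>) = 0"
  shows "(\<Sum>j\<in>J. \<phi> ((2 powi (- j)) *\<^sub>R \<xi>)) = 1"
proof -
  have "((\<lambda>j. \<phi> ((2 powi (- j)) *\<^sub>R \<xi>)) has_sum 1) UNIV"
    using \<phi> \<xi> unfolding lp_annulus_def by blast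
  then have "((\<lambda>j. \<phi> ((2 powi (- j)) *\<^sub>R \<xi>)) has_sum 1) J"
    using has_sum_cong_neutral[of UNIV J "\<lambda>j. \<phi> ((2 powi (- j)) *\<^sub>R \<xi>)" "\<lambda>j. \<phi> ((2 powi (- j)) *\<^sub>R \<xi>)" 1] out
    by (simp del: power_int_minus)
  then show ?thesis
    by (rule has_sum_unique[OF has_sum_finite[OF J]])
qed

lemma powi_2_mono: "i \<le> j \<Longrightarrow> (2::real) powi i \<le> 2 powi j"
  by (rule power_int_increasing) auto

lemma lp_annulus_schwartz: "lp_annulus \<phi> \<Longrightarrow> \<phi> \<in> schwartz"
  by (rule smooth_compact_support_schwartz[of _ 2]) (simp_all add: lp_annulus_def)

lemma lp_ball_schwartz: "lp_ball \<eta> \<Longrightarrow> \<eta> \<in> schwartz"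
  by (rule smooth_compact_support_schwartz[of _ 2]) (simp_all add: lp_ball_def)

lemma schwartz_sum:
  assumes "finite A" "\<And>a. a \<in> A \<Longrightarrow> f a \<in> schwartz" shows "(\<lambda>x. \<Sum>a\<in>A. f a x) \<in> schwartz"
  using assms unfolding schwartz_iff_fam by (rule scale.schwartz_fam_sum[OF scale_1])

lemma lp_annulus_dilate_schwartz: "lp_annulus \<phi> \<Longrightarrow> (\<lambda>\<xi>. \<phi> ((2 powi j) *\<^sub>R \<xi>)) \<in> schwartz"
  by (rule schwartz_dilate[OF lp_annulus_schwartz]) simp_all

lemma lp_annulus_dilate_supp:
  assumes \<phi>: "lp_annulus \<phi>" and nz: "\<phi> ((2 powi (- j)) *\<^sub>R \<xi>) \<noteq> 0"
  shows "1 / 2 \<le> 2 powi (- j) * norm \<xi>" "2 powi (- j) * norm \<xi> \<le> 2"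
    and "m \<le> - j \<Longrightarrow> 2 powi m * norm \<xi> \<le> 2" "- j \<le> m \<Longrightarrow> 1 / 2 \<le> 2 powi m * norm \<xi>"
proof -
  have "1 / 2 \<le> norm ((2 powi (- j)) *\<^sub>R \<xi>) \<and> norm ((2 powi (- j)) *\<^sub>R \<xi>) \<le> 2"
    using \<phi> nz unfolding lp_annulus_def by blast
  then show *: "1 / 2 \<le> 2 powi (- j) * norm \<xi>" "2 powi (- j) * norm \<xi> \<le> 2" by simp_all
  show "2 powi m * norm \<xi> \<le> 2" if "m \<le> - j"
    using mult_right_mono[OF powi_2_mono[OF that], of "norm \<xi>"] *(2) by simp
  show "1 / 2 \<le> 2 powi m * norm \<xi>" if "- j \<le> m"
    using mult_right_mono[OF powi_2_mono[OF that], of "norm \<xi>"] *(1) by simp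
qed

text \<open>If both \<xi> and 2^(-j) \<xi> have norm between 1/2 and 2, then |j| \<le> 2. Hence the
  five neighbouring pieces sum to 1 wherever \<open>\<phi>\<close> is nonzero, while their supports
  stay inside 1/8 \<le> |\<xi>| \<le> 8.\<close>

definition fat_annulus :: "('a::euclidean_space \<Rightarrow> complex) \<Rightarrow> 'a \<Rightarrow> complex" where
  "fat_annulus \<phi> \<xi> = (\<Sum>j\<in>{-2..2::int}. \<phi> ((2 powi (- j)) *\<^sub>R \<xi>))"

lemma fat_annulus_props:
  assumes \<phi>: "lp_annulus \<phi>"
  shows "fat_annulus \<phi> \<in> schwartz"
    and "fat_annulus \<phi> \<xi> \<noteq> 0 \<Longrightarrow> 1 / 8 \<le> norm \<xi> \<and> norm \<xi> \<le> 8"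
    and "\<phi> \<xi> \<noteq> 0 \<Longrightarrow> fat_annulus \<phi> \<xi> = 1"
proof -
  have supp: "1 / 2 \<le> norm \<xi> \<and> norm \<xi> \<le> 2" if "\<phi> \<xi> \<noteq> 0" for \<xi>
    using \<phi> that unfolding lp_annulus_def by blast
  show "fat_annulus \<phi> \<in> schwartz"
    unfolding fat_annulus_def[abs_def] by (rule schwartz_sum) (simp_all only: lp_annulus_dilate_schwartz \<phi> finite_atLeastAtMost_int)
  {
    assume "fat_annulus \<phi> \<xi> \<noteq> 0"
    then have "\<exists>j\<in>{-2..2::int}. \<phi> ((2 powi (- j)) *\<^sub>R \<xi>) \<noteq> 0"
      unfolding fat_annulus_def by (metis (no_types, lifting) sum.neutral)
    then obtain j :: int where j: "j \<in> {-2..2}" "\<phi> ((2 powi (- j)) *\<^sub>R \<xi>) \<noteq> 0" ..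
    show "1 / 8 \<le> norm \<xi> \<and> norm \<xi> \<le> 8"
      using lp_annulus_dilate_supp(3)[OF \<phi> j(2), of "- 2"] lp_annulus_dilate_supp(4)[OF \<phi> j(2), of 2] j(1)
      by (simp add: power_int_minus)
  }
  {
    assume 0: "\<phi> \<xi> \<noteq> 0"
    show "fat_annulus \<phi> \<xi> = 1"
      unfolding fat_annulus_def
    proof (rule lp_annulus_sum[OF \<phi>])
      show "\<xi> \<noteq> 0" using supp[OF 0] by auto
      fix j :: int assume j: "j \<notin> {-2..2}"
      show "\<phi> ((2 powi (- j)) *\<^sub>R \<xi>) = 0"
      proof (rule ccontr)
        assume nz: "\<phi> ((2 powi (- j)) *\<^sub>R \<xi>) \<noteq> 0"
        from j consider "- j \<le> - 3" | "3 \<le> - j" by fastforce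
        then show False
          using lp_annulus_dilate_supp(3)[OF \<phi> nz, of 3] lp_annulus_dilate_supp(4)[OF \<phi> nz, of "- 3"] supp[OF 0]
          by cases (simp_all add: power_int_minus)
      qed
    qed simp
  }
qed

text \<open>The potential sits in the symbol next to the cutoff and \<open>u\<close> is the original
  distribution. For \<open>e = 0\<close> this remains meaningful although |\<xi>|^s is not a
  multiplier on all test functions.\<close>

abbreviation block_norm :: "('a::euclidean_space \<Rightarrow> complex) \<Rightarrow> real \<Rightarrow> real \<Rightarrow> int \<Rightarrow> 'a functional \<Rightarrow> ennreal" where
  "block_norm \<phi> e s j u \<equiv> Linf_norm (fourier_multiplier (\<lambda>\<xi>. weight e s \<xi> * \<phi> ((2 powi (- j)) *\<^sub>R \<xi>)) u)"

text \<open>Multiplying by the fat annulus changes nothing on the block, so the extra order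
  \<open>t\<close> can be cut off and rescaled to unit frequency. The parameter becomes 2^(-j) e,
  which must lie in the unit interval for the uniform kernel bound.\<close>

lemma block_estimate:
  fixes \<phi> :: "'a::euclidean_space \<Rightarrow> complex"
  assumes \<phi>: "lp_annulus \<phi>"
  shows "\<exists>C>0. \<forall>e j u. 0 \<le> e \<longrightarrow> 2 powi (- j) * e \<le> 1 \<longrightarrow>
    block_norm \<phi> e (s + t) j u \<le>
    ennreal (C * 2 powr (of_int j * t)) *
      block_norm \<phi> e s j u"
proof -
  let ?q = "fat_annulus \<phi>"
  have "\<exists>C>0. \<forall>e\<in>{0..1}. (\<lambda>\<xi>. weight e t \<xi> * ?q \<xi>) \<in> schwartz \<and>
    (LINT x|lborel. norm (fourier (\<lambda>\<xi>. weight e t \<xi> * ?q \<xi>) x)) \<le> C"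
  proof (rule weight_kernel_bound[where r = "1/8" and R = 8])
    show "(1 / 8)\<^sup>2 \<le> e\<^sup>2 + (norm \<xi>)\<^sup>2" if "?q \<xi> \<noteq> 0" for e and \<xi> :: 'a
    proof -
      have "(1 / 8)\<^sup>2 \<le> (norm \<xi>)\<^sup>2"
        using fat_annulus_props(2)[OF \<phi> that] by (intro power_mono) auto
      then show ?thesis by (simp add: add_increasing)
    qed
  qed (use fat_annulus_props[OF \<phi>] in auto)
  then obtain C where C: "C > 0" "\<And>e. 0 \<le> e \<Longrightarrow> e \<le> 1 \<Longrightarrow> (\<lambda>\<xi>. weight e t \<xi> * ?q \<xi>) \<in> schwartz"
    "\<And>e. 0 \<le> e \<Longrightarrow> e \<le> 1 \<Longrightarrow> (LINT x|lborel. norm (fourier (\<lambda>\<xi>. weight e t \<xi> * ?q \<xi>) x)) \<le> C"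
    by auto
  show ?thesis
  proof (intro exI[of _ C] conjI C(1) allI impI)
    fix e :: real and j :: int and u :: "'a functional"
    assume e: "0 \<le> e" "2 powi (- j) * e \<le> 1"
    define c where "c = (2::real) powi (- j)"
    have c: "0 < c" by (simp add: c_def)
    have cpow: "c powr (- t) = 2 powr (of_int j * t)"
    proof -
      have "c = 2 powr (- of_int j)" unfolding c_def using powr_real_of_int'[of 2 "- j"] by simp
      then show ?thesis by (simp add: powr_powr)
    qed
    \<comment> \<open>The first two factors form the block of order \<open>s\<close>; the bracket is
      a scalar times a dilate of the symbol whose kernel was bounded by \<open>C\<close>.\<close>
    have split: "weight e (s + t) \<xi> * \<phi> (c *\<^sub>R \<xi>) =
        weight e s \<xi> * \<phi> (c *\<^sub>R \<xi>) * (of_real (c powr (- t)) * (weight (c * e) t (c *\<^sub>R \<xi>) * ?q (c *\<^sub>R \<xi>)))" for \<xi>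
    proof (cases "\<phi> (c *\<^sub>R \<xi>) = 0")
      case False
      have "weight e (s + t) \<xi> * \<phi> (c *\<^sub>R \<xi>) = weight e s \<xi> * \<phi> (c *\<^sub>R \<xi>) * weight e t \<xi>"
        by (simp add: weight_add mult_ac)
      then show ?thesis
        unfolding weight_dilate[OF c, of e t \<xi>] using fat_annulus_props(3)[OF \<phi> False] by simp
    qed simp
    have ce: "0 \<le> c * e" "c * e \<le> 1" using c e by (auto simp: c_def)
    have "Linf_norm (fourier_multiplier (\<lambda>\<xi>. weight e (s + t) \<xi> * \<phi> (c *\<^sub>R \<xi>)) u) \<le>
        ennreal (C * c powr (- t)) * Linf_norm (fourier_multiplier (\<lambda>\<xi>. weight e s \<xi> * \<phi> (c *\<^sub>R \<xi>)) u)"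
      unfolding split
      by (rule Linf_norm_multiplier_cmult[where q = "\<lambda>\<xi>. weight (c * e) t \<xi> * ?q \<xi>", OF C(2,3)[OF ce] C(1) c])
        (use c in simp)
    then show "block_norm \<phi> e (s + t) j u \<le>
        ennreal (C * 2 powr (of_int j * t)) *
        block_norm \<phi> e s j u"
      unfolding cpow by (simp only: c_def)
  qed
qed

lemma tempered_add:
  "u \<in> tempered \<Longrightarrow> f \<in> schwartz \<Longrightarrow> g \<in> schwartz \<Longrightarrow> u (\<lambda>x. f x + g x) = u f + u g"
  unfolding tempered_def by blast

lemma fourier_multiplier_add:
  assumes u: "u \<in> tempered"
    and "(\<lambda>\<xi>. a \<xi> * inv_fourier \<psi> \<xi>) \<in> schwartz" "(\<lambda>\<xi>. b \<xi> * inv_fourier \<psi> \<xi>) \<in> schwartz"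
  shows "fourier_multiplier (\<lambda>\<xi>. a \<xi> + b \<xi>) u \<psi> = fourier_multiplier a u \<psi> + fourier_multiplier b u \<psi>"
proof -
  have "fourier (\<lambda>\<xi>. (a \<xi> + b \<xi>) * inv_fourier \<psi> \<xi>) =
      (\<lambda>x. fourier (\<lambda>\<xi>. a \<xi> * inv_fourier \<psi> \<xi>) x + fourier (\<lambda>\<xi>. b \<xi> * inv_fourier \<psi> \<xi>) x)"
    unfolding fourier_eq_ft distrib_right using assms(2,3)[THEN schwartz_integrable] by (simp add: ft_add fun_eq_iff)
  then show ?thesis
    unfolding fourier_multiplier_apply using tempered_add[OF u] assms(2,3)[THEN schwartz_fourier] by simp
qed

text \<open>Write \<eta> = \<eta>^2 + \<theta>. In \<eta>^2 one factor belongs to the low-frequency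
  operator and the other cuts off the weight of order \<open>t\<close>. The rest \<theta> vanishes
  on the unit ball and outside the ball of radius 2; between them the pieces of index 0, 1, 2 sum to
  1, so it can be distributed over three blocks.\<close>

lemma low_estimate:
  fixes \<phi> \<eta> :: "'a::euclidean_space \<Rightarrow> complex"
  assumes \<phi>: "lp_annulus \<phi>" and \<eta>: "lp_ball \<eta>"
  shows "\<exists>C>0. \<forall>u\<in>tempered.
    Linf_norm (fourier_multiplier (\<lambda>\<xi>. weight 1 (s + t) \<xi> * \<eta> \<xi>) u) \<le>
    ennreal C * (Linf_norm (fourier_multiplier (\<lambda>\<xi>. weight 1 s \<xi> * \<eta> \<xi>) u) +
      (\<Sum>j\<in>{0..2::int}. block_norm \<phi> 1 s j u))"
proof -
  have \<eta>s: "\<eta> \<in> schwartz" using lp_ball_schwartz[OF \<eta>] .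
  have \<eta>supp: "norm \<xi> \<le> 2" if "\<eta> \<xi> \<noteq> 0" for \<xi> using \<eta> that unfolding lp_ball_def by blast
  define \<theta> where "\<theta> \<xi> = \<eta> \<xi> + (- 1) * (\<eta> \<xi> * \<eta> \<xi>)" for \<xi>
  have \<theta>s: "\<theta> \<in> schwartz"
    unfolding \<theta>_def[abs_def] by (rule schwartz_add[OF \<eta>s schwartz_cmult[OF schwartz_mult[OF \<eta>s \<eta>s]]])
  have W: "\<exists>C>0. (\<lambda>\<xi>. weight 1 r \<xi> * q \<xi>) \<in> schwartz \<and>
      (LINT x|lborel. norm (fourier (\<lambda>\<xi>. weight 1 r \<xi> * q \<xi>) x)) \<le> C"
    \<comment> \<open>For \<open>e = 1\<close> the weight is nonsingular, since its argument is at
      least 1; thus \<open>r = 1\<close> works for every cutoff supported in the ball of radius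
      2.\<close>
    if "q \<in> schwartz" "\<And>\<xi>. \<eta> \<xi> = 0 \<Longrightarrow> q \<xi> = 0" for r and q :: "'a \<Rightarrow> complex"
    using weight_kernel_bound[of "{1}" 1 q 2 r] that \<eta>supp by auto
  have \<theta>0: "\<theta> \<xi> = 0" if "\<eta> \<xi> = 0" for \<xi> using that by (simp add: \<theta>_def)
  obtain C1 where C1: "C1 > 0" "(\<lambda>\<xi>. weight 1 t \<xi> * \<eta> \<xi>) \<in> schwartz"
    "(LINT x|lborel. norm (fourier (\<lambda>\<xi>. weight 1 t \<xi> * \<eta> \<xi>) x)) \<le> C1"
    using W[OF \<eta>s, of t] by blast
  obtain C2 where C2: "C2 > 0" "(\<lambda>\<xi>. weight 1 t \<xi> * \<theta> \<xi>) \<in> schwartz"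
    "(LINT x|lborel. norm (fourier (\<lambda>\<xi>. weight 1 t \<xi> * \<theta> \<xi>) x)) \<le> C2"
    using W[OF \<theta>s \<theta>0, of t] by blast
  have ws: "(\<lambda>\<xi>. weight 1 s \<xi> * \<eta> \<xi>) \<in> schwartz" using W[OF \<eta>s, of s] by blast
  have wst: "(\<lambda>\<xi>. weight 1 (s + t) \<xi> * \<theta> \<xi>) \<in> schwartz" using W[OF \<theta>s \<theta>0, of "s + t"] by blast
  \<comment> \<open>The scalar 1 and the dilation by 1 give the symbols the shape required by
    \<open>Linf_norm_multiplier_cmult\<close>.\<close>
  define a where "a \<xi> = weight 1 s \<xi> * \<eta> \<xi> * (of_real 1 * (weight 1 t (1 *\<^sub>R \<xi>) * \<eta> (1 *\<^sub>R \<xi>)))" for \<xi>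
  define b where "b j \<xi> = weight 1 s \<xi> * \<phi> ((2 powi (- j)) *\<^sub>R \<xi>) * (of_real 1 * (weight 1 t (1 *\<^sub>R \<xi>) * \<theta> (1 *\<^sub>R \<xi>)))" for j :: int and \<xi>
  have sum1: "(\<Sum>j\<in>{0..2::int}. \<phi> ((2 powi (- j)) *\<^sub>R \<xi>)) = 1" if "1 < norm \<xi>" "norm \<xi> \<le> 2" for \<xi>
  proof (rule lp_annulus_sum[OF \<phi>])
    show "\<xi> \<noteq> 0" using that by auto
    fix j :: int assume j: "j \<notin> {0..2}"
    show "\<phi> ((2 powi (- j)) *\<^sub>R \<xi>) = 0"
    proof (rule ccontr)
      assume nz: "\<phi> ((2 powi (- j)) *\<^sub>R \<xi>) \<noteq> 0"
      from j consider "- j \<le> - 3" | "1 \<le> - j" by fastforce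
      then show False
        using lp_annulus_dilate_supp(3)[OF \<phi> nz, of 1] lp_annulus_dilate_supp(4)[OF \<phi> nz, of "- 3"] that
        by cases (simp_all add: power_int_minus)
    qed
  qed simp
  have split: "weight 1 (s + t) \<xi> * \<eta> \<xi> = a \<xi> + (b 0 \<xi> + (b 1 \<xi> + b 2 \<xi>))" for \<xi>
  proof -
    have "\<eta> \<xi> = \<eta> \<xi> * \<eta> \<xi> + (\<Sum>j\<in>{0..2::int}. \<phi> ((2 powi (- j)) *\<^sub>R \<xi>)) * \<theta> \<xi>"
    proof (cases "norm \<xi> \<le> 1")
      case True
      then have "\<eta> \<xi> = 1" using \<eta> unfolding lp_ball_def by blast
      then show ?thesis by (simp add: \<theta>_def)
    next
      case False
      show ?thesis
      proof (cases "\<eta> \<xi> = 0")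
        case nz: False
        then show ?thesis using sum1[of \<xi>] \<eta>supp False by (simp add: \<theta>_def)
      qed (simp add: \<theta>0)
    qed
    also have "{0..2::int} = {0, 1, 2}" by auto
    finally have eq: "\<eta> \<xi> = \<eta> \<xi> * \<eta> \<xi> + (\<phi> ((2 powi (- 0)) *\<^sub>R \<xi>) + (\<phi> ((2 powi (- 1)) *\<^sub>R \<xi>) + \<phi> ((2 powi (- 2)) *\<^sub>R \<xi>))) * \<theta> \<xi>"
      by simp
    show ?thesis unfolding a_def b_def weight_add
      by (subst eq) (simp add: algebra_simps)
  qed
  show ?thesis
  proof (intro exI[of _ "C1 + C2"] conjI ballI)
    show "0 < C1 + C2" using C1 C2 by simp
    fix u :: "'a functional" assume u: "u \<in> tempered"
    let ?L = "\<lambda>m. Linf_norm (fourier_multiplier m u)"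
    let ?\<phi> = "\<lambda>j::int. \<lambda>\<xi>. weight 1 s \<xi> * \<phi> ((2 powi (- j)) *\<^sub>R \<xi>)"
    have sa: "(\<lambda>\<xi>. a \<xi> * inv_fourier \<psi> \<xi>) \<in> schwartz" if "\<psi> \<in> schwartz" for \<psi>
      unfolding a_def using schwartz_mult[OF schwartz_mult[OF ws C1(2)] schwartz_inv_fourier[OF that]] by simp
    have sb: "(\<lambda>\<xi>. b j \<xi> * inv_fourier \<psi> \<xi>) \<in> schwartz" if "\<psi> \<in> schwartz" for \<psi> j
    proof -
      have "(\<lambda>\<xi>. weight 1 (s + t) \<xi> * \<theta> \<xi> * \<phi> ((2 powi (- j)) *\<^sub>R \<xi>) * inv_fourier \<psi> \<xi>) \<in> schwartz"
        by (rule schwartz_mult[OF schwartz_mult[OF wst lp_annulus_dilate_schwartz[OF \<phi>]] schwartz_inv_fourier[OF that]])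
      then show ?thesis unfolding b_def weight_add by (simp add: mult_ac)
    qed
    have sb2: "(\<lambda>\<xi>. (b 1 \<xi> + b 2 \<xi>) * inv_fourier \<psi> \<xi>) \<in> schwartz"
      "(\<lambda>\<xi>. (b 0 \<xi> + (b 1 \<xi> + b 2 \<xi>)) * inv_fourier \<psi> \<xi>) \<in> schwartz" if "\<psi> \<in> schwartz" for \<psi>
      unfolding distrib_right by (rule schwartz_add[OF sb[OF that] sb[OF that]],
        rule schwartz_add[OF sb[OF that] schwartz_add[OF sb[OF that] sb[OF that]]])
    have "?L (\<lambda>\<xi>. weight 1 (s + t) \<xi> * \<eta> \<xi>) = Linf_norm (\<lambda>\<psi>. fourier_multiplier a u \<psi> +
        (fourier_multiplier (b 0) u \<psi> + (fourier_multiplier (b 1) u \<psi> + fourier_multiplier (b 2) u \<psi>)))"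
      unfolding split
      by (rule Linf_norm_cong) (simp add: fourier_multiplier_add[OF u] sa sb sb2)
    also have "\<dots> \<le> ?L a + (?L (b 0) + (?L (b 1) + ?L (b 2)))"
      by (intro order_trans[OF Linf_norm_add] add_left_mono) (intro order_refl order_trans[OF Linf_norm_add] add_left_mono)+
    also have "\<dots> \<le> ennreal C1 * ?L (\<lambda>\<xi>. weight 1 s \<xi> * \<eta> \<xi>) +
        (ennreal C2 * ?L (?\<phi> 0) + (ennreal C2 * ?L (?\<phi> 1) + ennreal C2 * ?L (?\<phi> 2)))"
    proof -
      have "?L a \<le> ennreal (C1 * 1) * ?L (\<lambda>\<xi>. weight 1 s \<xi> * \<eta> \<xi>)"
        unfolding a_def by (rule Linf_norm_multiplier_cmult[OF C1(2,3,1)]) auto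
      moreover have "?L (b j) \<le> ennreal (C2 * 1) * ?L (?\<phi> j)" for j
        unfolding b_def by (rule Linf_norm_multiplier_cmult[OF C2(2,3,1)]) auto
      ultimately show ?thesis unfolding mult_1_right by (intro add_mono)
    qed
    also have "\<dots> \<le> ennreal (C1 + C2) * (?L (\<lambda>\<xi>. weight 1 s \<xi> * \<eta> \<xi>) + (?L (?\<phi> 0) + (?L (?\<phi> 1) + ?L (?\<phi> 2))))"
      unfolding distrib_left using C1(1) C2(1) by (intro add_mono mult_right_mono ennreal_leI) auto
    also have "?L (?\<phi> 0) + (?L (?\<phi> 1) + ?L (?\<phi> 2)) = (\<Sum>j\<in>{0..2::int}. ?L (?\<phi> j))"
    proof -
      have "{0..2::int} = {0, 1, 2}" by auto
      then show ?thesis by (simp del: power_int_minus)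
    qed
    finally show "?L (\<lambda>\<xi>. weight 1 (s + t) \<xi> * \<eta> \<xi>) \<le>
      ennreal (C1 + C2) * (?L (\<lambda>\<xi>. weight 1 s \<xi> * \<eta> \<xi>) + (\<Sum>j\<in>{0..2::int}. ?L (?\<phi> j)))" .
  qed
qed

lemma dyadic_SUP_le:
  fixes a b :: "int \<Rightarrow> ennreal"
  assumes B: "0 < B" and le: "\<And>j. j \<in> J \<Longrightarrow> a j \<le> ennreal (B * 2 powr (of_int j * t)) * b j"
  shows "(SUP j\<in>J. ennreal (2 powr (of_int j * (\<gamma> - t))) * a j) \<le> ennreal B * (SUP j\<in>J. ennreal (2 powr (of_int j * \<gamma>)) * b j)"
proof (rule SUP_least)
  fix j assume j: "j \<in> J"
  have "ennreal (2 powr (of_int j * (\<gamma> - t))) * a j \<le>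
      ennreal (2 powr (of_int j * (\<gamma> - t))) * (ennreal (B * 2 powr (of_int j * t)) * b j)"
    by (intro mult_left_mono le j) simp
  also have "\<dots> = ennreal B * (ennreal (2 powr (of_int j * \<gamma>)) * b j)"
  proof -
    have "2 powr (of_int j * (\<gamma> - t)) * (B * 2 powr (of_int j * t)) = B * 2 powr (of_int j * \<gamma>)"
      by (simp add: powr_add[symmetric] algebra_simps)
    then show ?thesis
      using B by (simp only: mult.assoc[symmetric] ennreal_mult'[symmetric] powr_ge_zero less_imp_le)
  qed
  also have "\<dots> \<le> ennreal B * (SUP j\<in>J. ennreal (2 powr (of_int j * \<gamma>)) * b j)"
    by (intro mult_left_mono SUP_upper j) simp
  finally show "ennreal (2 powr (of_int j * (\<gamma> - t))) * a j \<le> ennreal B * (SUP j\<in>J. ennreal (2 powr (of_int j * \<gamma>)) * b j)" .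
qed

section \<open>The inhomogeneous scale\<close>

text \<open>The inhomogeneous norm of \<open>\<langle>D\<rangle>\<^sup>s u\<close>, with the potential absorbed into the symbols.\<close>

definition inhom_weighted ::
  "('a::euclidean_space \<Rightarrow> complex) \<Rightarrow> ('a \<Rightarrow> complex) \<Rightarrow> real \<Rightarrow> real \<Rightarrow> 'a functional \<Rightarrow> ennreal" where
  "inhom_weighted \<phi> \<eta> \<gamma> s u = Linf_norm (fourier_multiplier (\<lambda>\<xi>. weight 1 s \<xi> * \<eta> \<xi>) u) +
     (SUP j\<in>{0::int..}. ennreal (2 powr (of_int j * \<gamma>)) *
        block_norm \<phi> 1 s j u)"

lemma inhom_lip_norm_bessel:
  assumes "lp_annulus \<phi>" "lp_ball \<eta>"
  shows "inhom_lip_norm \<phi> \<eta> \<gamma> (bessel_op s u) = inhom_weighted \<phi> \<eta> \<gamma> s u"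
proof -
  have b: "bessel_op s u = fourier_multiplier (weight 1 s) u"
    by (simp add: bessel_op_def weight_def[abs_def])
  have "Linf_norm (fourier_multiplier m (bessel_op s u)) = Linf_norm (fourier_multiplier (\<lambda>\<xi>. weight 1 s \<xi> * m \<xi>) u)"
    if "m \<in> schwartz" for m
    unfolding b by (rule Linf_norm_cong, rule fourier_multiplier_compose) (rule schwartz_mult[OF that schwartz_inv_fourier])
  then show ?thesis
    unfolding inhom_lip_norm_def inhom_weighted_def lp_low_def lp_block_def
    using lp_ball_schwartz[OF assms(2)] lp_annulus_dilate_schwartz[OF assms(1)] by (simp only:)
qed

lemma inhom_lip_norm_eq: "inhom_lip_norm \<phi> \<eta> \<gamma> u = inhom_weighted \<phi> \<eta> \<gamma> 0 u"
  by (simp add: inhom_lip_norm_def inhom_weighted_def lp_low_def lp_block_def)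

text \<open>The sign of \<open>t\<close> is free, so one inequality serves both directions: the
  return from order \<open>s + t\<close> to \<open>s\<close> is the case \<open>- t\<close>.\<close>

lemma inhom_weighted_le:
  fixes \<phi> \<eta> :: "'a::euclidean_space \<Rightarrow> complex"
  assumes \<phi>: "lp_annulus \<phi>" and \<eta>: "lp_ball \<eta>"
  shows "\<exists>C>0. \<forall>u\<in>tempered. inhom_weighted \<phi> \<eta> (\<gamma> - t) (s + t) u \<le> ennreal C * inhom_weighted \<phi> \<eta> \<gamma> s u"
proof -
  obtain A where A: "A > 0" "\<forall>u\<in>tempered.
    Linf_norm (fourier_multiplier (\<lambda>\<xi>. weight 1 (s + t) \<xi> * \<eta> \<xi>) u) \<le>
    ennreal A * (Linf_norm (fourier_multiplier (\<lambda>\<xi>. weight 1 s \<xi> * \<eta> \<xi>) u) +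
      (\<Sum>j\<in>{0..2::int}. block_norm \<phi> 1 s j u))"
    using low_estimate[OF assms] by blast
  obtain B where B: "B > 0" "\<And>e j u. 0 \<le> e \<Longrightarrow> 2 powi (- j) * e \<le> 1 \<Longrightarrow>
    block_norm \<phi> e (s + t) j u \<le>
    ennreal (B * 2 powr (of_int j * t)) *
      block_norm \<phi> e s j u"
    using block_estimate[OF \<phi>] by blast
  \<comment> \<open>The low-frequency estimate involves three block norms without dyadic factors.
    Recovering each from the supremum costs 2^(-j \<gamma>), and \<open>D\<close> collects these
    costs.\<close>
  define D where "D = (\<Sum>j\<in>{0..2::int}. 2 powr (- (of_int j * \<gamma>)))"
  have D: "0 \<le> D" by (simp add: D_def sum_nonneg)
  show ?thesis
  proof (intro exI[of _ "A * (1 + D) + B"] conjI ballI)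
    show "0 < A * (1 + D) + B" using A(1) B(1) D by (simp add: add_nonneg_pos)
    fix u :: "'a functional" assume u: "u \<in> tempered"
    let ?L = "\<lambda>m. Linf_norm (fourier_multiplier m u)"
    let ?\<phi> = "\<lambda>s. \<lambda>j::int. \<lambda>\<xi>. weight 1 s \<xi> * \<phi> ((2 powi (- j)) *\<^sub>R \<xi>)"
    let ?S = "SUP j\<in>{0::int..}. ennreal (2 powr (of_int j * \<gamma>)) * ?L (?\<phi> s j)"
    let ?N = "inhom_weighted \<phi> \<eta> \<gamma> s u"
    have N: "?N = ?L (\<lambda>\<xi>. weight 1 s \<xi> * \<eta> \<xi>) + ?S" by (simp add: inhom_weighted_def)
    have SN: "?S \<le> ?N" "?L (\<lambda>\<xi>. weight 1 s \<xi> * \<eta> \<xi>) \<le> ?N" unfolding N by (simp_all add: add_increasing add_increasing2)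
    have S: "?L (?\<phi> s j) \<le> ennreal (2 powr (- (of_int j * \<gamma>))) * ?N" if "0 \<le> j" for j
    proof -
      have "ennreal (2 powr (- (of_int j * \<gamma>))) * (ennreal (2 powr (of_int j * \<gamma>)) * ?L (?\<phi> s j)) \<le>
          ennreal (2 powr (- (of_int j * \<gamma>))) * ?N"
        by (intro mult_left_mono order_trans[OF _ SN(1)] SUP_upper) (use that in auto)
      moreover have "ennreal (2 powr (- (of_int j * \<gamma>))) * (ennreal (2 powr (of_int j * \<gamma>)) * ?L (?\<phi> s j)) = ?L (?\<phi> s j)"
        by (simp add: mult.assoc[symmetric] ennreal_mult[symmetric] powr_add[symmetric])
      ultimately show ?thesis by simp
    qed
    have "?L (\<lambda>\<xi>. weight 1 (s + t) \<xi> * \<eta> \<xi>) \<le> ennreal A * (?N + (\<Sum>j\<in>{0..2::int}. ennreal (2 powr (- (of_int j * \<gamma>))) * ?N))"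
      by (rule order_trans[OF A(2)[rule_format, OF u]]) (intro mult_left_mono add_mono sum_mono SN S, auto)
    also have "(\<Sum>j\<in>{0..2::int}. ennreal (2 powr (- (of_int j * \<gamma>))) * ?N) = ennreal D * ?N"
      unfolding D_def by (simp add: sum_distrib_right[symmetric] sum_ennreal)
    also have "ennreal A * (?N + ennreal D * ?N) = ennreal (A * (1 + D)) * ?N"
      using A(1) D by (simp add: ennreal_mult ennreal_plus distrib_right distrib_left mult.assoc)
    finally have low: "?L (\<lambda>\<xi>. weight 1 (s + t) \<xi> * \<eta> \<xi>) \<le> ennreal (A * (1 + D)) * ?N" .
    have "(SUP j\<in>{0::int..}. ennreal (2 powr (of_int j * (\<gamma> - t))) * block_norm \<phi> 1 (s + t) j u) \<le> ennreal B * ?S"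
    proof (rule dyadic_SUP_le[OF B(1)])
      fix j :: int assume "j \<in> {0..}"
      \<comment> \<open>For nonnegative \<open>j\<close> the rescaled Bessel parameter 2^(-j) stays
        in the unit interval, as \<open>block_estimate\<close> requires.\<close>
      then have "(2::real) powi (- j) \<le> 2 powi 0" by (intro powi_2_mono) simp
      then show "block_norm \<phi> 1 (s + t) j u \<le> ennreal (B * 2 powr (of_int j * t)) * block_norm \<phi> 1 s j u"
        by (intro B(2)) auto
    qed
    also have "\<dots> \<le> ennreal B * ?N" by (intro mult_left_mono SN) auto
    finally have high: "(SUP j\<in>{0::int..}. ennreal (2 powr (of_int j * (\<gamma> - t))) * block_norm \<phi> 1 (s + t) j u) \<le> ennreal B * ?N" .
    have "inhom_weighted \<phi> \<eta> (\<gamma> - t) (s + t) u \<le> ennreal (A * (1 + D)) * ?N + ennreal B * ?N"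
      unfolding inhom_weighted_def[of _ _ "\<gamma> - t"] by (intro add_mono low high)
    also have "\<dots> = ennreal (A * (1 + D) + B) * ?N"
      using A(1) B(1) D by (simp add: ennreal_plus distrib_right)
    finally show "inhom_weighted \<phi> \<eta> (\<gamma> - t) (s + t) u \<le> ennreal (A * (1 + D) + B) * ?N" .
  qed
qed

section \<open>Two-sided comparability\<close>

lemma comparable_onI:
  assumes "\<exists>C>0. \<forall>f\<in>X. B f \<le> ennreal C * A f" "\<exists>C>0. \<forall>f\<in>X. A f \<le> ennreal C * B f"
  shows "comparable_on X A B"
proof -
  obtain C where C: "C > 0" "\<And>f. f \<in> X \<Longrightarrow> B f \<le> ennreal C * A f" using assms(1) by blast
  obtain D where D: "D > 0" "\<And>f. f \<in> X \<Longrightarrow> A f \<le> ennreal D * B f" using assms(2) by blast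
  have "ennreal (inverse D) * A f \<le> B f" if "f \<in> X" for f
  proof -
    have "ennreal (inverse D) * A f \<le> ennreal (inverse D) * (ennreal D * B f)"
      by (intro mult_left_mono D(2) that) simp
    also have "\<dots> = B f" using D(1) by (simp add: mult.assoc[symmetric] ennreal_mult'[symmetric])
    finally show ?thesis .
  qed
  then show ?thesis
    unfolding comparable_on_def using C D(1) by (intro exI[of _ "inverse D"] exI[of _ C]) auto
qed

lemma comparable_on_sym: "comparable_on X A B \<Longrightarrow> comparable_on X B A"
proof -
  assume "comparable_on X A B"
  then obtain c C :: real where c: "0 < c" "0 < C" "\<And>f. f \<in> X \<Longrightarrow> ennreal c * A f \<le> B f" "\<And>f. f \<in> X \<Longrightarrow> B f \<le> ennreal C * A f"
    unfolding comparable_on_def by blast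
  have "A f \<le> ennreal (inverse c) * B f" if "f \<in> X" for f
  proof -
    have "A f = ennreal (inverse c) * (ennreal c * A f)"
      using c(1) by (simp add: mult.assoc[symmetric] ennreal_mult'[symmetric])
    also have "\<dots> \<le> ennreal (inverse c) * B f" by (intro mult_left_mono c(3) that) simp
    finally show ?thesis .
  qed
  then show ?thesis
    using c(1,2,4) positive_imp_inverse_positive[OF c(1)] by (intro comparable_onI) blast+
qed

lemma inhom_comparable:
  assumes "lp_annulus \<phi>" "lp_ball \<eta>"
  shows "comparable_on tempered (\<lambda>f. inhom_lip_norm \<phi> \<eta> \<gamma> f) (\<lambda>f. inhom_lip_norm \<phi> \<eta> (\<gamma> - s) (bessel_op s f))"
  unfolding inhom_lip_norm_bessel[OF assms] unfolding inhom_lip_norm_eq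
  using inhom_weighted_le[OF assms, of \<gamma> s 0] inhom_weighted_le[OF assms, of "\<gamma> - s" "- s" s]
  by (intro comparable_onI) simp_all

section \<open>The Hahn--Banach theorem for spaces of functions\<close>

definition comb :: "('x \<Rightarrow> complex) \<Rightarrow> real \<Rightarrow> ('x \<Rightarrow> complex) \<Rightarrow> 'x \<Rightarrow> complex" where
  "comb f t g = (\<lambda>x. f x + of_real t * g x)"

text \<open>Partial extensions are represented by their graphs, ordered by inclusion, so a chain is
  bounded by its union. Domination by \<open>p\<close> is part of the invariant and later forces a
  maximal graph to be single-valued.\<close>

lemma hahn_banach_real:
  fixes V W :: "('x \<Rightarrow> complex) set" and p u :: "('x \<Rightarrow> complex) \<Rightarrow> real"
  assumes V: "\<And>f g t. f \<in> V \<Longrightarrow> g \<in> V \<Longrightarrow> comb f t g \<in> V"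
    and W: "W \<subseteq> V" "(\<lambda>_. 0) \<in> W" "\<And>f g t. f \<in> W \<Longrightarrow> g \<in> W \<Longrightarrow> comb f t g \<in> W"
    and p: "\<And>f g. f \<in> V \<Longrightarrow> g \<in> V \<Longrightarrow> p (\<lambda>x. f x + g x) \<le> p f + p g"
      "\<And>t f. 0 \<le> t \<Longrightarrow> f \<in> V \<Longrightarrow> p (\<lambda>x. of_real t * f x) = t * p f"
    and u: "\<And>f g t. f \<in> W \<Longrightarrow> g \<in> W \<Longrightarrow> u (comb f t g) = u f + t * u g"
      "\<And>f. f \<in> W \<Longrightarrow> u f \<le> p f"
  shows "\<exists>U. (\<forall>f\<in>V. \<forall>g\<in>V. \<forall>t. U (comb f t g) = U f + t * U g) \<and> (\<forall>f\<in>W. U f = u f) \<and> (\<forall>f\<in>V. U f \<le> p f)"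
proof -
  define good where "good G \<longleftrightarrow> (\<forall>f\<in>W. (f, u f) \<in> G) \<and> (\<forall>(f, a)\<in>G. f \<in> V \<and> a \<le> p f) \<and>
    (\<forall>(f, a)\<in>G. \<forall>(g, b)\<in>G. \<forall>t. (comb f t g, a + t * b) \<in> G)" for G :: "(('x \<Rightarrow> complex) \<times> real) set"
  have "\<exists>M\<in>Collect good. \<forall>X\<in>Collect good. M \<subseteq> X \<longrightarrow> X = M"
  proof (rule subset_Zorn_nonempty)
    have "good ((\<lambda>f. (f, u f)) ` W)"
      unfolding good_def using W u by (auto simp: image_iff)
    then show "Collect good \<noteq> {}" by blast
    fix C assume C: "C \<noteq> {}" "subset.chain (Collect good) C"
    then have good: "good X" if "X \<in> C" for X using that unfolding subset.chain_def by auto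
    have "good (\<Union>C)"
      unfolding good_def
    proof (intro conjI)
      show "\<forall>f\<in>W. (f, u f) \<in> \<Union>C" using C(1) good unfolding good_def by blast
      show "\<forall>(f, a)\<in>\<Union>C. f \<in> V \<and> a \<le> p f" using good unfolding good_def by blast
      show "\<forall>(f, a)\<in>\<Union>C. \<forall>(g, b)\<in>\<Union>C. \<forall>t. (comb f t g, a + t * b) \<in> \<Union>C"
      proof (clarify)
        fix f a X g b Y and t :: real assume *: "(f, a) \<in> X" "X \<in> C" "(g, b) \<in> Y" "Y \<in> C"
        then have "X \<subseteq> Y \<or> Y \<subseteq> X" using C(2) unfolding subset.chain_def by blast
        then obtain Z where "Z \<in> C" "(f, a) \<in> Z" "(g, b) \<in> Z" using * by blast
        then show "(comb f t g, a + t * b) \<in> \<Union>C" using good[of Z] unfolding good_def by blast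
      qed
    qed
    then show "\<Union>C \<in> Collect good" by simp
  qed
  then obtain M where M: "good M" and max: "\<And>X. good X \<Longrightarrow> M \<subseteq> X \<Longrightarrow> X = M" by blast
  have MW: "(f, u f) \<in> M" if "f \<in> W" for f using M that unfolding good_def by blast
  have MV: "f \<in> V" "a \<le> p f" if "(f, a) \<in> M" for f a using M that unfolding good_def by blast+
  have Mc: "(comb f t g, a + t * b) \<in> M" if "(f, a) \<in> M" "(g, b) \<in> M" for f a g b t
    using M that unfolding good_def by blast
  let ?z = "\<lambda>_::'x. 0 :: complex"
  have "comb ?z 1 ?z = ?z" by (simp add: comb_def)
  then have "u ?z = 0" using u(1)[OF W(2) W(2), of 1] by simp
  then have M0: "(?z, 0) \<in> M" using MW[OF W(2)] by simp
  have p0: "p ?z = 0" using p(2)[of 0 ?z] W by auto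
  have total: "\<exists>a. (x0, a) \<in> M" if x0: "x0 \<in> V" for x0
  proof -
    \<comment> \<open>Subadditivity separates the lower bounds for a value at \<open>x0\<close> from
      the upper bounds; any number between them is admissible.\<close>
    have sep: "a - p (comb f (- 1) x0) \<le> p (comb g 1 x0) - b" if fa: "(f, a) \<in> M" and gb: "(g, b) \<in> M" for f a g b
    proof -
      have "a + b \<le> p (comb f 1 g)" using MV(2)[OF Mc[OF fa gb, of 1]] by simp
      also have "comb f 1 g = (\<lambda>x. comb f (- 1) x0 x + comb g 1 x0 x)" by (simp add: comb_def fun_eq_iff)
      also have "p \<dots> \<le> p (comb f (- 1) x0) + p (comb g 1 x0)"
        by (rule p(1)) (use V MV(1) fa gb x0 in blast)+
      finally show ?thesis by simp
    qed
    \<comment> \<open>This is the least admissible value at \<open>x0\<close>. The supremum is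
      finite by \<open>sep\<close> applied with the pair of zeros in \<open>M\<close>.\<close>
    define c where "c = (SUP (f, a)\<in>M. a - p (comb f (- 1) x0))"
    have bdd: "bdd_above ((\<lambda>(f, a). a - p (comb f (- 1) x0)) ` M)"
      using sep[OF _ M0] by (intro bdd_aboveI2[where M = "p (comb ?z 1 x0) - 0"]) auto
    have c1: "a - p (comb f (- 1) x0) \<le> c" if "(f, a) \<in> M" for f a
      unfolding c_def using cSUP_upper[OF that bdd] by simp
    have c2: "c \<le> p (comb g 1 x0) - b" if "(g, b) \<in> M" for g b
      unfolding c_def using M0 sep[OF _ that] by (intro cSUP_least) auto
    define M' where "M' = {(comb f t x0, a + t * c) | f a t. (f, a) \<in> M}"
    have bound: "a + t * c \<le> p (comb f t x0)" if fa: "(f, a) \<in> M" for f a t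
    proof -
      consider "t = 0" | "0 < t" | "t < 0" by linarith
      then show ?thesis
      proof cases
        case 1
        then show ?thesis using MV(2)[OF fa] by (simp add: comb_def)
      next
        case 2
        have m: "(comb ?z (inverse t) f, inverse t * a) \<in> M" using Mc[OF M0 fa, of "inverse t"] by simp
        have v: "comb (comb ?z (inverse t) f) 1 x0 \<in> V" by (rule V[OF MV(1)[OF m] x0])
        have "comb f t x0 = (\<lambda>x. of_real t * comb (comb ?z (inverse t) f) 1 x0 x)"
          using 2 by (simp add: comb_def fun_eq_iff field_simps)
        then have "p (comb f t x0) = t * p (comb (comb ?z (inverse t) f) 1 x0)"
          using p(2)[OF less_imp_le[OF 2] v] by simp
        also have "\<dots> \<ge> t * (inverse t * a + c)" using c2[OF m] 2 by (intro mult_left_mono) auto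
        finally show ?thesis using 2 by (simp add: distrib_left mult.assoc[symmetric])
      next
        case 3
        define r where "r = - t"
        have r: "0 < r" using 3 by (simp add: r_def)
        have m: "(comb ?z (inverse r) f, inverse r * a) \<in> M" using Mc[OF M0 fa, of "inverse r"] by simp
        have v: "comb (comb ?z (inverse r) f) (- 1) x0 \<in> V" by (rule V[OF MV(1)[OF m] x0])
        have "comb f t x0 = (\<lambda>x. of_real r * comb (comb ?z (inverse r) f) (- 1) x0 x)"
          using r by (simp add: comb_def fun_eq_iff field_simps r_def)
        then have "p (comb f t x0) = r * p (comb (comb ?z (inverse r) f) (- 1) x0)"
          using p(2)[OF less_imp_le[OF r] v] by simp
        also have "\<dots> \<ge> r * (inverse r * a - c)" using c1[OF m] r by (intro mult_left_mono) auto
        finally show ?thesis using r by (simp add: right_diff_distrib r_def mult.assoc[symmetric])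
      qed
    qed
    have sub: "M \<subseteq> M'"
    proof
      fix y assume y: "y \<in> M"
      obtain f a where fa: "y = (f, a)" by (cases y)
      have "y = (comb f 0 x0, a + 0 * c)" by (simp add: fa comb_def)
      moreover have "(f, a) \<in> M" using y fa by simp
      ultimately show "y \<in> M'" unfolding M'_def by blast
    qed
    have "good M'"
      unfolding good_def
    proof (intro conjI)
      show "\<forall>f\<in>W. (f, u f) \<in> M'" using MW sub by blast
      show "\<forall>(f, a)\<in>M'. f \<in> V \<and> a \<le> p f" unfolding M'_def using bound V MV(1) x0 by blast
      show "\<forall>(f, a)\<in>M'. \<forall>(g, b)\<in>M'. \<forall>t. (comb f t g, a + t * b) \<in> M'"
      proof clarify
        fix f a g b and t :: real assume "(f, a) \<in> M'" "(g, b) \<in> M'"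
        then obtain f' a' r g' b' q where *: "(f', a') \<in> M" "(g', b') \<in> M" "f = comb f' r x0" "a = a' + r * c"
          "g = comb g' q x0" "b = b' + q * c"
          unfolding M'_def by blast
        have "comb f t g = comb (comb f' t g') (r + t * q) x0" "a + t * b = (a' + t * b') + (r + t * q) * c"
          by (simp_all add: * comb_def fun_eq_iff algebra_simps)
        then show "(comb f t g, a + t * b) \<in> M'"
          unfolding M'_def using Mc[OF *(1,2), of t] by blast
      qed
    qed
    then have "M' = M" using max sub by blast
    moreover have "(comb ?z 1 x0, 0 + 1 * c) \<in> M'" unfolding M'_def using M0 by blast
    moreover have "comb ?z 1 x0 = x0" by (simp add: comb_def)
    ultimately show ?thesis by auto
  qed
  \<comment> \<open>Two values at the same \<open>f\<close> would put their differences, of either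
    sign, at the zero function, where domination allows only nonpositive values.\<close>
  have single: "a = b" if "(f, a) \<in> M" "(f, b) \<in> M" for f a b
  proof -
    have z: "comb f (- 1) f = ?z" by (simp add: comb_def)
    have "a - b \<le> 0" "b - a \<le> 0"
      using MV(2)[OF Mc[OF that, of "- 1"]] MV(2)[OF Mc[OF that(2,1), of "- 1"]] unfolding z p0 by simp_all
    then show ?thesis by simp
  qed
  define U where "U f = (THE a. (f, a) \<in> M)" for f
  have U: "U f = a" if "(f, a) \<in> M" for f a
    unfolding U_def using that single by blast
  show ?thesis
  proof (intro exI[of _ U] conjI ballI allI)
    fix f g and t :: real assume "f \<in> V" "g \<in> V"
    then obtain a b where ab: "(f, a) \<in> M" "(g, b) \<in> M" using total by blast
    show "U (comb f t g) = U f + t * U g"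
      using U[OF ab(1)] U[OF ab(2)] U[OF Mc[OF ab]] by simp
  next
    show "U f = u f" if "f \<in> W" for f using U[OF MW[OF that]] .
    show "U f \<le> p f" if fV: "f \<in> V" for f
    proof -
      obtain a where a: "(f, a) \<in> M" using total[OF fV] by blast
      show ?thesis using U[OF a] MV(2)[OF a] by simp
    qed
  qed
qed

text \<open>The real part is extended and the complex functional is recovered as R(f) - \<i> R(\<i>
  f). The factor 2 comes from estimating the real and imaginary parts separately; it is harmless for
  continuity.\<close>

lemma hahn_banach_complex:
  fixes V W :: "('x \<Rightarrow> complex) set" and p :: "('x \<Rightarrow> complex) \<Rightarrow> real" and u :: "('x \<Rightarrow> complex) \<Rightarrow> complex"
  assumes V: "\<And>f g. f \<in> V \<Longrightarrow> g \<in> V \<Longrightarrow> (\<lambda>x. f x + g x) \<in> V" "\<And>c f. f \<in> V \<Longrightarrow> (\<lambda>x. c * f x) \<in> V"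
    and W: "W \<subseteq> V" "W \<noteq> {}" "\<And>f g. f \<in> W \<Longrightarrow> g \<in> W \<Longrightarrow> (\<lambda>x. f x + g x) \<in> W" "\<And>c f. f \<in> W \<Longrightarrow> (\<lambda>x. c * f x) \<in> W"
    and p: "\<And>f g. f \<in> V \<Longrightarrow> g \<in> V \<Longrightarrow> p (\<lambda>x. f x + g x) \<le> p f + p g"
      "\<And>c f. f \<in> V \<Longrightarrow> p (\<lambda>x. c * f x) = norm c * p f"
    and u: "\<And>f g. f \<in> W \<Longrightarrow> g \<in> W \<Longrightarrow> u (\<lambda>x. f x + g x) = u f + u g" "\<And>c f. f \<in> W \<Longrightarrow> u (\<lambda>x. c * f x) = c * u f"
      "\<And>f. f \<in> W \<Longrightarrow> norm (u f) \<le> p f"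
  shows "\<exists>U. (\<forall>f\<in>V. \<forall>g\<in>V. U (\<lambda>x. f x + g x) = U f + U g) \<and> (\<forall>c. \<forall>f\<in>V. U (\<lambda>x. c * f x) = c * U f) \<and>
    (\<forall>f\<in>W. U f = u f) \<and> (\<forall>f\<in>V. norm (U f) \<le> 2 * p f)"
proof -
  obtain f0 where f0: "f0 \<in> W" using W(2) by blast
  have z: "(\<lambda>_. 0) \<in> W" using W(4)[OF f0, of 0] by simp
  have "\<exists>R. (\<forall>f\<in>V. \<forall>g\<in>V. \<forall>t. R (comb f t g) = R f + t * R g) \<and> (\<forall>f\<in>W. R f = Re (u f)) \<and> (\<forall>f\<in>V. R f \<le> p f)"
  proof (rule hahn_banach_real)
    show "comb f t g \<in> V" if "f \<in> V" "g \<in> V" for f g t unfolding comb_def using V that by simp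
    show "comb f t g \<in> W" if "f \<in> W" "g \<in> W" for f g t unfolding comb_def using W(3,4) that by simp
    show "Re (u (comb f t g)) = Re (u f) + t * Re (u g)" if "f \<in> W" "g \<in> W" for f g t
      unfolding comb_def using u(1)[OF that(1) W(4)[OF that(2)]] u(2)[OF that(2)] by simp
    show "Re (u f) \<le> p f" if "f \<in> W" for f
      using u(3)[OF that] complex_Re_le_cmod order_trans by blast
    show "p (\<lambda>x. of_real t * f x) = t * p f" if "0 \<le> t" "f \<in> V" for t f
      using p(2)[OF that(2), of "of_real t"] that(1) by simp
  qed (use W(1) z p(1) in auto)
  then obtain R where R: "\<And>f g t. f \<in> V \<Longrightarrow> g \<in> V \<Longrightarrow> R (comb f t g) = R f + t * R g"
    "\<And>f. f \<in> W \<Longrightarrow> R f = Re (u f)" "\<And>f. f \<in> V \<Longrightarrow> R f \<le> p f" by blast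
  have zV: "(\<lambda>_. 0) \<in> V" using z W(1) by blast
  have R0: "R (\<lambda>_. 0) = 0" using R(1)[OF zV zV, of 1] by (simp add: comb_def)
  have Rt: "R (\<lambda>x. of_real t * f x) = t * R f" if "f \<in> V" for f t
    using R(1)[OF zV that, of t] R0 by (simp add: comb_def)
  have Ra: "R (\<lambda>x. f x + g x) = R f + R g" if "f \<in> V" "g \<in> V" for f g
    using R(1)[OF that, of 1] by (simp add: comb_def)
  have Rabs: "\<bar>R f\<bar> \<le> p f" if "f \<in> V" for f
  proof -
    have "- R f = R (\<lambda>x. of_real (- 1) * f x)" using Rt[OF that, of "- 1"] by simp
    also have "\<dots> \<le> p (\<lambda>x. of_real (- 1) * f x)" by (intro R(3) V(2) that)
    also have "\<dots> = p f" using p(2)[OF that, of "of_real (- 1)"] by simp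
    finally show ?thesis using R(3)[OF that] by simp
  qed
  define J where "J f = (\<lambda>x. \<i> * f x)" for f :: "'x \<Rightarrow> complex"
  have JV: "J f \<in> V" if "f \<in> V" for f unfolding J_def using V(2) that by blast
  define U where "U f = Complex (R f) (- R (J f))" for f
  show ?thesis
  proof (intro exI[of _ U] conjI ballI allI)
    fix f g assume fg: "f \<in> V" "g \<in> V"
    have "J (\<lambda>x. f x + g x) = (\<lambda>x. J f x + J g x)" by (simp add: J_def distrib_left)
    then show "U (\<lambda>x. f x + g x) = U f + U g"
      unfolding U_def using Ra[OF fg] Ra[OF JV[OF fg(1)] JV[OF fg(2)]] by (simp add: complex_eq_iff)
  next
    fix c f assume f: "f \<in> V"
    have 1: "(\<lambda>x. c * f x) = (\<lambda>x. of_real (Re c) * f x + of_real (Im c) * J f x)"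
      by (simp add: J_def fun_eq_iff complex_eq_iff)
    have 2: "J (\<lambda>x. c * f x) = (\<lambda>x. of_real (Re c) * J f x + of_real (- Im c) * f x)"
      by (simp add: J_def fun_eq_iff complex_eq_iff algebra_simps)
    have "R (\<lambda>x. c * f x) = Re c * R f + Im c * R (J f)"
      unfolding 1 by (subst Ra) (simp_all only: V(2) f JV Rt)
    moreover have "R (J (\<lambda>x. c * f x)) = Re c * R (J f) + (- Im c) * R f"
      unfolding 2 by (subst Ra) (simp_all only: V(2) f JV Rt)
    ultimately show "U (\<lambda>x. c * f x) = c * U f" by (simp add: U_def complex_eq_iff)
  next
    fix f assume f: "f \<in> W"
    have "J f \<in> W" unfolding J_def using W(4) f by blast
    then show "U f = u f"
      using R(2)[OF f] R(2)[of "J f"] u(2)[OF f, of "\<i>"] by (simp add: U_def J_def complex_eq_iff)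
  next
    fix f assume f: "f \<in> V"
    have "norm (U f) \<le> \<bar>R f\<bar> + \<bar>R (J f)\<bar>" unfolding U_def using cmod_le[of "Complex (R f) (- R (J f))"] by simp
    also have "\<dots> \<le> p f + p (J f)" using Rabs[OF f] Rabs[OF JV[OF f]] by simp
    also have "p (J f) = p f" unfolding J_def using p(2)[OF f, of "\<i>"] by simp
    finally show "norm (U f) \<le> 2 * p f" by simp
  qed
qed

section \<open>Schwartz functions vanishing to infinite order at the origin\<close>

text \<open>As in \<open>fam\<close>, derivatives are taken on the inside. The truncation at order
  \<open>k\<close> permits induction: the product rule for a coordinate factor calls on the
  condition at a lower order.\<close>

primrec flat_upto :: "nat \<Rightarrow> ('a::euclidean_space \<Rightarrow> complex) \<Rightarrow> bool" where
  "flat_upto 0 f = (f 0 = 0)"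
| "flat_upto (Suc k) f = (f 0 = 0 \<and> (\<forall>b\<in>Basis. flat_upto k (partial_deriv b f)))"

lemma flat_upto_iff:
  "flat_upto k f \<longleftrightarrow> (\<forall>bs. set bs \<subseteq> Basis \<longrightarrow> length bs \<le> k \<longrightarrow> iter_partial bs f 0 = 0)"
proof (induction k arbitrary: f)
  case (Suc k)
  show ?case
  proof
    assume fl: "flat_upto (Suc k) f"
    show "\<forall>bs. set bs \<subseteq> Basis \<longrightarrow> length bs \<le> Suc k \<longrightarrow> iter_partial bs f 0 = 0"
    proof (intro allI impI)
      fix bs :: "'a list" assume bs: "set bs \<subseteq> Basis" "length bs \<le> Suc k"
      show "iter_partial bs f 0 = 0"
      proof (cases bs rule: rev_cases)
        case (snoc cs b)
        then show ?thesis using fl bs Suc.IH[of "partial_deriv b f"] by (auto simp: iter_partial_snoc)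
      qed (use fl in simp)
    qed
  next
    assume *: "\<forall>bs. set bs \<subseteq> Basis \<longrightarrow> length bs \<le> Suc k \<longrightarrow> iter_partial bs f 0 = 0"
    have "flat_upto k (partial_deriv b f)" if "b \<in> Basis" for b
      unfolding Suc.IH
    proof (intro allI impI)
      fix bs :: "'a list" assume "set bs \<subseteq> Basis" "length bs \<le> k"
      then show "iter_partial bs (partial_deriv b f) 0 = 0"
        using *[rule_format, of "bs @ [b]"] that by (simp add: iter_partial_snoc)
    qed
    then show "flat_upto (Suc k) f" using *[rule_format, of "[]"] by simp
  qed
qed simp

lemma schwartz_flat_iff: "f \<in> schwartz_flat \<longleftrightarrow> f \<in> schwartz \<and> (\<forall>k. flat_upto k f)"
  unfolding schwartz_flat_def flat_upto_iff by auto

lemma schwartz_flatD: "f \<in> schwartz_flat \<Longrightarrow> f \<in> schwartz" "f \<in> schwartz_flat \<Longrightarrow> f 0 = 0"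
  unfolding schwartz_flat_iff by (auto dest: spec[of _ 0])

lemma schwartz_flat_partial_deriv: "f \<in> schwartz_flat \<Longrightarrow> b \<in> Basis \<Longrightarrow> partial_deriv b f \<in> schwartz_flat"
  unfolding schwartz_flat_iff
proof (intro conjI allI)
  fix k assume "f \<in> schwartz \<and> (\<forall>k. flat_upto k f)" "b \<in> Basis"
  then show "flat_upto k (partial_deriv b f)" using flat_upto.simps(2)[of k f] by blast
qed (use schwartz_partial_deriv in blast)

lemma flat_upto_add:
  "f \<in> schwartz \<Longrightarrow> g \<in> schwartz \<Longrightarrow> flat_upto k f \<Longrightarrow> flat_upto k g \<Longrightarrow> flat_upto k (\<lambda>x. f x + g x)"
proof (induction k arbitrary: f g)
  case (Suc k)
  have "partial_deriv b (\<lambda>x. f x + g x) = (\<lambda>x. partial_deriv b f x + partial_deriv b g x)" for b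
    using partial_deriv_add schwartz_differentiable Suc.prems by blast
  moreover have "flat_upto k (\<lambda>x. partial_deriv b f x + partial_deriv b g x)" if "b \<in> Basis" for b
    using Suc.prems that by (intro Suc.IH schwartz_partial_deriv) auto
  ultimately show ?case using Suc.prems by simp
qed simp

lemma flat_upto_cmult: "f \<in> schwartz \<Longrightarrow> flat_upto k f \<Longrightarrow> flat_upto k (\<lambda>x. c * f x)"
proof (induction k arbitrary: f)
  case (Suc k)
  have "partial_deriv b (\<lambda>x. c * f x) = (\<lambda>x. c * partial_deriv b f x)" for b
    using partial_deriv_cmult schwartz_differentiable Suc.prems by blast
  moreover have "flat_upto k (\<lambda>x. c * partial_deriv b f x)" if "b \<in> Basis" for b
    using Suc.prems that by (intro Suc.IH schwartz_partial_deriv) auto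
  ultimately show ?case using Suc.prems by simp
qed simp

lemma flat_upto_SucD: "flat_upto (Suc k) f \<Longrightarrow> flat_upto k f"
  by (induction k arbitrary: f) auto

lemma flat_upto_coord: "f \<in> schwartz \<Longrightarrow> flat_upto k f \<Longrightarrow> flat_upto k (\<lambda>x. of_real (x \<bullet> c) * f x)"
proof (induction k arbitrary: f)
  case (Suc k)
  have d: "partial_deriv b (\<lambda>x. of_real (x \<bullet> c) * f x) = (\<lambda>x. of_real (b \<bullet> c) * f x + of_real (x \<bullet> c) * partial_deriv b f x)" for b
    by (rule ext) (simp add: partial_deriv_mult schwartz_differentiable[OF Suc.prems(1)] partial_deriv_coord)
  have "flat_upto k (partial_deriv b (\<lambda>x. of_real (x \<bullet> c) * f x))" if b: "b \<in> Basis" for b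
  proof -
    have pb: "partial_deriv b f \<in> schwartz" "flat_upto k (partial_deriv b f)"
      using schwartz_partial_deriv Suc.prems b by auto
    show ?thesis unfolding d
      by (rule flat_upto_add[OF schwartz_cmult[OF Suc.prems(1)] schwartz_coord[OF pb(1)]
            flat_upto_cmult[OF Suc.prems(1) flat_upto_SucD[OF Suc.prems(2)]] Suc.IH[OF pb]])
  qed
  then show ?case using Suc.prems by simp
qed simp

lemma schwartz_flat_add: "f \<in> schwartz_flat \<Longrightarrow> g \<in> schwartz_flat \<Longrightarrow> (\<lambda>x. f x + g x) \<in> schwartz_flat"
  unfolding schwartz_flat_iff using flat_upto_add schwartz_add by blast

lemma schwartz_flat_cmult: "f \<in> schwartz_flat \<Longrightarrow> (\<lambda>x. c * f x) \<in> schwartz_flat"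
  unfolding schwartz_flat_iff using flat_upto_cmult schwartz_cmult by blast

lemma schwartz_flat_coord: "f \<in> schwartz_flat \<Longrightarrow> (\<lambda>x. of_real (x \<bullet> c) * f x) \<in> schwartz_flat"
  unfolding schwartz_flat_iff using flat_upto_coord schwartz_coord by blast

lemma schwartz_flat_0: "(\<lambda>_. 0) \<in> schwartz_flat"
proof -
  have "iter_partial bs (\<lambda>_. 0) = (\<lambda>_. 0)" for bs :: "'a list"
    by (induction bs) (simp_all add: partial_deriv_const)
  then show ?thesis unfolding schwartz_flat_def schwartz_def smooth_def by simp
qed

lemma schwartz_flat_sum:
  assumes "finite A" "\<And>a. a \<in> A \<Longrightarrow> f a \<in> schwartz_flat" shows "(\<lambda>x. \<Sum>a\<in>A. f a x) \<in> schwartz_flat"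
  using assms
proof (induction A rule: finite_induct)
  case (insert a A)
  then show ?case using schwartz_flat_add[of "f a" "\<lambda>x. \<Sum>a\<in>A. f a x"] by simp
qed (simp add: schwartz_flat_0)

lemma vanishing_near_0_flat:
  assumes f: "f \<in> schwartz" and r: "0 < r" "\<And>x. norm x < r \<Longrightarrow> f x = 0"
  shows "f \<in> schwartz_flat"
proof -
  have "\<forall>x\<in>ball 0 r. iter_partial bs f x = 0" for bs
  proof (induction bs)
    case (Cons b bs)
    then show ?case using partial_deriv_eq_0(2)[of "ball 0 r" _ "iter_partial bs f" b] by auto
  qed (use r(2) in simp)
  then show ?thesis unfolding schwartz_flat_def using f r(1) by auto
qed

text \<open>Under the transform a linear factor is a constant-coefficient derivative, and flat
  functions are stable under those. Sums and products of polynomials then follow by induction, a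
  product by applying its factors one after the other.\<close>

lemma polynomial_mult_fourier_flat:
  fixes q :: "'a::euclidean_space \<Rightarrow> real"
  assumes "real_polynomial_function q" "\<kappa> \<in> schwartz_flat"
  shows "\<exists>\<kappa>'\<in>schwartz_flat. \<forall>x. of_real (q x) * fourier \<kappa> x = fourier \<kappa>' x"
  using assms
proof (induction arbitrary: \<kappa> rule: real_polynomial_function.induct)
  case (linear f)
  define c where "c b = complex_of_real (f b) * (\<i> / of_real (- 2 * pi))" for b
  let ?\<kappa> = "\<lambda>x. \<Sum>b\<in>Basis. c b * partial_deriv b \<kappa> x"
  have fl: "(\<lambda>x. c b * partial_deriv b \<kappa> x) \<in> schwartz_flat" if "b \<in> Basis" for b
    using schwartz_flat_cmult[OF schwartz_flat_partial_deriv[OF linear(2) that]] .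
  have "of_real (f x) * fourier \<kappa> x = fourier ?\<kappa> x" for x
  proof -
    have "f x = (\<Sum>b\<in>Basis. (x \<bullet> b) * f b)"
    proof -
      have lin: "linear f" using linear(1) by (rule bounded_linear.linear)
      have "f (\<Sum>b\<in>Basis. (x \<bullet> b) *\<^sub>R b) = (\<Sum>b\<in>Basis. (x \<bullet> b) * f b)"
        by (simp add: linear_sum[OF lin] linear_cmul[OF lin])
      then show ?thesis by (simp add: euclidean_representation)
    qed
    then have "of_real (f x) * fourier \<kappa> x = (\<Sum>b\<in>Basis. of_real (f b) * (of_real (x \<bullet> b) * fourier \<kappa> x))"
      by (simp add: sum_distrib_left mult_ac)
    also have "\<dots> = (\<Sum>b\<in>Basis. ft (- 2 * pi) (\<lambda>y. c b * partial_deriv b \<kappa> y) x)"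
    proof (rule sum.cong[OF refl])
      fix b :: 'a assume b: "b \<in> Basis"
      show "of_real (f b) * (of_real (x \<bullet> b) * fourier \<kappa> x) = ft (- 2 * pi) (\<lambda>y. c b * partial_deriv b \<kappa> y) x"
      proof -
        have 1: "of_real (x \<bullet> b) * ft (- 2 * pi) \<kappa> x = ft (- 2 * pi) (\<lambda>y. \<i> / of_real (- 2 * pi) * partial_deriv b \<kappa> y) x"
          by (rule coord_mult_ft[OF schwartz_flatD(1)[OF linear(2)] b]) simp
        show ?thesis unfolding fourier_eq_ft 1 c_def ft_cmult by (simp only: mult.assoc)
      qed
    qed
    also have "\<dots> = fourier ?\<kappa> x"
      unfolding fourier_eq_ft
      by (rule ft_sum[symmetric]) (use schwartz_integrable schwartz_flatD(1) fl in blast)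
    finally show ?thesis .
  qed
  moreover have "?\<kappa> \<in> schwartz_flat" by (rule schwartz_flat_sum) (use fl in auto)
  ultimately show ?case by blast
next
  case (const c)
  then show ?case
    using schwartz_flat_cmult[OF const, of "of_real c"] ft_cmult[of "- 2 * pi" "of_real c" \<kappa>]
    unfolding fourier_eq_ft by (intro bexI[of _ "\<lambda>x. of_real c * \<kappa> x"]) simp_all
next
  case (add f g)
  obtain \<kappa>1 \<kappa>2 where "\<kappa>1 \<in> schwartz_flat" "\<And>x. of_real (f x) * fourier \<kappa> x = fourier \<kappa>1 x"
    "\<kappa>2 \<in> schwartz_flat" "\<And>x. of_real (g x) * fourier \<kappa> x = fourier \<kappa>2 x"
    using add.IH[OF add.prems] by blast
  moreover from this have "fourier (\<lambda>x. \<kappa>1 x + \<kappa>2 x) x = fourier \<kappa>1 x + fourier \<kappa>2 x" for x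
    unfolding fourier_eq_ft by (intro ft_add schwartz_integrable schwartz_flatD)
  ultimately show ?case
    by (intro bexI[of _ "\<lambda>x. \<kappa>1 x + \<kappa>2 x"] schwartz_flat_add) (simp_all add: distrib_right)
next
  case (mult f g)
  obtain \<kappa>1 where 1: "\<kappa>1 \<in> schwartz_flat" "\<And>x. of_real (g x) * fourier \<kappa> x = fourier \<kappa>1 x"
    using mult.IH(2)[OF mult.prems] by blast
  obtain \<kappa>2 where 2: "\<kappa>2 \<in> schwartz_flat" "\<And>x. of_real (f x) * fourier \<kappa>1 x = fourier \<kappa>2 x"
    using mult.IH(1)[OF 1(1)] by blast
  show ?case by (rule bexI[OF _ 2(1)]) (simp add: mult.assoc 1(2) 2(2))
qed

text \<open>The integral is the inverse transform at the origin, hence the value there of the flat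
  function itself.\<close>

lemma integral_fourier_flat:
  assumes "\<kappa> \<in> schwartz_flat" shows "(LINT x|lborel. fourier \<kappa> x) = 0"
proof -
  have "inv_fourier (fourier \<kappa>) 0 = \<kappa> 0" using inv_fourier_fourier[OF schwartz_flatD(1)[OF assms]] by simp
  then show ?thesis using schwartz_flatD(2)[OF assms] by (simp add: inv_fourier_def)
qed

lemma regular_dist_polynomial_flat:
  fixes q :: "'a::euclidean_space \<Rightarrow> complex"
  assumes q: "polynomial_function q" and \<kappa>: "\<kappa> \<in> schwartz_flat"
  shows "regular_dist q (fourier \<kappa>) = 0"
proof -
  have "real_polynomial_function (Re \<circ> q)" "real_polynomial_function (Im \<circ> q)"
    using q bounded_linear_Re bounded_linear_Im unfolding polynomial_function_def by blast+
  then obtain \<kappa>1 \<kappa>2 where 1: "\<kappa>1 \<in> schwartz_flat" "\<And>x. of_real ((Re \<circ> q) x) * fourier \<kappa> x = fourier \<kappa>1 x"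
    and 2: "\<kappa>2 \<in> schwartz_flat" "\<And>x. of_real ((Im \<circ> q) x) * fourier \<kappa> x = fourier \<kappa>2 x"
    using polynomial_mult_fourier_flat[OF _ \<kappa>] by metis
  have "q x * fourier \<kappa> x = fourier \<kappa>1 x + \<i> * fourier \<kappa>2 x" for x
    unfolding 1(2)[symmetric] 2(2)[symmetric] by (subst complex_eq[of "q x"]) (simp add: distrib_right)
  moreover have "integrable lborel (fourier \<kappa>1)" "integrable lborel (fourier \<kappa>2)"
    using schwartz_integrable[OF schwartz_fourier[OF schwartz_flatD(1)]] 1(1) 2(1) by auto
  ultimately show ?thesis
    unfolding regular_dist_def using integral_fourier_flat[OF 1(1)] integral_fourier_flat[OF 2(1)] by simp
qed

text \<open>A polynomial annihilates transforms of flat functions. Blocks and potentials test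
  representatives only on such transforms, so they see classes alone.\<close>

lemma poly_equiv_fourier_flat:
  assumes "(f, g) \<in> poly_equiv" "\<kappa> \<in> schwartz_flat"
  shows "f (fourier \<kappa>) = g (fourier \<kappa>)"
proof -
  obtain q where q: "polynomial_function q" "\<And>\<psi>. \<psi> \<in> schwartz \<Longrightarrow> f \<psi> - g \<psi> = regular_dist q \<psi>"
    using assms(1) unfolding poly_equiv_def by blast
  show ?thesis
    using q(2)[OF schwartz_fourier[OF schwartz_flatD(1)[OF assms(2)]]] regular_dist_polynomial_flat[OF q(1) assms(2)] by simp
qed

section \<open>Riesz potentials\<close>

context scale
begin

text \<open>The gradient is a flat family too, hence of size |\<xi>|^M by induction; integrating
  along the segment from the origin gains one power. Using \<open>inverse\<close>, which is 0 at 0,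
  keeps the bound meaningful at the origin.\<close>

lemma flat_family_taylor:
  fixes T :: "'i \<Rightarrow> 'a::euclidean_space \<Rightarrow> complex"
  assumes "schwartz_fam T" "\<And>i. i \<in> I \<Longrightarrow> T i \<in> schwartz_flat"
  shows "bd (\<lambda>i \<xi>. norm (T i \<xi>) * inverse (norm \<xi>) ^ M)"
  using assms
proof (induction M arbitrary: T)
  case 0
  show ?case using rapidD[OF schwartz_fam_rapid[OF 0(1)], of 0] by simp
next
  case (Suc M)
  have "bd (\<lambda>i (\<xi>::'a). \<Sum>b\<in>Basis. norm (partial_deriv b (T i) \<xi>) * inverse (norm \<xi>) ^ M)"
  proof (rule bd_sum[OF finite_Basis])
    fix b :: 'a assume b: "b \<in> Basis"
    show "bd (\<lambda>i \<xi>. norm (partial_deriv b (T i) \<xi>) * inverse (norm \<xi>) ^ M)"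
      by (rule Suc.IH[OF schwartz_fam_partial_deriv[OF Suc.prems(1) b] schwartz_flat_partial_deriv[OF Suc.prems(2) b]])
  qed
  then obtain C K where C: "C \<ge> 0"
    "\<And>i \<xi>. i \<in> I \<Longrightarrow> (\<Sum>b\<in>Basis. norm (partial_deriv b (T i) \<xi>) * inverse (norm \<xi>) ^ M) \<le> C * \<rho> K i"
    unfolding bd_def by blast
  show ?case
  proof (rule bdI[OF C(1), of _ K])
    fix i and \<xi> :: 'a assume i: "i \<in> I"
    let ?B = "C * \<rho> K i"
    have B0: "0 \<le> ?B" using C(1) scale_nonneg[OF i] by simp
    have grad: "(\<Sum>b\<in>Basis. norm (partial_deriv b (T i) y)) \<le> ?B * norm y ^ M" for y
    proof (cases "y = 0")
      case True
      have "partial_deriv b (T i) 0 = 0" if "b \<in> Basis" for b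
        by (rule schwartz_flatD(2)[OF schwartz_flat_partial_deriv[OF Suc.prems(2)[OF i] that]])
      then show ?thesis using True B0 by simp
    next
      case False
      have "(\<Sum>b\<in>Basis. norm (partial_deriv b (T i) y)) * inverse (norm y) ^ M \<le> ?B"
        using C(2)[OF i, of y] by (simp add: sum_distrib_right)
      then have "(\<Sum>b\<in>Basis. norm (partial_deriv b (T i) y)) * inverse (norm y) ^ M * norm y ^ M \<le> ?B * norm y ^ M"
        by (rule mult_right_mono) simp
      moreover have "inverse (norm y) ^ M * norm y ^ M = 1" using False by (simp flip: power_mult_distrib)
      ultimately show ?thesis by (simp only: mult.assoc mult_1_right)
    qed
    have diff: "T i differentiable (at y)" for y using schwartz_fam_differentiable[OF Suc.prems(1) i] .
    have "norm (T i (0 + 1 *\<^sub>R \<xi>) - T i 0) \<le> 1 * (norm \<xi> * (?B * norm \<xi> ^ M))"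
    proof (rule increment_bound[OF diff])
      fix s :: real assume s: "0 \<le> s" "s \<le> 1"
      have "partial_deriv \<xi> (T i) (0 + s *\<^sub>R \<xi>) = (\<Sum>b\<in>Basis. (\<xi> \<bullet> b) *\<^sub>R partial_deriv b (T i) (s *\<^sub>R \<xi>))"
        unfolding add_0 by (rule partial_deriv_eqI[OF has_derivative_partial_deriv[OF diff]])
      also have "norm \<dots> \<le> (\<Sum>b\<in>Basis. norm \<xi> * norm (partial_deriv b (T i) (s *\<^sub>R \<xi>)))"
      proof (rule sum_norm_le)
        fix b :: 'a assume "b \<in> Basis"
        then show "norm ((\<xi> \<bullet> b) *\<^sub>R partial_deriv b (T i) (s *\<^sub>R \<xi>)) \<le> norm \<xi> * norm (partial_deriv b (T i) (s *\<^sub>R \<xi>))"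
          unfolding norm_scaleR real_norm_def by (intro mult_right_mono Basis_le_norm) auto
      qed
      also have "\<dots> = norm \<xi> * (\<Sum>b\<in>Basis. norm (partial_deriv b (T i) (s *\<^sub>R \<xi>)))"
        by (simp add: sum_distrib_left)
      also have "\<dots> \<le> norm \<xi> * (?B * norm (s *\<^sub>R \<xi>) ^ M)"
        by (intro mult_left_mono grad) simp
      also have "\<dots> \<le> norm \<xi> * (?B * norm \<xi> ^ M)"
      proof -
        have "norm (s *\<^sub>R \<xi>) \<le> norm \<xi>" using s mult_left_le_one_le[of "norm \<xi>" s] by simp
        then show ?thesis by (intro mult_left_mono power_mono B0) simp_all
      qed
      finally show "norm (partial_deriv \<xi> (T i) (0 + s *\<^sub>R \<xi>)) \<le> norm \<xi> * (?B * norm \<xi> ^ M)" .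
    qed simp
    then have le: "norm (T i \<xi>) \<le> ?B * norm \<xi> ^ Suc M"
    proof -
      assume "norm (T i (0 + 1 *\<^sub>R \<xi>) - T i 0) \<le> 1 * (norm \<xi> * (?B * norm \<xi> ^ M))"
      moreover have "T i 0 = 0" by (rule schwartz_flatD(2)[OF Suc.prems(2)[OF i]])
      moreover have "1 * (norm \<xi> * (?B * norm \<xi> ^ M)) = ?B * norm \<xi> ^ Suc M" by (simp only: power_Suc mult_1 mult_ac)
      ultimately show ?thesis by (simp only: add_0 scaleR_one diff_zero)
    qed
    show "norm (T i \<xi>) * inverse (norm \<xi>) ^ Suc M \<le> ?B"
    proof (cases "\<xi> = 0")
      case False
      have "norm (T i \<xi>) * inverse (norm \<xi>) ^ Suc M \<le> ?B * norm \<xi> ^ Suc M * inverse (norm \<xi>) ^ Suc M"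
        by (rule mult_right_mono[OF le]) simp
      also have "\<dots> = ?B"
      proof -
        have "norm \<xi> ^ Suc M * inverse (norm \<xi>) ^ Suc M = 1" using False by (simp flip: power_mult_distrib del: power_Suc)
        then show ?thesis by (simp only: mult.assoc mult_1_right)
      qed
      finally show ?thesis .
    qed (use B0 in simp)
  qed
qed

lemma rapid_weight_flat:
  fixes T :: "'i \<Rightarrow> 'a::euclidean_space \<Rightarrow> complex"
  assumes T: "schwartz_fam T" "\<And>i. i \<in> I \<Longrightarrow> T i \<in> schwartz_flat"
  shows "rapid (\<lambda>i \<xi>. weight 0 s \<xi> * T i \<xi>)"
  unfolding rapid_def
proof
  fix N
  \<comment> \<open>An integer above |s| serves both ends: outside the unit ball |\<xi>|^s is at
    most (1 + |\<xi>|)^m, and inside it is at most |\<xi>|^(-m), which flatness absorbs.\<close>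
  define m where "m = nat \<lceil>\<bar>s\<bar>\<rceil>"
  have m: "\<bar>s\<bar> \<le> real m" unfolding m_def by linarith
  have "bd (\<lambda>i \<xi>. (1 + norm \<xi>) ^ (N + m) * norm (T i \<xi>) + 2 ^ N * (norm (T i \<xi>) * inverse (norm \<xi>) ^ m))"
    by (rule bd_add[OF rapidD[OF schwartz_fam_rapid[OF T(1)]] bd_cmult[OF flat_family_taylor[OF T]]]) simp_all
  then show "bd (\<lambda>i \<xi>. (1 + norm \<xi>) ^ N * norm (weight 0 s \<xi> * T i \<xi>))"
  proof (rule bd_mono)
    fix i and \<xi> :: 'a
    consider "\<xi> = 0" | "1 \<le> norm \<xi>" | "0 < norm \<xi>" "norm \<xi> < 1" by fastforce
    then show "(1 + norm \<xi>) ^ N * norm (weight 0 s \<xi> * T i \<xi>) \<le>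
      (1 + norm \<xi>) ^ (N + m) * norm (T i \<xi>) + 2 ^ N * (norm (T i \<xi>) * inverse (norm \<xi>) ^ m)"
    proof cases
      case 1
      then show ?thesis by (simp add: weight_0)
    next
      case 2
      have "norm \<xi> powr s \<le> norm \<xi> powr real m" using 2 m by (intro powr_mono) auto
      also have "\<dots> = norm \<xi> ^ m" using 2 by (intro powr_realpow) auto
      also have "\<dots> \<le> (1 + norm \<xi>) ^ m" by (intro power_mono) auto
      finally have "norm \<xi> powr s * norm (T i \<xi>) \<le> (1 + norm \<xi>) ^ m * norm (T i \<xi>)"
        by (rule mult_right_mono) simp
      then have "(1 + norm \<xi>) ^ N * (norm \<xi> powr s * norm (T i \<xi>)) \<le> (1 + norm \<xi>) ^ N * ((1 + norm \<xi>) ^ m * norm (T i \<xi>))"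
        by (rule mult_left_mono) simp
      then show ?thesis
        by (simp add: weight_0 norm_mult power_add mult.assoc add_increasing2)
    next
      case 3
      have "inverse (norm \<xi>) = norm \<xi> powr (- 1)" using 3 by (simp add: powr_neg_one inverse_eq_divide)
      then have "norm \<xi> powr s = inverse (norm \<xi>) powr (- s)" by (simp only: powr_powr) simp
      also have "\<dots> \<le> inverse (norm \<xi>) powr real m"
        using 3 m by (intro powr_mono) (auto simp: one_le_inverse)
      also have "\<dots> = inverse (norm \<xi>) ^ m" using 3 by (intro powr_realpow) auto
      finally have "norm \<xi> powr s * norm (T i \<xi>) \<le> inverse (norm \<xi>) ^ m * norm (T i \<xi>)"
        by (rule mult_right_mono) simp
      moreover have "(1 + norm \<xi>) ^ N \<le> 2 ^ N" using 3 by (intro power_mono) auto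
      ultimately have "(1 + norm \<xi>) ^ N * (norm \<xi> powr s * norm (T i \<xi>)) \<le> 2 ^ N * (inverse (norm \<xi>) ^ m * norm (T i \<xi>))"
        by (intro mult_mono[of "(1 + norm \<xi>) ^ N" "2 ^ N"]) simp_all
      then have "(1 + norm \<xi>) ^ N * norm (weight 0 s \<xi> * T i \<xi>) \<le> 2 ^ N * (norm (T i \<xi>) * inverse (norm \<xi>) ^ m)"
        by (simp add: norm_mult weight_0 mult_ac)
      then show ?thesis by (rule add_increasing[rotated]) simp
    qed
  qed
qed

lemma schwartz_fam_weight_flat:
  fixes T :: "'i \<Rightarrow> 'a::euclidean_space \<Rightarrow> complex"
  assumes "schwartz_fam T" "\<And>i. i \<in> I \<Longrightarrow> T i \<in> schwartz_flat"
  shows "schwartz_fam (\<lambda>i \<xi>. weight 0 s \<xi> * T i \<xi>)"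
proof (rule schwartz_fam_weightI[where P = "\<lambda>T. schwartz_fam T \<and> (\<forall>i\<in>I. T i \<in> schwartz_flat)" and e = "\<lambda>_. 0"])
  show "schwartz_fam T \<and> (\<forall>i\<in>I. T i \<in> schwartz_flat)" using assms by blast
  fix T :: "'i \<Rightarrow> 'a \<Rightarrow> complex" and b :: 'a and s assume T: "schwartz_fam T \<and> (\<forall>i\<in>I. T i \<in> schwartz_flat)"
  show "rapid (\<lambda>i \<xi>. weight 0 s \<xi> * T i \<xi>)" using T by (intro rapid_weight_flat) auto
  show "T i differentiable (at \<xi>)" if "i \<in> I" for i \<xi> using T schwartz_fam_differentiable that by blast
  show "schwartz_fam (\<lambda>i. partial_deriv b (T i)) \<and> (\<forall>i\<in>I. partial_deriv b (T i) \<in> schwartz_flat)" if "b \<in> Basis"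
    using T that schwartz_fam_partial_deriv schwartz_flat_partial_deriv by blast
  show "schwartz_fam (\<lambda>i \<xi>. of_real s * (of_real (\<xi> \<bullet> b) * T i \<xi>)) \<and>
      (\<forall>i\<in>I. (\<lambda>\<xi>. of_real s * (of_real (\<xi> \<bullet> b) * T i \<xi>)) \<in> schwartz_flat)"
    using T schwartz_fam_cmult[OF schwartz_fam_coord] schwartz_flat_cmult[OF schwartz_flat_coord] by blast
qed

end

section \<open>Schwartz norms as dominating seminorms for the extension\<close>

lemma schwartz_norm_add:
  assumes f: "f \<in> schwartz" and g: "g \<in> schwartz"
  shows "schwartz_norm N (\<lambda>x. f x + g x) \<le> schwartz_norm N f + schwartz_norm N g"
proof -
  have it: "iter_partial bs (\<lambda>x. f x + g x) = (\<lambda>x. iter_partial bs f x + iter_partial bs g x)"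
    if "set bs \<subseteq> Basis" for bs
    using that
  proof (induction bs)
    case (Cons b bs)
    have "iter_partial bs f differentiable (at x)" "iter_partial bs g differentiable (at x)" for x
      using f g Cons.prems unfolding schwartz_def smooth_def by auto
    moreover have "iter_partial bs (\<lambda>x. f x + g x) = (\<lambda>x. iter_partial bs f x + iter_partial bs g x)"
      using Cons by simp
    ultimately show ?case by (simp add: partial_deriv_add)
  qed simp
  have "(SUP x. (1 + norm x) ^ N * norm (iter_partial bs (\<lambda>x. f x + g x) x)) \<le>
      (SUP x. (1 + norm x) ^ N * norm (iter_partial bs f x)) + (SUP x. (1 + norm x) ^ N * norm (iter_partial bs g x))"
    if bs: "set bs \<subseteq> Basis" for bs
  proof (rule cSUP_least)
    fix x
    have "(1 + norm x) ^ N * norm (iter_partial bs (\<lambda>x. f x + g x) x) \<le>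
        (1 + norm x) ^ N * norm (iter_partial bs f x) + (1 + norm x) ^ N * norm (iter_partial bs g x)"
      unfolding it[OF bs] distrib_left[symmetric] by (intro mult_left_mono norm_triangle_ineq) simp
    also have "\<dots> \<le> (SUP x. (1 + norm x) ^ N * norm (iter_partial bs f x)) + (SUP x. (1 + norm x) ^ N * norm (iter_partial bs g x))"
      by (intro add_mono cSUP_upper schwartz_bdd_above f g bs UNIV_I)
    finally show "(1 + norm x) ^ N * norm (iter_partial bs (\<lambda>x. f x + g x) x) \<le> \<dots>" .
  qed simp
  then show ?thesis unfolding schwartz_norm_def sum.distrib[symmetric] by (intro sum_mono) auto
qed

lemma schwartz_norm_cmult:
  assumes f: "f \<in> schwartz"
  shows "schwartz_norm N (\<lambda>x. c * f x) = norm c * schwartz_norm N f"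
proof -
  have it: "iter_partial bs (\<lambda>x. c * f x) = (\<lambda>x. c * iter_partial bs f x)" if "set bs \<subseteq> Basis" for bs
    using that
  proof (induction bs)
    case (Cons b bs)
    have "iter_partial bs f differentiable (at x)" for x
      using f Cons.prems unfolding schwartz_def smooth_def by auto
    moreover have "iter_partial bs (\<lambda>x. c * f x) = (\<lambda>x. c * iter_partial bs f x)"
      using Cons by simp
    ultimately show ?case by (simp add: partial_deriv_cmult)
  qed simp
  have "(SUP x. (1 + norm x) ^ N * norm (iter_partial bs (\<lambda>x. c * f x) x)) =
      norm c * (SUP x. (1 + norm x) ^ N * norm (iter_partial bs f x))" if bs: "set bs \<subseteq> Basis" for bs
  proof -
    have "(SUP x. norm c * ((1 + norm x) ^ N * norm (iter_partial bs f x))) =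
        norm c * (SUP x. (1 + norm x) ^ N * norm (iter_partial bs f x))"
      using continuous_at_Sup_mono[of "\<lambda>y. norm c * y" "range (\<lambda>x. (1 + norm x) ^ N * norm (iter_partial bs f x))"]
        schwartz_bdd_above[OF f bs]
      by (simp add: mono_def mult_left_mono continuous_intros image_image)
    then show ?thesis unfolding it[OF bs] by (simp add: norm_mult mult.left_commute)
  qed
  then show ?thesis unfolding schwartz_norm_def sum_distrib_left by (intro sum.cong) auto
qed

text \<open>Multiplication by \<open>|\<xi>|\<close> to the power \<open>s\<close> is continuous on flat Schwartz functions, so the transposed
  functional is bounded there by a Schwartz norm and extends by the Hahn--Banach theorem.\<close>

lemma riesz_op_nonempty:
  fixes f :: "'a::euclidean_space functional"
  assumes f: "f \<in> tempered" "f \<in> F"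
  shows "riesz_op s F \<noteq> {}"
proof -
  let ?L = "\<lambda>\<psi>. f (fourier (\<lambda>\<xi>. weight 0 s \<xi> * \<psi> \<xi>))"
  have fl: "schwartz_flat \<subseteq> schwartz" using schwartz_flatD(1) by blast
  interpret flat: scale "schwartz_flat :: ('a \<Rightarrow> complex) set" schwartz_norm using scale_schwartz[OF fl] .
  interpret full: scale "schwartz :: ('a \<Rightarrow> complex) set" schwartz_norm using scale_schwartz[OF subset_refl] .
  have famw: "flat.schwartz_fam (\<lambda>\<psi> \<xi>. weight 0 s \<xi> * \<psi> \<xi>)"
    by (rule flat.schwartz_fam_weight_flat[OF schwartz_fam_id[OF fl]])
  have ws: "(\<lambda>\<xi>. weight 0 s \<xi> * \<psi> \<xi>) \<in> schwartz" if "\<psi> \<in> schwartz_flat" for \<psi> :: "'a \<Rightarrow> complex"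
    using flat.schwartz_fam_schwartz[OF famw that] .
  have famf: "flat.schwartz_fam (\<lambda>\<psi>. fourier (\<lambda>\<xi>. weight 0 s \<xi> * \<psi> \<xi>))"
    unfolding fourier_eq_ft by (rule flat.schwartz_fam_ft[OF _ famw]) simp
  obtain C0 N where C0: "\<And>\<phi>. \<phi> \<in> schwartz \<Longrightarrow> norm (f \<phi>) \<le> C0 * schwartz_norm N \<phi>"
    using f(1) unfolding tempered_def by blast
  obtain D M where D: "D \<ge> 0" "\<And>\<psi> :: 'a \<Rightarrow> complex. \<psi> \<in> schwartz_flat \<Longrightarrow>
      schwartz_norm N (fourier (\<lambda>\<xi>. weight 0 s \<xi> * \<psi> \<xi>)) \<le> D * schwartz_norm M \<psi>"
    using flat.schwartz_fam_norm_bound[OF famf, of N] by blast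
  \<comment> \<open>The definition of \<open>tempered\<close> puts no sign on its constant, hence
    the absolute value.\<close>
  define C where "C = \<bar>C0\<bar> * D"
  have C: "0 \<le> C" using D(1) by (simp add: C_def)
  have bound: "norm (?L \<psi>) \<le> C * schwartz_norm M \<psi>" if \<psi>: "\<psi> \<in> schwartz_flat" for \<psi>
  proof -
    note fs = schwartz_fourier[OF ws[OF \<psi>]]
    have "norm (?L \<psi>) \<le> C0 * schwartz_norm N (fourier (\<lambda>\<xi>. weight 0 s \<xi> * \<psi> \<xi>))" by (rule C0[OF fs])
    also have "\<dots> \<le> \<bar>C0\<bar> * schwartz_norm N (fourier (\<lambda>\<xi>. weight 0 s \<xi> * \<psi> \<xi>))"
      using full.scale_nonneg[OF fs, of N] by (intro mult_right_mono) auto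
    also have "\<dots> \<le> \<bar>C0\<bar> * (D * schwartz_norm M \<psi>)" by (intro mult_left_mono D(2) \<psi>) simp
    finally show ?thesis by (simp add: C_def mult.assoc)
  qed
  have "\<exists>U. (\<forall>f\<in>schwartz. \<forall>g\<in>schwartz. U (\<lambda>x. f x + g x) = U f + U g) \<and>
      (\<forall>c. \<forall>f\<in>schwartz. U (\<lambda>x. c * f x) = c * U f) \<and>
      (\<forall>\<psi>\<in>schwartz_flat. U \<psi> = ?L \<psi>) \<and> (\<forall>\<psi>\<in>schwartz. norm (U \<psi>) \<le> 2 * (C * schwartz_norm M \<psi>))"
  proof (rule hahn_banach_complex)
    show "(schwartz_flat :: ('a \<Rightarrow> complex) set) \<noteq> {}" using schwartz_flat_0 by blast
    show "C * schwartz_norm M (\<lambda>x. f x + g x) \<le> C * schwartz_norm M f + C * schwartz_norm M g"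
      if "f \<in> schwartz" "g \<in> schwartz" for f g :: "'a \<Rightarrow> complex"
      unfolding distrib_left[symmetric] by (rule mult_left_mono[OF schwartz_norm_add[OF that] C])
    show "C * schwartz_norm M (\<lambda>x. c * f x) = norm c * (C * schwartz_norm M f)"
      if "f \<in> schwartz" for c and f :: "'a \<Rightarrow> complex"
      by (simp add: schwartz_norm_cmult[OF that])
    show "?L (\<lambda>x. \<psi> x + \<kappa> x) = ?L \<psi> + ?L \<kappa>" if "\<psi> \<in> schwartz_flat" "\<kappa> \<in> schwartz_flat" for \<psi> \<kappa>
    proof -
      have "fourier (\<lambda>\<xi>. weight 0 s \<xi> * (\<psi> \<xi> + \<kappa> \<xi>)) =
          (\<lambda>x. fourier (\<lambda>\<xi>. weight 0 s \<xi> * \<psi> \<xi>) x + fourier (\<lambda>\<xi>. weight 0 s \<xi> * \<kappa> \<xi>) x)"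
        unfolding fourier_eq_ft distrib_left using ft_add[OF ws[OF that(1), THEN schwartz_integrable] ws[OF that(2), THEN schwartz_integrable]]
        by blast
      then show ?thesis using tempered_add[OF f(1)] ws[THEN schwartz_fourier] that by simp
    qed
    show "?L (\<lambda>x. c * \<psi> x) = c * ?L \<psi>" if "\<psi> \<in> schwartz_flat" for c \<psi>
    proof -
      have "fourier (\<lambda>\<xi>. weight 0 s \<xi> * (c * \<psi> \<xi>)) = (\<lambda>x. c * fourier (\<lambda>\<xi>. weight 0 s \<xi> * \<psi> \<xi>) x)"
        unfolding fourier_eq_ft mult.left_commute[of _ c] by (rule ext, rule ft_cmult)
      then show ?thesis using f(1) schwartz_fourier[OF ws[OF that]] unfolding tempered_def by simp
    qed
  qed (use fl bound schwartz_add schwartz_cmult schwartz_flat_add schwartz_flat_cmult in blast)+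
  then obtain U where U: "\<And>f g. f \<in> schwartz \<Longrightarrow> g \<in> schwartz \<Longrightarrow> U (\<lambda>x. f x + g x) = U f + U g"
      "\<And>c f. f \<in> schwartz \<Longrightarrow> U (\<lambda>x. c * f x) = c * U f"
      "\<And>\<psi>. \<psi> \<in> schwartz_flat \<Longrightarrow> U \<psi> = ?L \<psi>"
      "\<And>\<psi>. \<psi> \<in> schwartz \<Longrightarrow> norm (U \<psi>) \<le> 2 * (C * schwartz_norm M \<psi>)" by blast
  \<comment> \<open>The extension lives on the frequency side; composing with
    \<open>inv_fourier\<close> makes \<open>U\<close> the Fourier transform of \<open>g\<close>, by
    inversion.\<close>
  define g where "g \<psi> = U (inv_fourier \<psi>)" for \<psi>
  have "g \<in> tempered"
    unfolding tempered_def
  proof (intro CollectI conjI ballI allI)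
    fix \<psi> \<kappa> :: "'a \<Rightarrow> complex" assume s: "\<psi> \<in> schwartz" "\<kappa> \<in> schwartz"
    have "inv_fourier (\<lambda>x. \<psi> x + \<kappa> x) = (\<lambda>x. inv_fourier \<psi> x + inv_fourier \<kappa> x)"
      unfolding inv_fourier_eq_ft using ft_add[OF s[THEN schwartz_integrable]] by blast
    then show "g (\<lambda>x. \<psi> x + \<kappa> x) = g \<psi> + g \<kappa>"
      unfolding g_def using U(1) s[THEN schwartz_inv_fourier] by simp
  next
    fix c and \<psi> :: "'a \<Rightarrow> complex" assume s: "\<psi> \<in> schwartz"
    have "inv_fourier (\<lambda>x. c * \<psi> x) = (\<lambda>x. c * inv_fourier \<psi> x)"
      unfolding inv_fourier_eq_ft by (rule ext, rule ft_cmult)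
    then show "g (\<lambda>x. c * \<psi> x) = c * g \<psi>" unfolding g_def using U(2) schwartz_inv_fourier[OF s] by simp
  next
    have "full.schwartz_fam inv_fourier"
      unfolding inv_fourier_eq_ft by (rule full.schwartz_fam_ft[OF _ schwartz_fam_id[OF subset_refl]]) simp
    from full.schwartz_fam_norm_bound[OF this, of M] obtain D' K where
      D': "\<And>\<psi> :: 'a \<Rightarrow> complex. \<psi> \<in> schwartz \<Longrightarrow> schwartz_norm M (inv_fourier \<psi>) \<le> D' * schwartz_norm K \<psi>" by blast
    show "\<exists>C N. \<forall>\<psi>\<in>schwartz. norm (g \<psi>) \<le> C * schwartz_norm N \<psi>"
    proof (intro exI ballI)
      fix \<psi> :: "'a \<Rightarrow> complex" assume \<psi>: "\<psi> \<in> schwartz"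
      have "norm (g \<psi>) \<le> 2 * (C * schwartz_norm M (inv_fourier \<psi>))"
        unfolding g_def by (rule U(4)[OF schwartz_inv_fourier[OF \<psi>]])
      also have "\<dots> \<le> 2 * (C * (D' * schwartz_norm K \<psi>))" by (intro mult_left_mono D' \<psi> C) simp
      finally show "norm (g \<psi>) \<le> (2 * C * D') * schwartz_norm K \<psi>" by (simp add: mult.assoc)
    qed
  qed
  moreover have "fourier_dist g \<psi> = mult_dist (\<lambda>\<xi>. of_real (norm \<xi> powr s)) (fourier_dist f) \<psi>"
    if "\<psi> \<in> schwartz_flat" for \<psi>
    using that by (simp add: fourier_dist_def mult_dist_def g_def inv_fourier_fourier[OF schwartz_flatD(1)] U(3) weight_0)
  ultimately have "g \<in> riesz_op s F" unfolding riesz_op_def using f(2) by blast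
  then show ?thesis by blast
qed

section \<open>The homogeneous scale\<close>

definition hom_weighted :: "('a::euclidean_space \<Rightarrow> complex) \<Rightarrow> real \<Rightarrow> real \<Rightarrow> 'a functional \<Rightarrow> ennreal" where
  "hom_weighted \<phi> \<gamma> s u = (SUP j::int. ennreal (2 powr (of_int j * \<gamma>)) *
     block_norm \<phi> 0 s j u)"

lemma hom_weighted_le:
  fixes \<phi> :: "'a::euclidean_space \<Rightarrow> complex"
  assumes \<phi>: "lp_annulus \<phi>"
  shows "\<exists>C>0. \<forall>u. hom_weighted \<phi> (\<gamma> - t) (s + t) u \<le> ennreal C * hom_weighted \<phi> \<gamma> s u"
proof -
  obtain B where B: "B > 0" "\<And>e j u. 0 \<le> e \<Longrightarrow> 2 powi (- j) * e \<le> 1 \<Longrightarrow>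
    block_norm \<phi> e (s + t) j u \<le>
    ennreal (B * 2 powr (of_int j * t)) *
      block_norm \<phi> e s j u"
    using block_estimate[OF \<phi>] by blast
  show ?thesis
    unfolding hom_weighted_def
    by (intro exI[of _ B] conjI allI B(1) dyadic_SUP_le B(2)) simp_all
qed

text \<open>The annulus stays away from the origin, so a block tests a distribution only against
  transforms of flat functions. The second part says the same after a power of |\<xi>| has been
  inserted.\<close>

lemma lp_block_flat:
  assumes \<phi>: "lp_annulus \<phi>" and \<psi>: "\<psi> \<in> schwartz"
  shows "(\<lambda>\<xi>. \<phi> ((2 powi (- j)) *\<^sub>R \<xi>) * inv_fourier \<psi> \<xi>) \<in> schwartz_flat"
    and "(\<lambda>\<xi>. weight 0 s \<xi> * (\<phi> ((2 powi (- j)) *\<^sub>R \<xi>) * inv_fourier \<psi> \<xi>)) \<in> schwartz_flat"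
proof -
  let ?k = "\<lambda>\<xi>. \<phi> ((2 powi (- j)) *\<^sub>R \<xi>) * inv_fourier \<psi> \<xi>"
  \<comment> \<open>This is the inner radius 2^(j - 1) of the dilated annulus.\<close>
  define r where "r = 1 / (2 * 2 powi (- j)) * (1::real)"
  have r: "0 < r" by (simp add: r_def)
  have s: "?k \<in> schwartz" by (rule schwartz_mult[OF lp_annulus_dilate_schwartz[OF \<phi>] schwartz_inv_fourier[OF \<psi>]])
  have v: "?k \<xi> = 0" if "norm \<xi> < r" for \<xi>
  proof (rule ccontr)
    assume "?k \<xi> \<noteq> 0"
    then have "\<phi> ((2 powi (- j)) *\<^sub>R \<xi>) \<noteq> 0" by auto
    then have "1 / 2 \<le> norm ((2 powi (- j)) *\<^sub>R \<xi>)" using \<phi> unfolding lp_annulus_def by blast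
    moreover have "norm ((2 powi (- j)) *\<^sub>R \<xi>) = 2 powi (- j) * norm \<xi>" by simp
    moreover have "2 powi (- j) * norm \<xi> < 2 powi (- j) * r" using that by (intro mult_strict_left_mono) auto
    moreover have "2 powi (- j) * r = 1 / 2" by (simp add: r_def)
    ultimately show False by linarith
  qed
  show fl: "?k \<in> schwartz_flat" by (rule vanishing_near_0_flat[OF s r v])
  interpret scale "{()}" "\<lambda>_ _. 1" by (rule scale_1)
  have "schwartz_fam (\<lambda>_ \<xi>. weight 0 s \<xi> * ?k \<xi>)"
    by (rule schwartz_fam_weight_flat) (use fl s schwartz_iff_fam in blast)+
  then have "(\<lambda>\<xi>. weight 0 s \<xi> * ?k \<xi>) \<in> schwartz" unfolding schwartz_iff_fam .
  then show "(\<lambda>\<xi>. weight 0 s \<xi> * ?k \<xi>) \<in> schwartz_flat"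
    by (rule vanishing_near_0_flat[OF _ r]) (simp only: v mult_zero_right)
qed

lemma hom_lip_norm_const:
  assumes "F \<noteq> {}" "\<And>g j. g \<in> F \<Longrightarrow> Linf_norm (lp_block \<phi> j g) = block_norm \<phi> 0 s j f"
  shows "hom_lip_norm \<phi> \<gamma> F = hom_weighted \<phi> \<gamma> s f"
proof -
  have "(\<lambda>g. SUP j::int. ennreal (2 powr (of_int j * \<gamma>)) * Linf_norm (lp_block \<phi> j g)) ` F = {hom_weighted \<phi> \<gamma> s f}"
    using assms by (auto simp: hom_weighted_def image_iff)
  then show ?thesis by (simp add: hom_lip_norm_def)
qed

lemma tempered_poly_equiv_refl: "f \<in> tempered \<Longrightarrow> (f, f) \<in> poly_equiv"
  unfolding poly_equiv_def by (auto intro!: exI[of _ "\<lambda>_. 0"] simp: regular_dist_def)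

text \<open>On a block, the relation defining \<open>riesz_op\<close> may be used because the test
  function is flat. Multiplication by the power keeps it flat, so the representative
  \<open>h\<close> chosen there can be exchanged for \<open>f\<close>.\<close>

lemma hom_lip_norm_class:
  fixes f :: "'a::euclidean_space functional"
  assumes \<phi>: "lp_annulus \<phi>" and f: "f \<in> tempered"
  shows "hom_lip_norm \<phi> \<gamma> (poly_equiv `` {f}) = hom_weighted \<phi> \<gamma> 0 f"
    and "hom_lip_norm \<phi> \<gamma> (riesz_op s (poly_equiv `` {f})) = hom_weighted \<phi> \<gamma> s f"
proof -
  have ff: "f \<in> poly_equiv `` {f}" using tempered_poly_equiv_refl[OF f] by blast
  show "hom_lip_norm \<phi> \<gamma> (poly_equiv `` {f}) = hom_weighted \<phi> \<gamma> 0 f"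
  proof (rule hom_lip_norm_const)
    show "poly_equiv `` {f} \<noteq> {}" using ff by blast
    fix g and j :: int assume "g \<in> poly_equiv `` {f}"
    then have fg: "(f, g) \<in> poly_equiv" by simp
    \<comment> \<open>By the convention \<open>0 powr 0 = 0\<close>, the weight of order 0 is 1 only
      off the origin; at the origin the cutoff vanishes as well.\<close>
    have w: "weight 0 0 \<xi> * \<phi> ((2 powi (- j)) *\<^sub>R \<xi>) = \<phi> ((2 powi (- j)) *\<^sub>R \<xi>)" for \<xi>
      using \<phi> unfolding lp_annulus_def by (cases "\<xi> = 0") (force simp: weight_0)+
    show "Linf_norm (lp_block \<phi> j g) = block_norm \<phi> 0 0 j f"
      unfolding lp_block_def w
      by (rule Linf_norm_cong) (simp only: fourier_multiplier_apply poly_equiv_fourier_flat[OF fg lp_block_flat(1)[OF \<phi>]])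
  qed
  show "hom_lip_norm \<phi> \<gamma> (riesz_op s (poly_equiv `` {f})) = hom_weighted \<phi> \<gamma> s f"
  proof (rule hom_lip_norm_const)
    show "riesz_op s (poly_equiv `` {f}) \<noteq> {}" by (rule riesz_op_nonempty[OF f ff])
    fix g and j :: int assume "g \<in> riesz_op s (poly_equiv `` {f})"
    then obtain h where h: "(f, h) \<in> poly_equiv" "\<And>\<psi>. \<psi> \<in> schwartz_flat \<Longrightarrow>
       fourier_dist g \<psi> = mult_dist (\<lambda>\<xi>. of_real (norm \<xi> powr s)) (fourier_dist h) \<psi>"
      unfolding riesz_op_def by blast
    show "Linf_norm (lp_block \<phi> j g) = block_norm \<phi> 0 s j f"
    proof (rule Linf_norm_cong)
      fix \<psi> :: "'a \<Rightarrow> complex" assume \<psi>: "\<psi> \<in> schwartz"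
      let ?k = "\<lambda>\<xi>. \<phi> ((2 powi (- j)) *\<^sub>R \<xi>) * inv_fourier \<psi> \<xi>"
      have "lp_block \<phi> j g \<psi> = fourier_dist g ?k"
        by (simp only: lp_block_def fourier_multiplier_apply fourier_dist_def)
      also have "\<dots> = h (fourier (\<lambda>\<xi>. weight 0 s \<xi> * ?k \<xi>))"
        unfolding h(2)[OF lp_block_flat(1)[OF \<phi> \<psi>]] by (simp only: mult_dist_def fourier_dist_def weight_0)
      also have "\<dots> = f (fourier (\<lambda>\<xi>. weight 0 s \<xi> * ?k \<xi>))"
        using poly_equiv_fourier_flat[OF h(1) lp_block_flat(2)[OF \<phi> \<psi>]] by (simp only:)
      also have "\<dots> = fourier_multiplier (\<lambda>\<xi>. weight 0 s \<xi> * \<phi> ((2 powi (- j)) *\<^sub>R \<xi>)) f \<psi>"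
        by (simp only: fourier_multiplier_apply mult.assoc)
      finally show "lp_block \<phi> j g \<psi> = fourier_multiplier (\<lambda>\<xi>. weight 0 s \<xi> * \<phi> ((2 powi (- j)) *\<^sub>R \<xi>)) f \<psi>" .
    qed
  qed
qed

text \<open>For \<open>e = 0\<close> the rescaled parameter is 0 on every block, so the estimate
  covers all integers \<open>j\<close> and leaves no low-frequency term. Allowing negative
  \<open>s\<close> also gives the version with the potential on the other side.\<close>

lemma hom_comparable:
  assumes \<phi>: "lp_annulus \<phi>"
  shows "comparable_on tempered_mod_poly (\<lambda>F. hom_lip_norm \<phi> \<gamma> F) (\<lambda>F. hom_lip_norm \<phi> (\<gamma> - s) (riesz_op s F))"
proof (rule comparable_onI)
  have cls: "\<exists>f\<in>tempered. F = poly_equiv `` {f}" if "F \<in> tempered_mod_poly" for F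
    using that unfolding tempered_mod_poly_def by (rule quotientE) blast
  obtain C where C: "C > 0" "\<And>u. hom_weighted \<phi> (\<gamma> - s) (0 + s) u \<le> ennreal C * hom_weighted \<phi> \<gamma> 0 u"
    using hom_weighted_le[OF \<phi>] by blast
  show "\<exists>C>0. \<forall>F\<in>tempered_mod_poly. hom_lip_norm \<phi> (\<gamma> - s) (riesz_op s F) \<le> ennreal C * hom_lip_norm \<phi> \<gamma> F"
    using C cls hom_lip_norm_class[OF \<phi>] by (intro exI[of _ C] conjI ballI) fastforce+
  obtain D where D: "D > 0" "\<And>u. hom_weighted \<phi> ((\<gamma> - s) - (- s)) (s + (- s)) u \<le> ennreal D * hom_weighted \<phi> (\<gamma> - s) s u"
    using hom_weighted_le[OF \<phi>] by blast
  show "\<exists>C>0. \<forall>F\<in>tempered_mod_poly. hom_lip_norm \<phi> \<gamma> F \<le> ennreal C * hom_lip_norm \<phi> (\<gamma> - s) (riesz_op s F)"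
    using D cls hom_lip_norm_class[OF \<phi>] by (intro exI[of _ D] conjI ballI) fastforce+
qed

theorem theorem19p1:
  fixes \<phi> \<eta> :: "'a::euclidean_space \<Rightarrow> complex" and \<gamma> \<sigma> :: real
  assumes "lp_annulus \<phi>" and "lp_ball \<eta>"
    and "0 < \<gamma>" and "0 < \<sigma>" and "\<sigma> < \<gamma>"
  shows
    "comparable_on tempered_mod_poly
       (\<lambda>F. hom_lip_norm \<phi> \<gamma> F) (\<lambda>F. hom_lip_norm \<phi> (\<gamma> - \<sigma>) (riesz_op \<sigma> F)) \<and>
     comparable_on tempered_mod_poly
       (\<lambda>G. hom_lip_norm \<phi> \<gamma> (riesz_op (- \<sigma>) G)) (\<lambda>G. hom_lip_norm \<phi> (\<gamma> - \<sigma>) G) \<and>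
     comparable_on tempered
       (\<lambda>f. inhom_lip_norm \<phi> \<eta> \<gamma> f) (\<lambda>f. inhom_lip_norm \<phi> \<eta> (\<gamma> - \<sigma>) (bessel_op \<sigma> f)) \<and>
     comparable_on tempered
       (\<lambda>g. inhom_lip_norm \<phi> \<eta> \<gamma> (bessel_op (- \<sigma>) g)) (\<lambda>g. inhom_lip_norm \<phi> \<eta> (\<gamma> - \<sigma>) g)"
  using hom_comparable[OF assms(1), of \<gamma> \<sigma>] comparable_on_sym[OF hom_comparable[OF assms(1), of "\<gamma> - \<sigma>" "- \<sigma>"]]
    inhom_comparable[OF assms(1,2), of \<gamma> \<sigma>] comparable_on_sym[OF inhom_comparable[OF assms(1,2), of "\<gamma> - \<sigma>" "- \<sigma>"]]
  by simp

end
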